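(* Let $p\in S_n$ be a pattern avoiding $1324$. If for at least one choice of $q$ among $p,\ p^{-1},\ p^{\mathrm{rc}},\ (p^{\mathrm{rc}})^{-1}$ one of the following conditions holds, then $p$ is $f$-incompatible: (a) $\mathrm{comp}(q)\ge 3$. (b) $q_1<n$ and $\mathrm{comp}(q\smallsetminus q_1)>\mathrm{comp}(q)$. (c) $q_1>1$, $\mathrm{comp}(q)=2$, and the first component of $q$ begins with its largest entry. (d) $1<q_1<n$ and $q\smallsetminus q_1$ avoids $213$. In cases (b), (c) and (d), if $q$ is chosen as $p^{\mathrm{rc}}$ or $(p^{\mathrm{rc}})^{-1}$, it is required further that $q_1<n-1$.
   Context: Notation. $\mathrm{Av}(B)$ is the set of permutations avoiding all patterns in $B$ (no subsequence order-isomorphic to a pattern in $B$). For $\pi\in S_n$ and a value $e\in[n]$, $\pi\smallsetminus e$ is the permutation order-isomorphic to the sequence obtained by deleting the entry with value $e$ from $\pi$. The direct sum $\sigma\oplus\tau$ of $\sigma\in S_a,\tau\in S_b$ is $\sigma$ followed by $\tau$ with all values shifted up by $a$. A permutation is decomposable if it is a direct sum of two nonempty permutations, and indecomposable otherwise. Every permutation is uniquely a direct sum of nonempty indecomposable permutations, called its components; $\mathrm{comp}(\pi)$ is their number. $\mathrm{id}_m$ is the identity permutation of length $m$ ($\mathrm{id}_0$ is empty). The reverse-complement of $\pi\in S_n$ is $\pi^{\mathrm{rc}}$ with $\pi^{\mathrm{rc}}_i=n+1-\pi_{n+1-i}$. A permutation $\pi\in S_n$ is almost decomposable if it is indecomposable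 but $\pi\smallsetminus e$ is decomposable for some $e\in\{1,\pi_1,n,\pi_n\}$. The map $f$. Every decomposable $1324$-avoider can be written uniquely as $\pi=\sigma\oplus\mathrm{id}_m\oplus\tau$ with $m\ge0$, $\sigma$ an indecomposable $132$-avoider and $\tau$ an indecomposable $213$-avoider (both nonempty); set $\widetilde f(\pi)=\sigma\oplus\mathrm{id}_{m+1}\oplus\tau$. For a decomposable $1324$-avoider set $f(\pi)=\widetilde f(\pi)$. For an almost decomposable $1324$-avoider $\pi$ define $f(\pi)$ (of length $|\pi|+1$) as follows: (1) if $\pi\smallsetminus\pi_1$ is decomposable, $f(\pi)$ is the permutation with $f(\pi)_1=\pi_1$ and $f(\pi)\smallsetminus\pi_1=\widetilde f(\pi\smallsetminus\pi_1)$; (2) if $\pi\smallsetminus 1$ is decomposable, $f(\pi)=f(\pi^{-1})^{-1}$; (3) otherwise (both $\pi\smallsetminus\pi_1$ and $\pi\smallsetminus1$ indecomposable), $f(\pi)=f(\pi^{\mathrm{rc}})^{\mathrm{rc}}$. (For almost decomposable $1324$-avoiders, cases (1) and (2) cannot occur simultaneously.) A pattern $p$ is $f$-compatible if $f(\pi)$ avoids $p$ for every decomposable or almost decomposable permutation $\pi\in\mathrm{Av}(1324,p)$; otherwise it is $f$-incompatible. *)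

theory Defs
  imports "HOL-Library.Sublist" "HOL-Combinatorics.Combinatorics"
begin

text \<open>Permutations of length \<open>n\<close> are lists in one-line notation with entries \<open>1, \<dots>, n\<close>.
  So \<open>\<pi>\<^sub>1\<close> is \<open>hd \<pi>\<close> and \<open>\<pi>\<^sub>n\<close> is \<open>last \<pi>\<close>.\<close>

definition perms :: "nat \<Rightarrow> nat list set" where
  "perms n = permutations_of_set {1..n}"

definition order_iso :: "nat list \<Rightarrow> nat list \<Rightarrow> bool" where
  "order_iso s t \<longleftrightarrow> length s = length t \<and>
     (\<forall>i<length s. \<forall>j<length s. s ! i < s ! j \<longleftrightarrow> t ! i < t ! j)"

definition avoids :: "nat list \<Rightarrow> nat list \<Rightarrow> bool" where
  "avoids \<pi> p \<longleftrightarrow> \<not> (\<exists>s. subseq s \<pi> \<and> order_iso s p)"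

text \<open>For a list of distinct numbers, the permutation order-isomorphic to it:
  each entry is replaced by its rank.\<close>

definition standardize :: "nat list \<Rightarrow> nat list" where
  "standardize s = map (\<lambda>x. card {y \<in> set s. y \<le> x}) s"

definition del :: "nat list \<Rightarrow> nat \<Rightarrow> nat list" where
  "del \<pi> e = standardize (removeAll e \<pi>)"

definition inv_perm :: "nat list \<Rightarrow> nat list" where
  "inv_perm \<pi> = map (\<lambda>v. Suc (THE i. i < length \<pi> \<and> \<pi> ! i = v)) [1..<Suc (length \<pi>)]"

definition rc :: "nat list \<Rightarrow> nat list" where
  "rc \<pi> = map (\<lambda>x. length \<pi> + 1 - x) (rev \<pi>)"

definition id_perm :: "nat \<Rightarrow> nat list" where
  "id_perm m = [1..<Suc m]"

definition dsum :: "nat list \<Rightarrow> nat list \<Rightarrow> nat list" where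
  "dsum \<sigma> \<tau> = \<sigma> @ map (\<lambda>x. x + length \<sigma>) \<tau>"

definition decomposable :: "nat list \<Rightarrow> bool" where
  "decomposable \<pi> \<longleftrightarrow>
     (\<exists>a b. a > 0 \<and> b > 0 \<and> (\<exists>\<sigma>\<in>perms a. \<exists>\<tau>\<in>perms b. \<pi> = dsum \<sigma> \<tau>))"

definition nonempty_indecomposable :: "nat list \<Rightarrow> bool" where
  "nonempty_indecomposable \<pi> \<longleftrightarrow> (\<exists>n>0. \<pi> \<in> perms n) \<and> \<not> decomposable \<pi>"

definition components :: "nat list \<Rightarrow> nat list list" where
  "components \<pi> =
     (THE cs. (\<forall>c\<in>set cs. nonempty_indecomposable c) \<and> \<pi> = foldr dsum cs [])"

definition comp_num :: "nat list \<Rightarrow> nat" where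
  "comp_num \<pi> = length (components \<pi>)"

definition almost_decomposable :: "nat list \<Rightarrow> bool" where
  "almost_decomposable \<pi> \<longleftrightarrow> \<not> decomposable \<pi> \<and>
     (\<exists>e\<in>{1, hd \<pi>, length \<pi>, last \<pi>}. decomposable (del \<pi> e))"

definition f_tilde :: "nat list \<Rightarrow> nat list" where
  "f_tilde \<pi> = (THE \<rho>. \<exists>\<sigma> m \<tau>.
     nonempty_indecomposable \<sigma> \<and> avoids \<sigma> [1,3,2] \<and>
     nonempty_indecomposable \<tau> \<and> avoids \<tau> [2,1,3] \<and>
     \<pi> = dsum \<sigma> (dsum (id_perm m) \<tau>) \<and>
     \<rho> = dsum \<sigma> (dsum (id_perm (m + 1)) \<tau>))"

text \<open>The map \<open>f\<close> is built in stages instead of by recursion. In its case (2) the permutation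
  \<open>\<pi>\<^sup>-\<^sup>1\<close> is in case (1), because deleting its first entry gives the inverse of \<open>\<pi>\<close> with the value 1
  deleted; similarly, in case (3) the permutation \<open>\<pi>\<^sup>r\<^sup>c\<close> is in case (1) or (2). The values of
  \<open>f_map\<close> are meaningful only on decomposable or almost decomposable 1324-avoiders.\<close>

definition f_case1 :: "nat list \<Rightarrow> nat list" where
  "f_case1 \<pi> = (THE \<rho>. \<rho> \<in> perms (length \<pi> + 1) \<and> hd \<rho> = hd \<pi> \<and>
     del \<rho> (hd \<pi>) = f_tilde (del \<pi> (hd \<pi>)))"

definition f_case12 :: "nat list \<Rightarrow> nat list" where
  "f_case12 \<pi> =
     (if decomposable (del \<pi> (hd \<pi>)) then f_case1 \<pi>
      else inv_perm (f_case1 (inv_perm \<pi>)))"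

definition f_map :: "nat list \<Rightarrow> nat list" where
  "f_map \<pi> =
     (if decomposable \<pi> then f_tilde \<pi>
      else if decomposable (del \<pi> (hd \<pi>)) \<or> decomposable (del \<pi> 1) then f_case12 \<pi>
      else rc (f_case12 (rc \<pi>)))"

definition f_compatible :: "nat list \<Rightarrow> bool" where
  "f_compatible p \<longleftrightarrow>
     (\<forall>n. \<forall>\<pi>\<in>perms n. (decomposable \<pi> \<or> almost_decomposable \<pi>) \<and>
        avoids \<pi> [1,3,2,4] \<and> avoids \<pi> p \<longrightarrow> avoids (f_map \<pi>) p)"

abbreviation f_incompatible :: "nat list \<Rightarrow> bool" where
  "f_incompatible p \<equiv> \<not> f_compatible p"

definition cond_a :: "nat list \<Rightarrow> bool" where
  "cond_a q \<longleftrightarrow> comp_num q \<ge> 3"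

definition cond_b :: "nat list \<Rightarrow> bool" where
  "cond_b q \<longleftrightarrow> hd q < length q \<and> comp_num (del q (hd q)) > comp_num q"

definition cond_c :: "nat list \<Rightarrow> bool" where
  "cond_c q \<longleftrightarrow> hd q > 1 \<and> comp_num q = 2 \<and>
     hd (hd (components q)) = Max (set (hd (components q)))"

definition cond_d :: "nat list \<Rightarrow> bool" where
  "cond_d q \<longleftrightarrow> 1 < hd q \<and> hd q < length q \<and> avoids (del q (hd q)) [2,1,3]"

end

theory Submission
  imports Defs
begin

text \<open>Each witness against compatibility has the form \<open>\<pi> = a \<rho>\<close> with \<open>\<rho> = \<alpha> \<oplus> \<tau>\<close> (up to standardization), where
  \<open>\<tau>\<close> is the last component of \<open>\<rho>\<close> and the first entry \<open>a\<close> exceeds at least one entry of \<open>\<tau>\<close>. Then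
  \<open>\<pi>\<close> is almost decomposable and \<open>f(\<pi>)\<close> has the same first entry, followed by \<open>\<alpha> \<oplus> 1 \<oplus> \<tau>\<close>; relative to
  \<open>\<tau>\<close> that entry drops by one. For conditions (b) and (c), \<open>\<pi>\<close> starts with \<open>q\<^sub>1 + 1\<close> and
  \<open>\<pi> \<setminus> \<pi>\<^sub>1 = q \<setminus> q\<^sub>1\<close>; for (d) with \<open>q \<setminus> q\<^sub>1\<close> indecomposable, \<open>\<pi>\<close> starts with \<open>q\<^sub>1 + 2\<close> and
  \<open>\<pi> \<setminus> \<pi>\<^sub>1 = 1 \<oplus> (q \<setminus> q\<^sub>1)\<close>; condition (a) is immediate. Inverses are harmless because the deletion of
  \<open>1\<close> leaves \<open>\<pi>\<close> indecomposable. The bound \<open>q\<^sub>1 < n - 1\<close> keeps \<open>a\<close> from being the maximum of \<open>\<pi>\<close>, whose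
  deletion would be a decomposition. If \<open>\<pi>\<close> still becomes decomposable when its last entry or its maximum is deleted,
  then \<open>q\<^sup>r\<^sup>c\<close> or its inverse has a witness of the above form itself, so \<open>f(\<pi>\<^sup>r\<^sup>c)\<close> is not needed.\<close>

subsection \<open>Permutations, order isomorphism and pattern containment\<close>

text \<open>The entry inserted by f lies above \<alpha> but below a and \<tau>, so omitting it from
  f(\<pi>) costs a one unit of rank and leaves the order within and between \<alpha> and \<tau>
  intact. With a = q_1 + 1 this recovers q, while \<pi> avoids q simply because the two have equal
  length and different first entries. The insertion needs two components behind the first entry. If
  \<open>tl q\<close> is indecomposable, an additional 1 must supply the first of them; it raises
  the start once more and makes avoidance a counting argument.

  The obstacle on the reversed side is the precedence of cases (1) and (2) in f:
  \<open>rc \<pi>\<close> is sent back to \<pi> only if \<pi> stays indecomposable when its last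
  entry or its maximum is deleted. In the remaining overlap 1324-avoidance excludes all cuts that
  would keep the reversed pattern from having a witness.

  Everything is expressed by cut positions. They are unchanged by inversion, mirrored by
  reverse-complement, and one fewer than the components of a nonempty permutation, so the conditions
  become statements about \<open>splits q\<close> and \<open>splits (tl q)\<close>.\<close>

lemma perms_iff: "\<pi> \<in> perms n \<longleftrightarrow> distinct \<pi> \<and> set \<pi> = {1..n}"
  by (auto simp: perms_def permutations_of_set_def)

lemma length_perms: "\<pi> \<in> perms n \<Longrightarrow> length \<pi> = n"
  by (metis card_atLeastAtMost diff_Suc_1 distinct_card perms_iff)

lemma perms_nth: "\<pi> \<in> perms n \<Longrightarrow> i < n \<Longrightarrow> 1 \<le> \<pi> ! i \<and> \<pi> ! i \<le> n"
  by (metis atLeastAtMost_iff length_perms nth_mem perms_iff)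

lemma perms_surj: 
  assumes "\<pi> \<in> perms n" "1 \<le> v" "v \<le> n"
  obtains i where "i < n" "\<pi> ! i = v"
  by (metis assms atLeastAtMost_iff in_set_conv_nth length_perms perms_iff)

lemma permsI: "distinct s \<Longrightarrow> set s \<subseteq> {1..length s} \<Longrightarrow> s \<in> perms (length s)"
  by (metis card_atLeastAtMost card_subset_eq diff_Suc_1 distinct_card finite_atLeastAtMost perms_iff)

lemma perms_hd_last:
  assumes "s \<in> perms n" "n > 0" shows "hd s \<in> {1..n}" "last s \<in> {1..n}"
proof -
  have "s \<noteq> []" "set s = {1..n}" using assms length_perms[OF assms(1)] perms_iff by auto
  then show "hd s \<in> {1..n}" "last s \<in> {1..n}" using hd_in_set last_in_set by metis+
qed

lemma order_iso_length: "order_iso s t \<Longrightarrow> length s = length t"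
  by (simp add: order_iso_def)

lemma order_iso_sym: "order_iso s t \<Longrightarrow> order_iso t s"
  by (simp add: order_iso_def)

lemma order_iso_trans: "order_iso s t \<Longrightarrow> order_iso t u \<Longrightarrow> order_iso s u"
  by (simp add: order_iso_def)

lemma order_iso_map:
  assumes "strict_mono_on (set s) f" shows "order_iso (map f s) s"
  using assms unfolding order_iso_def
  by (auto simp: strict_mono_on_less)

text \<open>Recovers an entry from comparisons alone; hence each order type contains only one
  permutation.\<close>

lemma perms_nth_eq_card:
  assumes "\<pi> \<in> perms n" "i < n"
  shows "\<pi> ! i = card {j. j < n \<and> \<pi> ! j \<le> \<pi> ! i}"
proof -
  have l: "length \<pi> = n" and d: "distinct \<pi>" and s: "set \<pi> = {1..n}"
    using assms length_perms perms_iff by auto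
  have "(!) \<pi> ` {j. j < n \<and> \<pi> ! j \<le> \<pi> ! i} = {1..\<pi> ! i}"
  proof
    show "(!) \<pi> ` {j. j < n \<and> \<pi> ! j \<le> \<pi> ! i} \<subseteq> {1..\<pi> ! i}"
      using perms_nth[OF assms(1)] by auto
    show "{1..\<pi> ! i} \<subseteq> (!) \<pi> ` {j. j < n \<and> \<pi> ! j \<le> \<pi> ! i}"
    proof
      fix v assume v: "v \<in> {1..\<pi> ! i}"
      with perms_nth[OF assms] have "1 \<le> v" "v \<le> n" by auto
      from perms_surj[OF assms(1) this] obtain j where "j < n" "\<pi> ! j = v" .
      with v show "v \<in> (!) \<pi> ` {j. j < n \<and> \<pi> ! j \<le> \<pi> ! i}" by auto
    qed
  qed
  moreover have "inj_on ((!) \<pi>) {j. j < n \<and> \<pi> ! j \<le> \<pi> ! i}"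
    using d l by (auto simp: inj_on_def nth_eq_iff_index_eq)
  ultimately show ?thesis
    by (metis card_atLeastAtMost card_image diff_Suc_1)
qed

lemma order_iso_perms_eq:
  assumes "s \<in> perms n" "t \<in> perms n" "order_iso s t"
  shows "s = t"
proof (rule nth_equalityI)
  have l: "length s = n" "length t = n" using assms length_perms by auto
  then show "length s = length t" by simp
  fix i assume i: "i < length s"
  have "{j. j < n \<and> s ! j \<le> s ! i} = {j. j < n \<and> t ! j \<le> t ! i}"
    using assms(3) i l unfolding order_iso_def by (auto simp flip: not_less)
  then show "s ! i = t ! i"
    using perms_nth_eq_card[OF assms(1)] perms_nth_eq_card[OF assms(2)] i l by metis
qed

lemma standardize_strict_mono:
  fixes s :: "nat list"
  shows "strict_mono_on (set s) (\<lambda>x. card {y \<in> set s. y \<le> x})"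
proof (rule strict_mono_onI)
  fix x z assume "x \<in> set s" "z \<in> set s" "x < z"
  then have "{y \<in> set s. y \<le> x} \<subseteq> {y \<in> set s. y \<le> z}"
    and "z \<in> {y \<in> set s. y \<le> z}" "z \<notin> {y \<in> set s. y \<le> x}" by auto
  then have "{y \<in> set s. y \<le> x} \<subset> {y \<in> set s. y \<le> z}" by blast
  then show "card {y \<in> set s. y \<le> x} < card {y \<in> set s. y \<le> z}"
    by (intro psubset_card_mono) auto
qed

lemma order_iso_standardize: "order_iso (standardize s) s"
  unfolding standardize_def by (rule order_iso_map[OF standardize_strict_mono])

lemma length_standardize [simp]: "length (standardize s) = length s"
  by (simp add: standardize_def)

lemma standardize_perms:
  assumes "distinct s" shows "standardize s \<in> perms (length s)"
proof -
  have "distinct (standardize s)"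
    unfolding standardize_def distinct_map
    using assms strict_mono_on_imp_inj_on[OF standardize_strict_mono[of s]] by simp
  moreover have "set (standardize s) \<subseteq> {1..length s}"
  proof
    fix v assume "v \<in> set (standardize s)"
    then obtain x where x: "x \<in> set s" "v = card {y \<in> set s. y \<le> x}"
      by (auto simp: standardize_def)
    have "v \<le> card (set s)" unfolding x by (intro card_mono) auto
    moreover have "v > 0" using x by (auto simp: card_gt_0_iff)
    ultimately show "v \<in> {1..length s}" using distinct_card[OF assms] by simp
  qed
  ultimately show ?thesis using permsI[of "standardize s"] by simp
qed

lemma standardize_eqI: "t \<in> perms n \<Longrightarrow> distinct s \<Longrightarrow> order_iso s t \<Longrightarrow> standardize s = t"
  using order_iso_perms_eq standardize_perms order_iso_trans order_iso_standardize
  by (metis length_perms order_iso_length)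

lemma del_perms:
  assumes "\<pi> \<in> perms n" "e \<in> {1..n}" shows "del \<pi> e \<in> perms (n - 1)"
proof -
  have d: "distinct \<pi>" "e \<in> set \<pi>" using assms by (auto simp: perms_iff)
  then have "length (removeAll e \<pi>) = n - 1"
    using length_perms[OF assms(1)]
    by (metis distinct_remove1_removeAll length_remove1)
  then show ?thesis
    unfolding del_def using standardize_perms[of "removeAll e \<pi>"] d
    by (simp add: distinct_removeAll)
qed

lemma map_nth_sorted_eq_nths: "map ((!) s) (filter (\<lambda>i. i \<in> N) [0..<length s]) = nths s N"
proof -
  have "zip s [0..<length s] = map (\<lambda>i. (s ! i, i)) [0..<length s]"
    by (rule nth_equalityI) auto
  then show ?thesis
    by (simp add: nths_def filter_map comp_def)
qed

lemma strict_mono_on_sorted_map: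
  fixes g :: "nat \<Rightarrow> nat"
  assumes "strict_mono_on {..<k} g" 
  shows "sorted (map g [0..<k]) \<and> distinct (map g [0..<k])"
  using assms strict_mono_on_imp_inj_on[OF assms] strict_mono_on_leD[OF assms]
  by (auto simp: distinct_map sorted_iff_nth_mono lessThan_atLeast0)

lemma subseq_map_nth:
  assumes "sorted_wrt (<) js" "set js \<subseteq> {..<length s}"
  shows "subseq (map ((!) s) js) s"
proof -
  have "js = filter (\<lambda>i. i \<in> set js) [0..<length s]"
    by (rule sorted_distinct_set_unique)
      (use assms in \<open>auto intro: sorted_wrt_filter simp: strict_sorted_iff\<close>)
  then have "subseq js [0..<length s]" by (metis subseq_filter_left)
  then have "subseq (map ((!) s) js) (map ((!) s) [0..<length s])" by (rule subseq_map)
  then show ?thesis by (simp add: map_nth)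
qed

text \<open>Replaces subsequences by increasing index maps, which can be composed, reversed and
  counted.\<close>

lemma not_avoids_iff:
  "\<not> avoids \<pi> p \<longleftrightarrow> (\<exists>g. strict_mono_on {..<length p} g \<and> g ` {..<length p} \<subseteq> {..<length \<pi>} \<and>
     (\<forall>i<length p. \<forall>j<length p. \<pi> ! g i < \<pi> ! g j \<longleftrightarrow> p ! i < p ! j))" (is "?L \<longleftrightarrow> ?R")
proof
  assume ?L
  then obtain s where s: "subseq s \<pi>" "order_iso s p" by (auto simp: avoids_def)
  then obtain N where "s = nths \<pi> N" by (auto simp: subseq_conv_nths)
  define js where "js = filter (\<lambda>i. i \<in> N) [0..<length \<pi>]"
  have s': "s = map ((!) \<pi>) js"
    unfolding js_def map_nth_sorted_eq_nths by fact
  have l: "length js = length p" using s' order_iso_length[OF s(2)] by simp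
  have js: "sorted js" "distinct js" unfolding js_def by (auto intro: sorted_wrt_filter)
  have "strict_mono_on {..<length p} ((!) js)"
    using js l by (auto intro!: strict_mono_onI simp: sorted_wrt_nth_less strict_sorted_iff)
  moreover have "(!) js ` {..<length p} \<subseteq> {..<length \<pi>}"
  proof -
    have sub: "set js \<subseteq> {..<length \<pi>}" by (auto simp: js_def)
    show ?thesis
    proof (rule image_subsetI)
      fix i assume "i \<in> {..<length p}"
      then show "js ! i \<in> {..<length \<pi>}" using sub l by (simp add: subset_iff)
    qed
  qed
  moreover have "\<forall>i<length p. \<forall>j<length p. \<pi> ! (js ! i) < \<pi> ! (js ! j) \<longleftrightarrow> p ! i < p ! j"
    using s(2) l unfolding s' order_iso_def by auto
  ultimately show ?R by blast
next
  assume ?R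
  then obtain g where g: "strict_mono_on {..<length p} g" "g ` {..<length p} \<subseteq> {..<length \<pi>}"
     "\<forall>i<length p. \<forall>j<length p. \<pi> ! g i < \<pi> ! g j \<longleftrightarrow> p ! i < p ! j" by blast
  define js where "js = map g [0..<length p]"
  have js: "sorted js" "distinct js" "set js \<subseteq> {..<length \<pi>}"
    using strict_mono_on_sorted_map[OF g(1)] g(2) by (auto simp: js_def image_subset_iff)
  have "subseq (map ((!) \<pi>) js) \<pi>"
    using js by (intro subseq_map_nth) (auto simp: strict_sorted_iff)
  moreover have "order_iso (map ((!) \<pi>) js) p"
    using g(3) by (auto simp: order_iso_def js_def)
  ultimately show ?L by (auto simp: avoids_def)
qed


section \<open>Explicit occurrences of 1324, 132 and 213\<close>

lemma contains_1324_iff: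
  "\<not> avoids \<pi> [1,3,2,4] \<longleftrightarrow> (\<exists>i j k l. i < j \<and> j < k \<and> k < l \<and> l < length \<pi> \<and>
     \<pi> ! i < \<pi> ! k \<and> \<pi> ! k < \<pi> ! j \<and> \<pi> ! j < \<pi> ! l)" (is "?L \<longleftrightarrow> ?R")
proof
  assume ?L
  then obtain g where "strict_mono_on {..<length [1,3,2,4::nat]} g" "g ` {..<length [1,3,2,4::nat]} \<subseteq> {..<length \<pi>}"
     "\<forall>i<length [1,3,2,4::nat]. \<forall>j<length [1,3,2,4::nat]. \<pi> ! g i < \<pi> ! g j \<longleftrightarrow> [1,3,2,4::nat] ! i < [1,3,2,4] ! j"
    unfolding not_avoids_iff by blast
  moreover have "length [1,3,2,4::nat] = 4" by simp
  ultimately have g: "strict_mono_on {..<4} g" "g ` {..<4} \<subseteq> {..<length \<pi>}"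
     "\<forall>i<4. \<forall>j<4. \<pi> ! g i < \<pi> ! g j \<longleftrightarrow> [1,3,2,4::nat] ! i < [1,3,2,4] ! j"
    by metis+
  have "g 0 < g 1" "g 1 < g 2" "g 2 < g 3" 
    by (rule strict_mono_onD[OF g(1)]; simp)+
  moreover have "g 3 < length \<pi>" using g(2) by (simp add: image_subset_iff)
  moreover have "\<pi> ! g 0 < \<pi> ! g 2" "\<pi> ! g 2 < \<pi> ! g 1" "\<pi> ! g 1 < \<pi> ! g 3"
    using g(3) by (auto simp: nth_Cons')
  ultimately show ?R by blast
next
  assume ?R
  then obtain i j k l where "i < j \<and> j < k \<and> k < l \<and> l < length \<pi> \<and>
     \<pi> ! i < \<pi> ! k \<and> \<pi> ! k < \<pi> ! j \<and> \<pi> ! j < \<pi> ! l" by blast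
  note * = this
  have "subseq (map ((!) \<pi>) [i,j,k,l]) \<pi>"
    by (rule subseq_map_nth) (use * in auto)
  moreover have "order_iso (map ((!) \<pi>) [i,j,k,l]) [1,3,2,4]"
    unfolding order_iso_def by (simp add: All_less_Suc2, intro conjI; use * in linarith)
  ultimately show ?L unfolding avoids_def by blast
qed

lemma contains_132_iff:
  "\<not> avoids \<pi> [1,3,2] \<longleftrightarrow> (\<exists>i j k. i < j \<and> j < k \<and> k < length \<pi> \<and>
     \<pi> ! i < \<pi> ! k \<and> \<pi> ! k < \<pi> ! j)" (is "?L \<longleftrightarrow> ?R")
proof
  assume ?L
  then obtain g where "strict_mono_on {..<length [1,3,2::nat]} g" "g ` {..<length [1,3,2::nat]} \<subseteq> {..<length \<pi>}"
     "\<forall>i<length [1,3,2::nat]. \<forall>j<length [1,3,2::nat]. \<pi> ! g i < \<pi> ! g j \<longleftrightarrow> [1,3,2::nat] ! i < [1,3,2] ! j"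
    unfolding not_avoids_iff by blast
  moreover have "length [1,3,2::nat] = 3" by simp
  ultimately have g: "strict_mono_on {..<3} g" "g ` {..<3} \<subseteq> {..<length \<pi>}"
     "\<forall>i<3. \<forall>j<3. \<pi> ! g i < \<pi> ! g j \<longleftrightarrow> [1,3,2::nat] ! i < [1,3,2] ! j"
    by metis+
  have "g 0 < g 1" "g 1 < g 2"
    by (rule strict_mono_onD[OF g(1)]; simp)+
  moreover have "g 2 < length \<pi>" using g(2) by (simp add: image_subset_iff)
  moreover have "\<pi> ! g 0 < \<pi> ! g 2" "\<pi> ! g 2 < \<pi> ! g 1"
    using g(3) by (auto simp: nth_Cons')
  ultimately show ?R by blast
next
  assume ?R
  then obtain i j k where "i < j \<and> j < k \<and> k < length \<pi> \<and>
     \<pi> ! i < \<pi> ! k \<and> \<pi> ! k < \<pi> ! j" by blast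
  note * = this
  have "subseq (map ((!) \<pi>) [i,j,k]) \<pi>"
    by (rule subseq_map_nth) (use * in auto)
  moreover have "order_iso (map ((!) \<pi>) [i,j,k]) [1,3,2]"
    unfolding order_iso_def by (simp add: All_less_Suc2, intro conjI; use * in linarith)
  ultimately show ?L unfolding avoids_def by blast
qed

lemma contains_213_iff:
  "\<not> avoids \<pi> [2,1,3] \<longleftrightarrow> (\<exists>i j k. i < j \<and> j < k \<and> k < length \<pi> \<and>
     \<pi> ! j < \<pi> ! i \<and> \<pi> ! i < \<pi> ! k)" (is "?L \<longleftrightarrow> ?R")
proof
  assume ?L
  then obtain g where "strict_mono_on {..<length [2,1,3::nat]} g" "g ` {..<length [2,1,3::nat]} \<subseteq> {..<length \<pi>}"
     "\<forall>i<length [2,1,3::nat]. \<forall>j<length [2,1,3::nat]. \<pi> ! g i < \<pi> ! g j \<longleftrightarrow> [2,1,3::nat] ! i < [2,1,3] ! j"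
    unfolding not_avoids_iff by blast
  moreover have "length [2,1,3::nat] = 3" by simp
  ultimately have g: "strict_mono_on {..<3} g" "g ` {..<3} \<subseteq> {..<length \<pi>}"
     "\<forall>i<3. \<forall>j<3. \<pi> ! g i < \<pi> ! g j \<longleftrightarrow> [2,1,3::nat] ! i < [2,1,3] ! j"
    by metis+
  have "g 0 < g 1" "g 1 < g 2"
    by (rule strict_mono_onD[OF g(1)]; simp)+
  moreover have "g 2 < length \<pi>" using g(2) by (simp add: image_subset_iff)
  moreover have "\<pi> ! g 1 < \<pi> ! g 0" "\<pi> ! g 0 < \<pi> ! g 2"
    using g(3) by (auto simp: nth_Cons')
  ultimately show ?R by blast
next
  assume ?R
  then obtain i j k where "i < j \<and> j < k \<and> k < length \<pi> \<and>
     \<pi> ! j < \<pi> ! i \<and> \<pi> ! i < \<pi> ! k" by blast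
  note * = this
  have "subseq (map ((!) \<pi>) [i,j,k]) \<pi>"
    by (rule subseq_map_nth) (use * in auto)
  moreover have "order_iso (map ((!) \<pi>) [i,j,k]) [2,1,3]"
    unfolding order_iso_def by (simp add: All_less_Suc2, intro conjI; use * in linarith)
  ultimately show ?L unfolding avoids_def by blast
qed

lemma avoids_subseq: "avoids \<pi> p \<Longrightarrow> subseq s \<pi> \<Longrightarrow> avoids s p"
  unfolding avoids_def by (meson subseq_order.trans)

lemma not_avoids_order_iso:
  assumes "order_iso s t" "\<not> avoids s p" shows "\<not> avoids t p"
proof -
  obtain g where g: "strict_mono_on {..<length p} g" "g ` {..<length p} \<subseteq> {..<length s}"
     "\<forall>i<length p. \<forall>j<length p. s ! g i < s ! g j \<longleftrightarrow> p ! i < p ! j"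
    using assms(2) not_avoids_iff by blast
  have *: "g i < length s" if "i < length p" for i using g(2) that by blast
  have "t ! g i < t ! g j \<longleftrightarrow> p ! i < p ! j" if "i < length p" "j < length p" for i j
  proof -
    have "s ! g i < s ! g j \<longleftrightarrow> t ! g i < t ! g j"
      using assms(1) *[OF that(1)] *[OF that(2)] unfolding order_iso_def by blast
    then show ?thesis using g(3) that by blast
  qed
  then show ?thesis
    unfolding not_avoids_iff using g(1,2) order_iso_length[OF assms(1)]
    by (intro exI[of _ g]) simp
qed

lemma avoids_order_iso:
  assumes "order_iso s t" shows "avoids s p \<longleftrightarrow> avoids t p"
  using not_avoids_order_iso[OF assms] not_avoids_order_iso[OF order_iso_sym[OF assms]] by blast

lemma not_avoids_map: 
  assumes "strict_mono_on (set q) h" "subseq (map h q) \<pi>" shows "\<not> avoids \<pi> q"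
  using assms order_iso_map unfolding avoids_def by blast

lemma avoids_longer: "length \<pi> < length p \<Longrightarrow> avoids \<pi> p"
  unfolding avoids_def by (metis leD list_emb_length order_iso_length)

lemma avoids_same_length:
  assumes "\<pi> \<in> perms n" "p \<in> perms n" "\<pi> \<noteq> p" shows "avoids \<pi> p"
  using assms order_iso_perms_eq length_perms unfolding avoids_def
  by (metis order_iso_length subseq_same_length)

subsection \<open>Cut positions and the symmetries\<close>

text \<open>The cut positions of a list. They depend only on its order type, so the components of
  \<open>del \<pi> e\<close> can be read off \<open>removeAll e \<pi>\<close> without standardizing.\<close>

definition splits :: "nat list \<Rightarrow> nat set" where
  "splits s = {j. 0 < j \<and> j < length s \<and> (\<forall>x\<in>set (take j s). \<forall>y\<in>set (drop j s). x < y)}"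

lemma splits_iff_nth:
  "j \<in> splits s \<longleftrightarrow> 0 < j \<and> j < length s \<and> (\<forall>a<j. \<forall>b. j \<le> b \<and> b < length s \<longrightarrow> s ! a < s ! b)"
proof -
  have "(\<forall>x\<in>set (take j s). P x) \<longleftrightarrow> (\<forall>a<j. P (s ! a))" if "j < length s" for P
    using that by (auto simp: all_set_conv_all_nth)
  moreover have "(\<forall>y\<in>set (drop j s). P y) \<longleftrightarrow> (\<forall>b. j \<le> b \<and> b < length s \<longrightarrow> P (s ! b))"
    if "j < length s" for P
  proof -
    have "(\<forall>y\<in>set (drop j s). P y) \<longleftrightarrow> (\<forall>i<length s - j. P (s ! (j + i)))"
      using that by (auto simp: all_set_conv_all_nth)
    also have "\<dots> \<longleftrightarrow> (\<forall>b. j \<le> b \<and> b < length s \<longrightarrow> P (s ! b))"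
      by (metis add_diff_inverse_nat diff_less_mono leD less_diff_conv le_add1 add.commute)
    finally show ?thesis .
  qed
  ultimately show ?thesis by (cases "j < length s") (simp_all add: splits_def)
qed

lemma finite_splits: "finite (splits s)"
  by (rule finite_subset[of _ "{..<length s}"]) (auto simp: splits_def)

lemma splits_order_iso_subset:
  assumes "order_iso s t" shows "splits s \<subseteq> splits t"
proof
  fix j assume j: "j \<in> splits s"
  have *: "length s = length t"
    "\<And>a b. a < length s \<Longrightarrow> b < length s \<Longrightarrow> s ! a < s ! b \<longleftrightarrow> t ! a < t ! b"
    using assms unfolding order_iso_def by blast+
  have "t ! a < t ! b" if "a < j" "j \<le> b" "b < length t" for a b
    using j *(1) *(2)[of a b] that unfolding splits_iff_nth by simp
  then show "j \<in> splits t" using j *(1) unfolding splits_iff_nth by simp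
qed

lemma splits_order_iso: "order_iso s t \<Longrightarrow> splits s = splits t"
  using splits_order_iso_subset[of s t] splits_order_iso_subset[OF order_iso_sym[of s t]] by blast

lemma splits_append:
  assumes "xs \<noteq> []" "ys \<noteq> []" "\<And>x y. x \<in> set xs \<Longrightarrow> y \<in> set ys \<Longrightarrow> x < y"
  shows "splits (xs @ ys) = splits xs \<union> {length xs} \<union> (\<lambda>j. j + length xs) ` splits ys"
proof (rule set_eqI)
  fix j
  consider "j < length xs" | "j = length xs" | "j > length xs" by linarith
  then show "j \<in> splits (xs @ ys) \<longleftrightarrow>
     j \<in> splits xs \<union> {length xs} \<union> (\<lambda>j. j + length xs) ` splits ys"
  proof cases
    case 1
    then have "j \<notin> (\<lambda>j. j + length xs) ` splits ys" by auto
    moreover have "j \<in> splits (xs @ ys) \<longleftrightarrow> j \<in> splits xs"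
      using 1 assms by (auto simp: splits_def dest: in_set_takeD)
    ultimately show ?thesis using 1 by auto
  next
    case 2
    then show ?thesis using assms by (auto simp: splits_def)
  next
    case 3
    then obtain k where k: "j = k + length xs" "k > 0" by (metis add.commute less_imp_add_positive)
    have "j \<in> splits (xs @ ys) \<longleftrightarrow> k \<in> splits ys"
      using k assms by (auto simp: splits_def dest: in_set_dropD)
    moreover have "j \<notin> splits xs" using 3 by (auto simp: splits_def)
    ultimately show ?thesis using k by auto
  qed
qed

text \<open>A formulation in terms of points \<open>(i, s ! i)\<close>, which is symmetric in positions and values and hence
  transfers to inverses.\<close>

lemma splits_filter_iff:
  defines "D \<equiv> \<lambda>P (s::nat list). {i. i < length s \<and> P (s ! i)}"
  shows "c \<in> splits (filter P s) \<longleftrightarrow>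
    (\<exists>I. I \<subseteq> D P s \<and> card I = c \<and> I \<noteq> {} \<and> I \<noteq> D P s \<and> (\<forall>i\<in>I. \<forall>j\<in>D P s - I. i < j \<and> s ! i < s ! j))"
    (is "?L \<longleftrightarrow> ?R")
proof -
  define js where "js = filter (\<lambda>i. P (s ! i)) [0..<length s]"
  have s: "filter P s = map ((!) s) js"
    unfolding js_def by (subst map_nth[of s, symmetric]) (simp only: filter_map comp_def)
  have js: "sorted_wrt (<) js" "distinct js" "set js = D P s"
    unfolding js_def D_def by (auto intro: sorted_wrt_filter)
  show ?thesis
  proof
    assume ?L
    then have c: "0 < c" "c < length js"
       "\<And>x y. x \<in> set (take c js) \<Longrightarrow> y \<in> set (drop c js) \<Longrightarrow> s ! x < s ! y"
      by (auto simp: splits_def s take_map drop_map)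
    have un: "set (take c js) \<union> set (drop c js) = D P s" "set (take c js) \<inter> set (drop c js) = {}"
      using js(2,3) by (metis set_append append_take_drop_id, metis distinct_append append_take_drop_id)
    have "card (set (take c js)) = c" using c js by (simp add: distinct_card)
    moreover have "\<forall>i\<in>set (take c js). \<forall>j\<in>set (drop c js). i < j"
      using js(1) by (metis append_take_drop_id sorted_wrt_append)
    moreover have ne: "set (take c js) \<noteq> {}" "set (drop c js) \<noteq> {}" using c by auto
    moreover have dd: "D P s - set (take c js) = set (drop c js)"
      unfolding un(1)[symmetric] using un(2) by (simp add: Un_Diff Diff_triv Int_commute)
    moreover from this ne have "set (take c js) \<noteq> D P s" by (metis Diff_cancel)
    moreover have "set (take c js) \<subseteq> D P s" unfolding un(1)[symmetric] by (rule Un_upper1)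
    ultimately show ?R using c(3)
      by (intro exI[of _ "set (take c js)"]) simp
  next
    assume ?R
    then obtain I where I: "I \<subseteq> D P s" "card I = c" "I \<noteq> {}" "I \<noteq> D P s"
      "\<And>i j. i \<in> I \<Longrightarrow> j \<in> D P s - I \<Longrightarrow> i < j \<and> s ! i < s ! j" by blast
    define xs ys where "xs = filter (\<lambda>i. i \<in> I) js" and "ys = filter (\<lambda>i. i \<notin> I) js"
    have sets: "set xs = I" "set ys = D P s - I" using I(1) js(3) by (auto simp: xs_def ys_def)
    have d: "sorted_wrt (<) xs" "sorted_wrt (<) ys"
      using js unfolding xs_def ys_def by (auto intro: sorted_wrt_filter)
    have "sorted_wrt (<) (xs @ ys)" using d sets I(5) by (simp add: sorted_wrt_append)
    then have "js = xs @ ys"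
      by (rule strict_sorted_equal[OF _ js(1)]) (use sets I(1) js(3) in auto)
    moreover have "length xs = c" using I(2) sets(1) js(2) by (metis distinct_card distinct_filter xs_def)
    moreover have "xs \<noteq> []" "ys \<noteq> []" using sets I by auto
    ultimately show ?L unfolding s using I(5) sets by (auto simp: splits_def)
  qed
qed

section \<open>Inverses and their cuts\<close>

lemma length_inv_perm [simp]: "length (inv_perm \<pi>) = length \<pi>"
  by (simp add: inv_perm_def del: upt_Suc)

lemma inv_perm_nth:
  assumes "\<pi> \<in> perms n" "i < n" shows "inv_perm \<pi> ! (\<pi> ! i - 1) = Suc i"
proof -
  have l: "length \<pi> = n" "distinct \<pi>" using assms length_perms perms_iff by auto
  have v: "1 \<le> \<pi> ! i" "\<pi> ! i \<le> n" using perms_nth[OF assms] by auto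
  have "(THE k. k < length \<pi> \<and> \<pi> ! k = \<pi> ! i) = i"
    by (rule the_equality) (use l assms(2) nth_eq_iff_index_eq in \<open>auto\<close>)
  moreover have "[1..<Suc (length \<pi>)] ! (\<pi> ! i - 1) = \<pi> ! i"
    using v l by (subst nth_upt) auto
  moreover have "\<pi> ! i - 1 < length \<pi>" using v l by linarith
  ultimately show ?thesis by (simp add: inv_perm_def del: upt_Suc)
qed

lemma inv_perm_unique:
  assumes "\<pi> \<in> perms n" "length \<rho> = n" "\<And>i. i < n \<Longrightarrow> \<rho> ! (\<pi> ! i - 1) = Suc i"
  shows "\<rho> = inv_perm \<pi>"
proof (rule nth_equalityI)
  show "length \<rho> = length (inv_perm \<pi>)" using assms length_perms by simp
  fix v assume "v < length \<rho>"
  then have "1 \<le> Suc v" "Suc v \<le> n" using assms by auto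
  then obtain i where "i < n" "\<pi> ! i = Suc v" using perms_surj[OF assms(1)] by metis
  then show "\<rho> ! v = inv_perm \<pi> ! v"
    using assms(3) inv_perm_nth[OF assms(1)] by (metis diff_Suc_1)
qed

lemma inv_perm_nth':
  assumes "\<pi> \<in> perms n" "v < n"
  obtains i where "i < n" "\<pi> ! i = Suc v" "inv_perm \<pi> ! v = Suc i"
proof -
  obtain i where "i < n" "\<pi> ! i = Suc v" using perms_surj[OF assms(1), of "Suc v"] assms(2) by auto
  then show ?thesis using that inv_perm_nth[OF assms(1)] by (metis diff_Suc_1)
qed

lemma inv_perm_perms: assumes "\<pi> \<in> perms n" shows "inv_perm \<pi> \<in> perms n"
proof -
  have "set (inv_perm \<pi>) = {1..n}"
  proof
    show "set (inv_perm \<pi>) \<subseteq> {1..n}"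
    proof
      fix x assume "x \<in> set (inv_perm \<pi>)"
      then obtain v where "v < n" "x = inv_perm \<pi> ! v"
        using length_perms[OF assms] by (auto simp: in_set_conv_nth)
      then show "x \<in> {1..n}" using inv_perm_nth'[OF assms] by (metis atLeastAtMost_iff Suc_leI Suc_le_mono One_nat_def le0)
    qed
    show "{1..n} \<subseteq> set (inv_perm \<pi>)"
    proof
      fix x assume x: "x \<in> {1..n}"
      then have "inv_perm \<pi> ! (\<pi> ! (x - 1) - 1) = x" using inv_perm_nth[OF assms, of "x - 1"] by auto
      moreover have "\<pi> ! (x - 1) - 1 < length (inv_perm \<pi>)"
      proof -
        have "x - 1 < n" using x by auto
        then show ?thesis using perms_nth[OF assms, of "x - 1"] length_perms[OF assms] by simp linarith
      qed
      ultimately show "x \<in> set (inv_perm \<pi>)" using nth_mem by metis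
    qed
  qed
  moreover from this have "distinct (inv_perm \<pi>)"
    using length_perms[OF assms] by (intro card_distinct) simp
  ultimately show ?thesis by (simp add: perms_iff)
qed

lemma inv_perm_inv_perm: assumes "\<pi> \<in> perms n" shows "inv_perm (inv_perm \<pi>) = \<pi>"
proof (rule inv_perm_unique[OF inv_perm_perms[OF assms], symmetric])
  show "length \<pi> = n" using assms by (rule length_perms)
  fix i assume "i < n"
  then show "\<pi> ! (inv_perm \<pi> ! i - 1) = Suc i"
    using inv_perm_nth'[OF assms] by (metis diff_Suc_1)
qed

text \<open>Inversion reflects the points \<open>(i, \<pi> ! i)\<close> in the diagonal, and a cut
  is a set of points below and to the left of all others, a condition invariant under the
  reflection. The filters make this cover deletions: \<open>P\<close> tests values of \<pi>,
  \<open>P'\<close> the corresponding values of the inverse, that is, positions of \<pi> counted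
  from 1.\<close>

lemma splits_filter_inv_perm_subset:
  assumes "\<pi> \<in> perms n" "\<And>i. i < n \<Longrightarrow> P' (Suc i) \<longleftrightarrow> P (\<pi> ! i)"
  shows "splits (filter P \<pi>) \<subseteq> splits (filter P' (inv_perm \<pi>))"
proof
  fix c assume "c \<in> splits (filter P \<pi>)"
  have l: "length \<pi> = n" "distinct \<pi>" using assms length_perms perms_iff by auto
  define D where "D = {i. i < length \<pi> \<and> P (\<pi> ! i)}"
  define D' where "D' = {i. i < length (inv_perm \<pi>) \<and> P' (inv_perm \<pi> ! i)}"
  obtain I where I: "I \<subseteq> D" "card I = c" "I \<noteq> {}" "I \<noteq> D"
      "\<forall>i\<in>I. \<forall>j\<in>D - I. i < j \<and> \<pi> ! i < \<pi> ! j"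
    using \<open>c \<in> splits (filter P \<pi>)\<close> unfolding splits_filter_iff D_def by blast
  \<comment> \<open>The reflection on zero-based indices: i goes to the index at which the inverse
    has the value i + 1.\<close>
  define f where "f i = \<pi> ! i - 1" for i
  have inj: "inj_on f {..<n}"
  proof (rule inj_onI)
    fix i j assume "i \<in> {..<n}" "j \<in> {..<n}" "f i = f j"
    then have "\<pi> ! i = \<pi> ! j" using perms_nth[OF assms(1)] unfolding f_def
      by (metis One_nat_def Suc_pred lessThan_iff less_le_trans zero_less_one)
    then show "i = j" using l nth_eq_iff_index_eq \<open>i \<in> _\<close> \<open>j \<in> _\<close> by auto
  qed
  have Dn: "D \<subseteq> {..<n}" by (auto simp: D_def l)
  have D': "D' = f ` D"
  proof
    show "f ` D \<subseteq> D'"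
    proof (rule image_subsetI)
      fix i assume "i \<in> D"
      then have "i < n" "P (\<pi> ! i)" using l by (auto simp: D_def)
      then show "f i \<in> D'" using assms(2) inv_perm_nth[OF assms(1)] perms_nth[OF assms(1)] l
        unfolding D'_def f_def by fastforce
    qed
    show "D' \<subseteq> f ` D"
    proof
      fix v assume "v \<in> D'"
      then have v: "v < n" "P' (inv_perm \<pi> ! v)" by (auto simp: D'_def l)
      obtain i where i: "i < n" "\<pi> ! i = Suc v" "inv_perm \<pi> ! v = Suc i"
        using inv_perm_nth'[OF assms(1) v(1)] .
      then have "i \<in> D" using v assms(2) l by (auto simp: D_def)
      moreover have "f i = v" using i by (simp add: f_def)
      ultimately show "v \<in> f ` D" by blast
    qed
  qed
  have "f ` I \<subseteq> D'" using I D' by blast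
  moreover have "card (f ` I) = c" using I Dn inj by (metis card_image inj_on_subset)
  moreover have "f ` I \<noteq> {}" using I by blast
  moreover have "f ` I \<noteq> D'" using I Dn inj D' by (metis inj_on_image_eq_iff order.trans)
  moreover have "\<forall>i\<in>f ` I. \<forall>j\<in>D' - f ` I. i < j \<and> inv_perm \<pi> ! i < inv_perm \<pi> ! j"
  proof (intro ballI)
    fix a b assume "a \<in> f ` I" "b \<in> D' - f ` I"
    then obtain i j where ij: "i \<in> I" "j \<in> D - I" "a = f i" "b = f j" using D' by blast
    then have "i < j" "\<pi> ! i < \<pi> ! j" "i < n" "j < n" using I Dn by auto
    then show "a < b \<and> inv_perm \<pi> ! a < inv_perm \<pi> ! b"
      using inv_perm_nth[OF assms(1)] perms_nth[OF assms(1)] ij unfolding f_def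
      by (metis Suc_less_eq diff_less_mono)
  qed
  ultimately show "c \<in> splits (filter P' (inv_perm \<pi>))"
    unfolding splits_filter_iff D'_def by blast
qed

lemma splits_filter_inv_perm:
  assumes "\<pi> \<in> perms n" "\<And>i. i < n \<Longrightarrow> P' (Suc i) \<longleftrightarrow> P (\<pi> ! i)"
  shows "splits (filter P' (inv_perm \<pi>)) = splits (filter P \<pi>)"
proof
  have "P (Suc v) \<longleftrightarrow> P' (inv_perm \<pi> ! v)" if "v < n" for v
    using inv_perm_nth'[OF assms(1) that] assms(2) by metis
  from splits_filter_inv_perm_subset[where P=P' and P'=P, OF inv_perm_perms[OF assms(1)] this]
  show "splits (filter P' (inv_perm \<pi>)) \<subseteq> splits (filter P \<pi>)"
    by (simp add: inv_perm_inv_perm[OF assms(1)])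
qed (use splits_filter_inv_perm_subset[of \<pi> n P' P] assms in auto)

lemma splits_inv_perm: "\<pi> \<in> perms n \<Longrightarrow> splits (inv_perm \<pi>) = splits \<pi>"
  using splits_filter_inv_perm[of \<pi> n "\<lambda>_. True" "\<lambda>_. True"] by simp

lemma splits_removeAll_inv_perm:
  assumes "\<pi> \<in> perms n" "i < n"
  shows "splits (removeAll (Suc i) (inv_perm \<pi>)) = splits (removeAll (\<pi> ! i) \<pi>)"
proof -
  have "length \<pi> = n" "distinct \<pi>" using assms length_perms perms_iff by auto
  then show ?thesis unfolding removeAll_filter_not_eq
    using assms nth_eq_iff_index_eq
    by (intro splits_filter_inv_perm[of \<pi> n]) auto
qed

section \<open>Reverse-complements and their cuts\<close>

lemma length_rc [simp]: "length (rc \<pi>) = length \<pi>"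
  by (simp add: rc_def)

lemma rc_nth: "i < length \<pi> \<Longrightarrow> rc \<pi> ! i = length \<pi> + 1 - \<pi> ! (length \<pi> - 1 - i)"
  by (simp add: rc_def rev_nth)

lemma rc_perms: assumes "\<pi> \<in> perms n" shows "rc \<pi> \<in> perms n"
proof -
  have l: "length \<pi> = n" "distinct \<pi>" "set \<pi> = {1..n}" using assms length_perms perms_iff by auto
  have "inj_on (\<lambda>x. n + 1 - x) {1..n}" by (rule inj_onI) (unfold atLeastAtMost_iff, arith)
  then have "distinct (rc \<pi>)" using l by (simp add: rc_def distinct_map)
  moreover have "set (rc \<pi>) \<subseteq> {1..n}"
  proof
    fix x assume "x \<in> set (rc \<pi>)"
    then obtain y where y: "y \<in> set \<pi>" "x = length \<pi> + 1 - y" by (auto simp: rc_def)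
    then have "1 \<le> y" "y \<le> n" using l(3) by (metis atLeastAtMost_iff)+
    then show "x \<in> {1..n}" using y(2) l(1) by simp arith
  qed
  ultimately have "distinct (rc \<pi>)" "set (rc \<pi>) \<subseteq> {1..n}" by blast+
  then show ?thesis using permsI[of "rc \<pi>"] l by simp
qed

lemma rc_rc: assumes "\<pi> \<in> perms n" shows "rc (rc \<pi>) = \<pi>"
proof -
  have "set \<pi> = {1..n}" "length \<pi> = n" using assms length_perms perms_iff by auto
  then show ?thesis by (auto simp: rc_def rev_map intro!: map_idI)
qed

lemma inv_perm_rc: assumes "\<pi> \<in> perms n" shows "inv_perm (rc \<pi>) = rc (inv_perm \<pi>)"
proof (rule inv_perm_unique[OF rc_perms[OF assms], symmetric])
  have l: "length \<pi> = n" using assms by (rule length_perms)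
  then show "length (rc (inv_perm \<pi>)) = n" by simp
  fix i assume i: "i < n"
  define k where "k = n - 1 - i"
  have k: "k < n" "i = n - 1 - k" using i by (auto simp: k_def)
  have v: "1 \<le> \<pi> ! k" "\<pi> ! k \<le> n" using perms_nth[OF assms k(1)] by auto
  have "rc \<pi> ! i - 1 = n - \<pi> ! k" using i l v by (simp add: rc_nth k_def)
  moreover have "rc (inv_perm \<pi>) ! (n - \<pi> ! k) = n + 1 - inv_perm \<pi> ! (n - 1 - (n - \<pi> ! k))"
    using v l by (simp add: rc_nth)
  moreover have "n - 1 - (n - \<pi> ! k) = \<pi> ! k - 1" using v by linarith
  ultimately show "rc (inv_perm \<pi>) ! (rc \<pi> ! i - 1) = Suc i"
    using inv_perm_nth[OF assms k(1)] k by simp arith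
qed

text \<open>Holds for arbitrary bounded lists so that it applies to a permutation with one entry
  removed, whose complement is still taken with respect to n + 1. The bound N keeps truncated
  subtraction strictly decreasing.\<close>

lemma splits_rev_complement:
  assumes "\<And>x. x \<in> set s \<Longrightarrow> x \<le> N"
  shows "splits (map (\<lambda>x. N - x) (rev s)) = (\<lambda>c. length s - c) ` splits s"
proof -
  have *: "length s - c \<in> splits (map (\<lambda>x. N - x) (rev s)) \<longleftrightarrow> c \<in> splits s"
    if c: "0 < c" "c < length s" for c
  proof -
    have "(\<forall>x\<in>set (drop c s). \<forall>y\<in>set (take c s). N - x < N - y) \<longleftrightarrow>
        (\<forall>x\<in>set (drop c s). \<forall>y\<in>set (take c s). y < x)"
    proof (intro ball_cong refl)
      fix x y assume "x \<in> set (drop c s)" "y \<in> set (take c s)"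
      then have "x \<le> N" "y \<le> N" using assms in_set_takeD in_set_dropD by metis+
      then show "N - x < N - y \<longleftrightarrow> y < x" by arith
    qed
    also have "\<dots> \<longleftrightarrow> (\<forall>y\<in>set (take c s). \<forall>x\<in>set (drop c s). y < x)" by blast
    finally have *: "(\<forall>x\<in>set (drop c s). \<forall>y\<in>set (take c s). N - x < N - y) \<longleftrightarrow>
      (\<forall>y\<in>set (take c s). \<forall>x\<in>set (drop c s). y < x)" .
    have "length s - c < length s" "length s - (length s - c) = c" using c by arith+
    then show ?thesis
      using c * by (simp add: splits_def take_map drop_map take_rev drop_rev)
  qed
  show ?thesis
  proof (intro set_eqI iffI)
    fix j assume j: "j \<in> splits (map (\<lambda>x. N - x) (rev s))"
    then have "0 < j" "j < length s" by (auto simp: splits_def)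
    with j show "j \<in> (\<lambda>c. length s - c) ` splits s" using *[of "length s - j"]
      by (intro image_eqI[of _ _ "length s - j"]) auto
  next
    fix j assume "j \<in> (\<lambda>c. length s - c) ` splits s"
    then obtain c where c: "c \<in> splits s" "j = length s - c" by blast
    then have "0 < c" "c < length s" by (auto simp: splits_def)
    then show "j \<in> splits (map (\<lambda>x. N - x) (rev s))" using * c by blast
  qed
qed

lemma rc_removeAll:
  assumes "\<pi> \<in> perms n" "1 \<le> e" "e \<le> n"
  shows "removeAll (n + 1 - e) (rc \<pi>) = map (\<lambda>x. n + 1 - x) (rev (removeAll e \<pi>))"
proof -
  have "set \<pi> = {1..n}" "length \<pi> = n" using assms length_perms perms_iff by auto
  moreover have "filter (\<lambda>x. n + 1 - e \<noteq> n + 1 - x) (rev \<pi>) = filter (\<lambda>x. e \<noteq> x) (rev \<pi>)"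
  proof (rule filter_cong)
    fix x assume "x \<in> set (rev \<pi>)"
    then have "1 \<le> x" "x \<le> n" using calculation by simp_all
    then show "n + 1 - e \<noteq> n + 1 - x \<longleftrightarrow> e \<noteq> x" using assms(2,3) by arith
  qed simp
  ultimately show ?thesis
    by (simp add: rc_def removeAll_filter_not_eq filter_map rev_filter comp_def)
qed

lemma splits_removeAll_rc:
  assumes "\<pi> \<in> perms n" "1 \<le> e" "e \<le> n"
  shows "splits (removeAll (n + 1 - e) (rc \<pi>)) = (\<lambda>c. n - 1 - c) ` splits (removeAll e \<pi>)"
proof -
  have "set \<pi> = {1..n}" "length \<pi> = n" "distinct \<pi>" using assms length_perms perms_iff by auto
  moreover from this assms have "length (removeAll e \<pi>) = n - 1"
    by (simp add: length_remove1 flip: distinct_remove1_removeAll)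
  ultimately show ?thesis
    unfolding rc_removeAll[OF assms] by (subst splits_rev_complement) auto
qed

lemma splits_rc:
  assumes "\<pi> \<in> perms n"
  shows "splits (rc \<pi>) = (\<lambda>c. n - c) ` splits \<pi>"
proof -
  have "set \<pi> = {1..n}" "length \<pi> = n" using assms length_perms perms_iff by auto
  then show ?thesis unfolding rc_def by (subst splits_rev_complement) auto
qed

section \<open>Patterns under inversion and reverse-complement\<close>

lemma contains_inv_perm:
  assumes "\<pi> \<in> perms n" "q \<in> perms k" "\<not> avoids \<pi> q"
  shows "\<not> avoids (inv_perm \<pi>) (inv_perm q)"
proof -
  have l: "length \<pi> = n" "length q = k" using assms length_perms by auto
  obtain g where g: "strict_mono_on {..<k} g" "g ` {..<k} \<subseteq> {..<n}"
     "\<forall>i<k. \<forall>j<k. \<pi> ! g i < \<pi> ! g j \<longleftrightarrow> q ! i < q ! j"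
    using assms(3) l not_avoids_iff by metis
  have gn: "g i < n" if "i < k" for i using g(2) that by blast
  \<comment> \<open>\<open>h v\<close> is the zero-based position of the value v + 1 in q: the
    embedding of the inverse runs through the given occurrence by increasing value instead of
    increasing position.\<close>
  define h where "h v = inv_perm q ! v - 1" for v
  have h: "h v < k" "q ! h v = Suc v" "inv_perm q ! v = Suc (h v)" if "v < k" for v
    using inv_perm_nth'[OF assms(2) that] unfolding h_def by (metis diff_Suc_1)+
  define g' where "g' v = \<pi> ! g (h v) - 1" for v
  have g': "inv_perm \<pi> ! g' v = Suc (g (h v))" "g' v < n" "\<pi> ! g (h v) = Suc (g' v)" if "v < k" for v
    using inv_perm_nth[OF assms(1) gn[OF h(1)[OF that]]] perms_nth[OF assms(1) gn[OF h(1)[OF that]]]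
    unfolding g'_def by auto
  have "strict_mono_on {..<k} g'"
  proof (rule strict_mono_onI)
    fix v w assume vw: "v \<in> {..<k}" "w \<in> {..<k}" "v < w"
    then have "\<pi> ! g (h v) < \<pi> ! g (h w)" using g(3) h by simp
    then show "g' v < g' w" using g' vw by auto
  qed
  moreover have "g' ` {..<k} \<subseteq> {..<n}" using g' by auto
  moreover have "inv_perm \<pi> ! g' v < inv_perm \<pi> ! g' w \<longleftrightarrow> inv_perm q ! v < inv_perm q ! w"
    if "v < k" "w < k" for v w
    using that g'(1) h strict_mono_on_less[OF g(1)] by simp
  ultimately show ?thesis unfolding not_avoids_iff using l by (intro exI[of _ g']) simp
qed

lemma avoids_inv_perm:
  assumes "\<pi> \<in> perms n" "q \<in> perms k"
  shows "avoids (inv_perm \<pi>) (inv_perm q) \<longleftrightarrow> avoids \<pi> q"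
  using contains_inv_perm[OF assms] contains_inv_perm[OF assms[THEN inv_perm_perms]]
  by (auto simp: inv_perm_inv_perm[OF assms(1)] inv_perm_inv_perm[OF assms(2)])

lemma contains_rc:
  assumes "\<pi> \<in> perms n" "q \<in> perms k" "\<not> avoids \<pi> q"
  shows "\<not> avoids (rc \<pi>) (rc q)"
proof -
  have l: "length \<pi> = n" "length q = k" using assms length_perms by auto
  obtain g where g: "strict_mono_on {..<k} g" "g ` {..<k} \<subseteq> {..<n}"
     "\<forall>i<k. \<forall>j<k. \<pi> ! g i < \<pi> ! g j \<longleftrightarrow> q ! i < q ! j"
    using assms(3) l not_avoids_iff by metis
  have gn: "g i < n" if "i < k" for i using g(2) that by blast
  define g' where "g' i = n - 1 - g (k - 1 - i)" for i
  have "strict_mono_on {..<k} g'"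
  proof (rule strict_mono_onI)
    fix v w assume vw: "v \<in> {..<k}" "w \<in> {..<k}" "v < w"
    then have "g (k - 1 - w) < g (k - 1 - v)" by (intro strict_mono_onD[OF g(1)]) auto
    moreover have "g (k - 1 - v) < n" using gn vw by simp
    ultimately show "g' v < g' w" unfolding g'_def by linarith
  qed
  moreover have g'n: "g' i < n" if "i < k" for i using gn[of "k - 1 - i"] that unfolding g'_def by linarith
  moreover have "rc \<pi> ! g' v < rc \<pi> ! g' w \<longleftrightarrow> rc q ! v < rc q ! w" if vw: "v < k" "w < k" for v w
  proof -
    have vw': "k - 1 - v < k" "k - 1 - w < k" using vw by auto
    have e: "n - 1 - g' v = g (k - 1 - v)" "n - 1 - g' w = g (k - 1 - w)"
      using gn[OF vw'(1)] gn[OF vw'(2)] unfolding g'_def by linarith+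
    have "\<pi> ! g (k - 1 - w) < \<pi> ! g (k - 1 - v) \<longleftrightarrow> q ! (k - 1 - w) < q ! (k - 1 - v)"
      using g(3) vw' by blast
    moreover have "rc \<pi> ! g' v = n + 1 - \<pi> ! g (k - 1 - v)" "rc \<pi> ! g' w = n + 1 - \<pi> ! g (k - 1 - w)"
      using rc_nth[of "g' v" \<pi>] rc_nth[of "g' w" \<pi>] g'n[OF vw(1)] g'n[OF vw(2)] e l by simp_all
    moreover have "rc q ! v = k + 1 - q ! (k - 1 - v)" "rc q ! w = k + 1 - q ! (k - 1 - w)"
      using rc_nth[of v q] rc_nth[of w q] vw l by simp_all
    moreover have "N + 1 - x < N + 1 - y \<longleftrightarrow> y < x" if "x \<le> N" "y \<le> N" for x y N :: nat
      using that by arith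
    moreover have "\<pi> ! g (k - 1 - v) \<le> n" "\<pi> ! g (k - 1 - w) \<le> n" "q ! (k - 1 - v) \<le> k" "q ! (k - 1 - w) \<le> k"
      using perms_nth[OF assms(1) gn[OF vw'(1)]] perms_nth[OF assms(1) gn[OF vw'(2)]]
        perms_nth[OF assms(2) vw'(1)] perms_nth[OF assms(2) vw'(2)] by blast+
    ultimately show ?thesis by metis
  qed
  ultimately show ?thesis unfolding not_avoids_iff using l by (intro exI[of _ g']) (simp add: image_subset_iff)
qed

lemma avoids_rc:
  assumes "\<pi> \<in> perms n" "q \<in> perms k"
  shows "avoids (rc \<pi>) (rc q) \<longleftrightarrow> avoids \<pi> q"
  using contains_rc[OF assms] contains_rc[OF assms[THEN rc_perms]]
  by (auto simp: rc_rc[OF assms(1)] rc_rc[OF assms(2)])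

lemma perm_1324: "[1,3,2,4] \<in> perms 4"
  by (auto simp: perms_iff)

lemma rc_1324: "rc [1,3,2,4] = [1,3,2,4]"
  by (simp add: rc_def)

lemma inv_perm_1324: "inv_perm [1,3,2,4] = [1,3,2,4]"
  by (rule inv_perm_unique[OF perm_1324, symmetric]) (auto simp: less_Suc_eq numeral_eq_Suc)

subsection \<open>Direct sums and components\<close>

text \<open>Everything behind the cut is larger, so the entries before it are closed downwards;
  being c in number, they are 1, ..., c.\<close>

lemma splits_perm_set:
  assumes "\<rho> \<in> perms n" "c \<in> splits \<rho>"
  shows "set (take c \<rho>) = {1..c}" "set (drop c \<rho>) = {Suc c..n}"
proof -
  have l: "length \<rho> = n" "distinct \<rho>" "set \<rho> = {1..n}" using assms length_perms perms_iff by auto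
  have c: "0 < c" "c < n" "\<And>x y. x \<in> set (take c \<rho>) \<Longrightarrow> y \<in> set (drop c \<rho>) \<Longrightarrow> x < y"
    using assms(2) l(1) by (auto simp: splits_def)
  have un: "set (take c \<rho>) \<union> set (drop c \<rho>) = {1..n}"
    using l(3) by (metis append_take_drop_id set_append)
  have dj: "set (take c \<rho>) \<inter> set (drop c \<rho>) = {}"
    using l(2) by (metis append_take_drop_id distinct_append)
  have card: "card (set (take c \<rho>)) = c"
    using l c by (simp add: distinct_card)
  have "set (take c \<rho>) \<subseteq> {1..c}"
  proof
    fix x assume x: "x \<in> set (take c \<rho>)"
    then have x1: "1 \<le> x" "x \<le> n" using un by (metis UnI1 atLeastAtMost_iff)+
    have "{1..x} \<subseteq> set (take c \<rho>)"
    proof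
      fix y assume y: "y \<in> {1..x}"
      then have "y \<in> set (take c \<rho>) \<union> set (drop c \<rho>)" using un x1 by simp
      moreover have "y \<notin> set (drop c \<rho>)" using c(3)[OF x] y by (metis atLeastAtMost_iff leD)
      ultimately show "y \<in> set (take c \<rho>)" by blast
    qed
    then have "card {1..x} \<le> c" using card card_mono[of "set (take c \<rho>)" "{1..x}"] by simp
    then show "x \<in> {1..c}" using x1 by simp
  qed
  then show 1: "set (take c \<rho>) = {1..c}"
    using card by (intro card_subset_eq) auto
  have "set (drop c \<rho>) = {1..n} - {1..c}" using un dj 1 by blast
  also have "\<dots> = {Suc c..n}" using c(2) by (intro set_eqI) (simp, arith)
  finally show "set (drop c \<rho>) = {Suc c..n}" .
qed

lemma splits_permI:
  assumes "\<rho> \<in> perms n" "set (take c \<rho>) = {1..c}" "0 < c" "c < n"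
  shows "c \<in> splits \<rho>"
proof -
  have l: "length \<rho> = n" "distinct \<rho>" "set \<rho> = {1..n}" using assms length_perms perms_iff by auto
  have "x < y" if "x \<in> set (take c \<rho>)" "y \<in> set (drop c \<rho>)" for x y
  proof -
    have "y \<notin> set (take c \<rho>)" using l(2) that(2) 
      by (metis append_take_drop_id disjoint_iff distinct_append)
    moreover have "y \<in> {1..n}" using that(2) l(3) in_set_dropD by metis
    ultimately show "x < y" using that(1) unfolding assms(2) by simp
  qed
  then show ?thesis using assms l(1) by (simp add: splits_def)
qed

lemma length_dsum [simp]: "length (dsum \<alpha> \<beta>) = length \<alpha> + length \<beta>"
  by (simp add: dsum_def)

lemma dsum_Nil [simp]: "dsum \<alpha> [] = \<alpha>" "dsum [] \<alpha> = \<alpha>"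
  by (simp_all add: dsum_def)

lemma dsum_assoc: "dsum (dsum \<alpha> \<beta>) \<gamma> = dsum \<alpha> (dsum \<beta> \<gamma>)"
  by (simp add: dsum_def add.commute add.left_commute)

lemma dsum_perms:
  assumes "\<alpha> \<in> perms a" "\<beta> \<in> perms b"
  shows "dsum \<alpha> \<beta> \<in> perms (a + b)"
proof -
  have l: "length \<alpha> = a" "distinct \<alpha>" "set \<alpha> = {1..a}"
      "length \<beta> = b" "distinct \<beta>" "set \<beta> = {1..b}"
    using assms length_perms perms_iff by auto
  have "distinct (dsum \<alpha> \<beta>)" using l by (auto simp: dsum_def distinct_map)
  moreover have "set (dsum \<alpha> \<beta>) \<subseteq> {1..length (dsum \<alpha> \<beta>)}"
    unfolding length_dsum dsum_def using l by auto
  ultimately show ?thesis using permsI[of "dsum \<alpha> \<beta>"] l by simp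
qed

lemma splits_map_add [simp]: "splits (map (\<lambda>x. x + a) s) = splits s"
  by (rule splits_order_iso, rule order_iso_map) (simp add: strict_mono_on_def)

lemma splits_dsum:
  assumes "\<alpha> \<in> perms a" "\<beta> \<in> perms b" "0 < a" "0 < b"
  shows "splits (dsum \<alpha> \<beta>) = splits \<alpha> \<union> {a} \<union> (\<lambda>j. j + a) ` splits \<beta>"
proof -
  have l: "length \<alpha> = a" "set \<alpha> = {1..a}" "length \<beta> = b" "set \<beta> = {1..b}"
    using assms length_perms perms_iff by auto
  have "\<alpha> \<noteq> []" "\<beta> \<noteq> []" using l assms by auto
  moreover have "x < y" if "x \<in> set \<alpha>" "y \<in> set (map (\<lambda>x. x + length \<alpha>) \<beta>)" for x y
    using that l by auto
  ultimately show ?thesis unfolding dsum_def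
    by (subst splits_append) (simp_all add: l)
qed

lemma perm_splitE:
  assumes "\<rho> \<in> perms n" "c \<in> splits \<rho>"
  obtains \<alpha> \<beta> where "\<alpha> \<in> perms c" "\<beta> \<in> perms (n - c)" "\<rho> = dsum \<alpha> \<beta>" "0 < c" "0 < n - c"
proof -
  have l: "length \<rho> = n" "distinct \<rho>" using assms length_perms perms_iff by auto
  have c: "0 < c" "c < n" using assms(2) l(1) by (auto simp: splits_def)
  note s = splits_perm_set[OF assms]
  have t: "take c \<rho> \<in> perms c" using s(1) l by (simp add: perms_iff)
  define \<beta> where "\<beta> = map (\<lambda>x. x - c) (drop c \<rho>)"
  have "distinct \<beta>" unfolding \<beta>_def distinct_map using l(2) s(2)
    by (auto intro!: inj_onI)
  moreover have "set \<beta> \<subseteq> {1..n - c}" unfolding \<beta>_def using s(2) c by auto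
  moreover have "length \<beta> = n - c" using l c by (simp add: \<beta>_def)
  ultimately have "\<beta> \<in> perms (n - c)" using permsI[of \<beta>] by simp
  moreover have "map (\<lambda>x. x + c) \<beta> = drop c \<rho>"
    unfolding \<beta>_def map_map by (rule map_idI) (use s(2) in auto)
  then have "\<rho> = dsum (take c \<rho>) \<beta>" using l c by (simp add: dsum_def)
  ultimately show ?thesis using that t c by simp
qed

lemma decomposable_iff: "\<pi> \<in> perms n \<Longrightarrow> decomposable \<pi> \<longleftrightarrow> splits \<pi> \<noteq> {}"
proof
  assume "decomposable \<pi>"
  then obtain a b \<sigma> \<tau> where "0 < a" "0 < b" "\<sigma> \<in> perms a" "\<tau> \<in> perms b" "\<pi> = dsum \<sigma> \<tau>"
    unfolding decomposable_def by blast
  then show "splits \<pi> \<noteq> {}" using splits_dsum by blast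
next
  assume "\<pi> \<in> perms n" "splits \<pi> \<noteq> {}"
  then show "decomposable \<pi>" unfolding decomposable_def by (metis perm_splitE all_not_in_conv)
qed

lemma nonempty_indecomposable_iff:
  "nonempty_indecomposable \<pi> \<longleftrightarrow> \<pi> \<noteq> [] \<and> \<pi> \<in> perms (length \<pi>) \<and> splits \<pi> = {}"
  unfolding nonempty_indecomposable_def
  using decomposable_iff length_perms by (metis length_greater_0_conv)

text \<open>The shorter first summand is a prefix of the longer one and occupies its least values,
  so its length is a cut there. Indecomposable first summands can therefore be cancelled, which
  yields uniqueness of components.\<close>

lemma dsum_eq_splits:
  assumes "\<sigma> \<in> perms a" "0 < a" "\<beta> \<in> perms b" "dsum \<sigma> \<beta> = dsum \<sigma>' \<beta>'" "length \<sigma> < length \<sigma>'"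
  shows "splits \<sigma>' \<noteq> {}"
proof -
  have l: "length \<sigma> = a" "set \<sigma> = {1..a}" "set \<beta> = {1..b}" using assms length_perms perms_iff by auto
  have "take (length \<sigma>) \<sigma>' = take (length \<sigma>) (dsum \<sigma>' \<beta>')" using assms(5) by (simp add: dsum_def)
  also have "\<dots> = \<sigma>" unfolding assms(4)[symmetric] by (simp add: dsum_def)
  finally have 1: "take (length \<sigma>) \<sigma>' = \<sigma>" .
  have "set (drop (length \<sigma>) \<sigma>') \<subseteq> set (drop (length \<sigma>) (dsum \<sigma>' \<beta>'))" by (simp add: dsum_def)
  also have "\<dots> = (\<lambda>x. x + a) ` {1..b}" unfolding assms(4)[symmetric] using l by (simp add: dsum_def)
  finally have 2: "set (drop (length \<sigma>) \<sigma>') \<subseteq> (\<lambda>x. x + a) ` {1..b}" .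
  have "length \<sigma> \<in> splits \<sigma>'"
    unfolding splits_def mem_Collect_eq 1 l(2) using assms l(1) 2 by fastforce
  then show ?thesis by blast
qed

lemma dsum_cancel:
  assumes "nonempty_indecomposable \<sigma>" "nonempty_indecomposable \<sigma>'"
    "\<beta> \<in> perms b" "\<beta>' \<in> perms b'" "dsum \<sigma> \<beta> = dsum \<sigma>' \<beta>'"
  shows "\<sigma> = \<sigma>' \<and> \<beta> = \<beta>'"
proof -
  have "\<not> length \<sigma> < length \<sigma>'" "\<not> length \<sigma>' < length \<sigma>"
    using assms dsum_eq_splits[of \<sigma> "length \<sigma>" \<beta> b \<sigma>' \<beta>']
      dsum_eq_splits[of \<sigma>' "length \<sigma>'" \<beta>' b' \<sigma> \<beta>]
    unfolding nonempty_indecomposable_iff by auto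
  then have "length \<sigma> = length \<sigma>'" by simp
  then have eq: "\<sigma> = \<sigma>'" "map (\<lambda>x. x + length \<sigma>) \<beta> = map (\<lambda>x. x + length \<sigma>) \<beta>'"
    using assms(5) by (simp_all add: dsum_def)
  have "inj (\<lambda>x. x + length \<sigma>)" by (simp add: inj_def)
  from inj_map_eq_map[OF this] eq show ?thesis by blast
qed

lemma foldr_dsum_perms:
  assumes "\<forall>c\<in>set cs. nonempty_indecomposable c"
  shows "foldr dsum cs [] \<in> perms (length (foldr dsum cs []))"
  using assms
proof (induction cs)
  case Nil
  then show ?case by (simp add: perms_iff)
next
  case (Cons c cs)
  then have "c \<in> perms (length c)" by (simp add: nonempty_indecomposable_iff)
  then show ?case using dsum_perms Cons by simp
qed

lemma foldr_dsum_inject: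
  assumes "\<forall>c\<in>set cs. nonempty_indecomposable c" "\<forall>c\<in>set ds. nonempty_indecomposable c"
    "foldr dsum cs [] = foldr dsum ds []"
  shows "cs = ds"
  using assms
proof (induction cs arbitrary: ds)
  case Nil
  show ?case
  proof (cases ds)
    case (Cons d ds')
    then have "length (foldr dsum ds []) > 0" using Nil(2) by (simp add: nonempty_indecomposable_iff)
    then show ?thesis unfolding Nil(3)[symmetric] by simp
  qed simp
next
  case (Cons c cs)
  show ?case
  proof (cases ds)
    case Nil
    have "length (foldr dsum (c # cs) []) > 0" using Cons(2) by (simp add: nonempty_indecomposable_iff)
    then show ?thesis unfolding Cons.prems(3) Nil by simp
  next
    case (Cons d ds')
    have "c = d \<and> foldr dsum cs [] = foldr dsum ds' []"
      by (rule dsum_cancel[OF _ _ foldr_dsum_perms foldr_dsum_perms])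
        (use Cons.prems Cons in auto)
    then show ?thesis using Cons.IH[of ds'] Cons.prems Cons by simp
  qed
qed

lemma components_exist:
  "\<rho> \<in> perms n \<Longrightarrow> \<exists>cs. (\<forall>c\<in>set cs. nonempty_indecomposable c) \<and> \<rho> = foldr dsum cs []"
proof (induction n arbitrary: \<rho> rule: less_induct)
  case (less n)
  consider "n = 0" | "n > 0" "splits \<rho> = {}" | "splits \<rho> \<noteq> {}" by blast
  then show ?case
  proof cases
    case 1
    then show ?thesis using less(2) length_perms[OF less(2)] by (intro exI[of _ "[]"]) simp
  next
    case 2
    then show ?thesis using less(2) length_perms[OF less(2)]
      by (intro exI[of _ "[\<rho>]"]) (auto simp: nonempty_indecomposable_iff)
  next
    case 3
    \<comment> \<open>The least cut splits off the first component: a cut inside it would be a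
      smaller cut of \<rho>.\<close>
    define c where "c = Min (splits \<rho>)"
    have c: "c \<in> splits \<rho>" "\<And>j. j \<in> splits \<rho> \<Longrightarrow> c \<le> j" using 3 finite_splits by (simp_all add: c_def)
    obtain \<alpha> \<beta> where ab: "\<alpha> \<in> perms c" "\<beta> \<in> perms (n - c)" "\<rho> = dsum \<alpha> \<beta>" "0 < c" "0 < n - c"
      using perm_splitE[OF less(2) c(1)] .
    have "splits \<alpha> = {}"
    proof (rule equals0I)
      fix j assume j: "j \<in> splits \<alpha>"
      then have "j \<in> splits \<rho>" using splits_dsum[OF ab(1,2,4,5)] ab(3) by blast
      moreover have "j < c" using j length_perms[OF ab(1)] by (simp add: splits_def)
      ultimately show False using c(2) by fastforce
    qed
    then have "nonempty_indecomposable \<alpha>"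
      using ab(1,4) length_perms[OF ab(1)] by (auto simp: nonempty_indecomposable_iff)
    moreover obtain cs where "\<forall>c\<in>set cs. nonempty_indecomposable c" "\<beta> = foldr dsum cs []"
      using less(1)[OF _ ab(2)] ab(4,5) by auto
    ultimately show ?thesis using ab(3) by (intro exI[of _ "\<alpha> # cs"]) simp
  qed
qed

lemma components_foldr_dsum:
  assumes "\<forall>c\<in>set cs. nonempty_indecomposable c"
  shows "components (foldr dsum cs []) = cs"
  unfolding components_def
  by (rule the_equality) (use assms foldr_dsum_inject in blast)+

lemma components_spec:
  assumes "\<rho> \<in> perms n"
  shows "\<forall>c\<in>set (components \<rho>). nonempty_indecomposable c" "\<rho> = foldr dsum (components \<rho>) []"
  using components_exist[OF assms] components_foldr_dsum by metis+

lemma card_splits_foldr_dsum: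
  assumes "\<forall>c\<in>set (c # cs). nonempty_indecomposable c"
  shows "card (splits (foldr dsum (c # cs) [])) = length cs"
  using assms
proof (induction cs arbitrary: c)
  case Nil
  then show ?case by (simp add: nonempty_indecomposable_iff)
next
  case (Cons d cs)
  define \<beta> where "\<beta> = foldr dsum (d # cs) []"
  have b: "card (splits \<beta>) = length cs" using Cons by (simp add: \<beta>_def)
  have bp: "\<beta> \<in> perms (length \<beta>)" unfolding \<beta>_def by (rule foldr_dsum_perms) (use Cons(2) in simp)
  have b0: "0 < length \<beta>" using Cons(2) by (simp add: \<beta>_def nonempty_indecomposable_iff)
  have c: "c \<in> perms (length c)" "0 < length c" "splits c = {}"
    using Cons(2) by (simp_all add: nonempty_indecomposable_iff)
  have "splits (dsum c \<beta>) = insert (length c) ((\<lambda>j. j + length c) ` splits \<beta>)"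
    using splits_dsum[OF c(1) bp c(2) b0] c(3) by simp
  moreover have "length c \<notin> (\<lambda>j. j + length c) ` splits \<beta>" by (auto simp: splits_def)
  moreover have "card ((\<lambda>j. j + length c) ` splits \<beta>) = card (splits \<beta>)"
    by (rule card_image) (simp add: inj_on_def)
  ultimately have "card (splits (dsum c \<beta>)) = Suc (length cs)" using b finite_splits[of \<beta>] by simp
  then show ?case by (simp add: \<beta>_def)
qed

lemma comp_num_eq:
  assumes "\<rho> \<in> perms n" "n > 0" shows "comp_num \<rho> = Suc (card (splits \<rho>))"
proof -
  note cs = components_spec[OF assms(1)]
  show ?thesis
  proof (cases "components \<rho>")
    case Nil
    then show ?thesis using cs(2) assms length_perms[OF assms(1)] by simp
  next
    case (Cons c cs')
    then show ?thesis using card_splits_foldr_dsum[of c cs'] cs unfolding comp_num_def by simp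
  qed
qed

section \<open>Prepending and deleting a first entry\<close>

definition ins :: "nat \<Rightarrow> nat list \<Rightarrow> nat list" where
  "ins a \<rho> = a # map (\<lambda>x. if x < a then x else Suc x) \<rho>"

lemma hd_ins [simp]: "hd (ins a \<rho>) = a"
  by (simp add: ins_def)

lemma length_ins [simp]: "length (ins a \<rho>) = Suc (length \<rho>)"
  by (simp add: ins_def)

lemma tl_ins_order_iso: "order_iso (tl (ins a \<rho>)) \<rho>"
  unfolding ins_def list.sel by (rule order_iso_map) (simp add: strict_mono_on_def)

lemma splits_tl_ins: "splits (tl (ins a \<rho>)) = splits \<rho>"
  by (rule splits_order_iso[OF tl_ins_order_iso])

lemma ins_perms:
  assumes "\<rho> \<in> perms n" "1 \<le> a" "a \<le> Suc n" shows "ins a \<rho> \<in> perms (Suc n)"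
proof -
  have l: "length \<rho> = n" "distinct \<rho>" "set \<rho> = {1..n}" using assms length_perms perms_iff by auto
  have "inj_on (\<lambda>x. if x < a then x else Suc x) (set \<rho>)"
    by (rule inj_onI) (simp split: if_splits)
  then have "distinct (ins a \<rho>)" using l(2) by (auto simp: ins_def distinct_map)
  moreover have "set (ins a \<rho>) \<subseteq> {1..length (ins a \<rho>)}"
    unfolding length_ins ins_def l(1) using assms(2,3) l(3,1) by auto
  ultimately show ?thesis using permsI[of "ins a \<rho>"] l by simp
qed

lemma removeAll_hd: "distinct s \<Longrightarrow> s \<noteq> [] \<Longrightarrow> removeAll (hd s) s = tl s"
  by (cases s) simp_all

lemma removeAll_last: "distinct s \<Longrightarrow> s \<noteq> [] \<Longrightarrow> removeAll (last s) s = butlast s"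
  by (cases s rule: rev_cases) simp_all

lemma splits_del: "splits (del \<pi> e) = splits (removeAll e \<pi>)"
  unfolding del_def by (rule splits_order_iso[OF order_iso_standardize])

lemma del_ins:
  assumes "\<rho> \<in> perms n" "1 \<le> a" "a \<le> Suc n" shows "del (ins a \<rho>) a = \<rho>"
proof -
  have d: "distinct (ins a \<rho>)" using ins_perms[OF assms] by (simp add: perms_iff)
  have "removeAll a (ins a \<rho>) = tl (ins a \<rho>)"
    using removeAll_hd[OF d] by (simp add: ins_def)
  moreover have "distinct (tl (ins a \<rho>))" using d by (rule distinct_tl)
  ultimately show ?thesis
    unfolding del_def using standardize_eqI[OF assms(1) _ tl_ins_order_iso] by simp
qed

text \<open>With \<open>del_ins\<close>, this shows that a nonempty permutation is determined by its
  first entry and the result of deleting it, which resolves the definite description in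
  \<open>f_case1\<close>.\<close>

lemma ins_del:
  assumes "\<pi> \<in> perms n" "0 < n" shows "ins (hd \<pi>) (del \<pi> (hd \<pi>)) = \<pi>"
proof -
  have l: "length \<pi> = n" "distinct \<pi>" "set \<pi> = {1..n}" using assms length_perms perms_iff by auto
  obtain h t where ht: "\<pi> = h # t" using l assms(2) by (cases \<pi>) auto
  have t: "h \<notin> set t" "insert h (set t) = {1..n}" using l ht by auto
  then have st: "set t = {1..n} - {h}" by blast
  \<comment> \<open>Deleting h lowers exactly the ranks of the entries above h; the conditional
    restores them.\<close>
  have "(if card {y \<in> set t. y \<le> x} < h then card {y \<in> set t. y \<le> x}
      else Suc (card {y \<in> set t. y \<le> x})) = x" if x: "x \<in> set t" for x
  proof (cases "x < h")
    case True
    have "x \<in> {1..n}" using x st by blast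
    then have "{y \<in> set t. y \<le> x} = {1..x}" unfolding st using True by auto
    then show ?thesis using True by simp
  next
    case False
    have x1: "x \<in> {1..n}" "x \<noteq> h" "h \<in> {1..n}" using x st t(2) by blast+
    then have "{y \<in> set t. y \<le> x} = {1..x} - {h}" unfolding st using False by auto
    moreover have "card ({1..x} - {h}) = x - 1" using False x1 by (subst card_Diff_singleton) auto
    ultimately show ?thesis using False x1 by simp
  qed
  then have "map (\<lambda>x. if x < h then x else Suc x) (standardize t) = t"
    unfolding standardize_def map_map by (intro map_idI) simp
  then show ?thesis unfolding ht del_def ins_def using t(1) by (simp add: removeAll_id)
qed

subsection \<open>The map f on direct sums\<close>

lemma nth_dsum_left: "i < length \<alpha> \<Longrightarrow> dsum \<alpha> \<beta> ! i = \<alpha> ! i"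
  by (simp add: dsum_def nth_append)

lemma nth_dsum_right: "i < length \<beta> \<Longrightarrow> dsum \<alpha> \<beta> ! (length \<alpha> + i) = \<beta> ! i + length \<alpha>"
  by (simp add: dsum_def nth_append)

lemma id_perm_perms: "id_perm m \<in> perms m"
  by (auto simp: id_perm_def perms_iff simp del: upt_Suc)

lemma length_id_perm [simp]: "length (id_perm m) = m"
  by (simp add: id_perm_def del: upt_Suc)

lemma id_perm_Suc: "id_perm (Suc m) = dsum [1] (id_perm m)"
proof -
  have "[1..<Suc (Suc m)] = 1 # [Suc 1..<Suc (Suc m)]" by (rule upt_conv_Cons) simp
  also have "[Suc 1..<Suc (Suc m)] = map Suc [1..<Suc m]" by (rule map_Suc_upt[symmetric])
  finally show ?thesis by (simp add: id_perm_def dsum_def del: upt_Suc)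
qed

lemma id_perm_Suc': "id_perm (Suc m) = dsum (id_perm m) [1]"
proof -
  have "[1..<Suc (Suc m)] = [1..<Suc m] @ [Suc m]" by (rule upt_Suc_append) simp
  then show ?thesis by (simp add: id_perm_def dsum_def del: upt_Suc)
qed

lemma sorted_perm_eq_id:
  assumes "\<beta> \<in> perms b" "sorted_wrt (<) \<beta>" shows "\<beta> = id_perm b"
proof (rule strict_sorted_equal[OF _ assms(2)])
  show "sorted_wrt (<) (id_perm b)" unfolding id_perm_def by (rule sorted_wrt_upt)
  show "set \<beta> = set (id_perm b)" using assms(1) id_perm_perms[of b] unfolding perms_iff by blast
qed

text \<open>Behind the first component nothing is out of order, because an inversion there would
  form a 132 with the first entry of \<alpha>. So the rest is an identity, possibly empty.\<close>

lemma avoids_132_decomp: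
  assumes "\<alpha> \<in> perms a" "0 < a" "avoids \<alpha> [1,3,2]"
  obtains \<sigma> m where "nonempty_indecomposable \<sigma>" "avoids \<sigma> [1,3,2]" "\<alpha> = dsum \<sigma> (id_perm m)"
proof (cases "splits \<alpha> = {}")
  case True
  then have "nonempty_indecomposable \<alpha>"
    using assms length_perms[OF assms(1)] by (auto simp: nonempty_indecomposable_iff)
  moreover have "\<alpha> = dsum \<alpha> (id_perm 0)" by (simp add: id_perm_def)
  ultimately show ?thesis using that assms(3) by blast
next
  case False
  define c where "c = Min (splits \<alpha>)"
  have c: "c \<in> splits \<alpha>" "\<And>j. j \<in> splits \<alpha> \<Longrightarrow> c \<le> j" using False finite_splits by (simp_all add: c_def)
  obtain \<sigma> \<beta> where ab: "\<sigma> \<in> perms c" "\<beta> \<in> perms (a - c)" "\<alpha> = dsum \<sigma> \<beta>" "0 < c" "0 < a - c"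
    using perm_splitE[OF assms(1) c(1)] .
  have l: "length \<sigma> = c" "length \<beta> = a - c" using ab length_perms by auto
  have "splits \<sigma> = {}"
  proof (rule equals0I)
    fix j assume j: "j \<in> splits \<sigma>"
    then have "j \<in> splits \<alpha>" using splits_dsum[OF ab(1,2,4,5)] ab(3) by blast
    moreover have "j < c" using j l by (simp add: splits_def)
    ultimately show False using c(2) by fastforce
  qed
  then have "nonempty_indecomposable \<sigma>"
    using ab(1,4) l by (auto simp: nonempty_indecomposable_iff)
  moreover have "avoids \<sigma> [1,3,2]"
    by (rule avoids_subseq[OF assms(3) prefix_imp_subseq]) (simp add: ab(3) dsum_def)
  moreover have "sorted_wrt (<) \<beta>"
    unfolding sorted_wrt_iff_nth_less
  proof (intro allI impI)
    fix i j assume ij: "i < j" "j < length \<beta>"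
    show "\<beta> ! i < \<beta> ! j"
    proof (rule ccontr)
      assume "\<not> \<beta> ! i < \<beta> ! j"
      moreover have "\<beta> ! i \<noteq> \<beta> ! j" using ij ab(2) by (simp add: perms_iff nth_eq_iff_index_eq)
      ultimately have gt: "\<beta> ! j < \<beta> ! i" by simp
      have "\<alpha> ! 0 \<le> c" unfolding ab(3) using nth_dsum_left[of 0 \<sigma> \<beta>] perms_nth[OF ab(1), of 0] ab(4) l by simp
      moreover have "\<alpha> ! (c + i) = \<beta> ! i + c" "\<alpha> ! (c + j) = \<beta> ! j + c"
        unfolding ab(3) using nth_dsum_right[of _ \<beta> \<sigma>] ij l by simp_all
      moreover have "1 \<le> \<beta> ! j" using perms_nth[OF ab(2)] ij l by simp
      ultimately have "\<alpha> ! 0 < \<alpha> ! (c + j)" "\<alpha> ! (c + j) < \<alpha> ! (c + i)" using gt by linarith+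
      moreover have "0 < c + i" "c + i < c + j" "c + j < length \<alpha>" using ab ij l by simp_all
      ultimately have "\<not> avoids \<alpha> [1,3,2]" unfolding contains_132_iff by blast
      then show False using assms(3) by blast
    qed
  qed
  then have "\<beta> = id_perm (a - c)" by (rule sorted_perm_eq_id[OF ab(2)])
  ultimately show ?thesis using that ab(3) by blast
qed

text \<open>An identity is a sum of components of length 1. In this form, uniqueness of \<sigma>, m
  and \<tau> follows from uniqueness of components.\<close>

lemma foldr_dsum_ones: "foldr dsum (replicate m [1] @ [\<tau>]) [] = dsum (id_perm m) \<tau>"
proof (induction m)
  case 0
  then show ?case by (simp add: id_perm_def)
next
  case (Suc m)
  then show ?case by (simp add: id_perm_Suc dsum_assoc)
qed

lemma nonempty_indecomposable_1: "nonempty_indecomposable [1]"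
  by (auto simp: nonempty_indecomposable_iff perms_iff splits_def)

lemma dsum_id_inject:
  assumes "nonempty_indecomposable \<sigma>" "nonempty_indecomposable \<tau>"
    "nonempty_indecomposable \<sigma>'" "nonempty_indecomposable \<tau>'"
    "dsum \<sigma> (dsum (id_perm m) \<tau>) = dsum \<sigma>' (dsum (id_perm m') \<tau>')"
  shows "\<sigma> = \<sigma>' \<and> m = m' \<and> \<tau> = \<tau>'"
proof -
  have "\<sigma> # replicate m [1] @ [\<tau>] = \<sigma>' # replicate m' [1] @ [\<tau>']"
    by (rule foldr_dsum_inject)
      (use assms nonempty_indecomposable_1 foldr_dsum_ones in \<open>auto simp del: foldr_append\<close>)
  then have "\<sigma> = \<sigma>'" "replicate m [1] @ [\<tau>] = replicate m' [1] @ [\<tau>']" by simp_all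
  then show ?thesis by (metis append_eq_append_conv append1_eq_conv length_replicate)
qed

text \<open>Any entry of \<tau> extends a 132 in \<alpha> to a 1324, and any entry of \<alpha>
  extends a 213 in \<tau>.\<close>

lemma dsum_avoids_1324D:
  assumes "\<alpha> \<in> perms a" "0 < a" "\<tau> \<in> perms t" "0 < t" "avoids (dsum \<alpha> \<tau>) [1,3,2,4]"
  shows "avoids \<alpha> [1,3,2]" "avoids \<tau> [2,1,3]"
proof -
  have l: "length \<alpha> = a" "length \<tau> = t" using assms length_perms by auto
  show "avoids \<alpha> [1,3,2]"
  proof (rule ccontr)
    assume "\<not> avoids \<alpha> [1,3,2]"
    then obtain i j k where ijk: "i < j" "j < k" "k < length \<alpha>" "\<alpha> ! i < \<alpha> ! k" "\<alpha> ! k < \<alpha> ! j"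
      unfolding contains_132_iff by blast
    have "dsum \<alpha> \<tau> ! a = \<tau> ! 0 + a" using nth_dsum_right[of 0 \<tau> \<alpha>] l assms(4) by simp
    moreover have "1 \<le> \<tau> ! 0" "\<alpha> ! j \<le> a" using perms_nth[OF assms(3)] perms_nth[OF assms(1)] assms(4) ijk l by simp_all
    ultimately have "\<alpha> ! j < dsum \<alpha> \<tau> ! a" by linarith
    moreover have "dsum \<alpha> \<tau> ! i = \<alpha> ! i" "dsum \<alpha> \<tau> ! j = \<alpha> ! j" "dsum \<alpha> \<tau> ! k = \<alpha> ! k"
      using ijk by (simp_all add: nth_dsum_left)
    moreover have "a < length (dsum \<alpha> \<tau>)" "k < a" using l assms(4) ijk by simp_all
    ultimately have "\<not> avoids (dsum \<alpha> \<tau>) [1,3,2,4]" unfolding contains_1324_iff using ijk by metis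
    then show False using assms(5) by blast
  qed
  show "avoids \<tau> [2,1,3]"
  proof (rule ccontr)
    assume "\<not> avoids \<tau> [2,1,3]"
    then obtain i j k where ijk: "i < j" "j < k" "k < length \<tau>" "\<tau> ! j < \<tau> ! i" "\<tau> ! i < \<tau> ! k"
      unfolding contains_213_iff by blast
    have "dsum \<alpha> \<tau> ! 0 \<le> a" using nth_dsum_left[of 0 \<alpha> \<tau>] perms_nth[OF assms(1), of 0] assms(2) l by simp
    moreover have e: "dsum \<alpha> \<tau> ! (a + i) = \<tau> ! i + a" "dsum \<alpha> \<tau> ! (a + j) = \<tau> ! j + a" "dsum \<alpha> \<tau> ! (a + k) = \<tau> ! k + a"
      using nth_dsum_right[of _ \<tau> \<alpha>] ijk l by simp_all
    moreover have "1 \<le> \<tau> ! j" using perms_nth[OF assms(3)] ijk l by simp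
    ultimately have "dsum \<alpha> \<tau> ! 0 < dsum \<alpha> \<tau> ! (a + j)" by linarith
    moreover have "dsum \<alpha> \<tau> ! (a + j) < dsum \<alpha> \<tau> ! (a + i)" "dsum \<alpha> \<tau> ! (a + i) < dsum \<alpha> \<tau> ! (a + k)"
      using e ijk by simp_all
    moreover have "0 < a + i" "a + i < a + j" "a + j < a + k" "a + k < length (dsum \<alpha> \<tau>)"
      using ijk l assms(2) by simp_all
    ultimately have "\<not> avoids (dsum \<alpha> \<tau>) [1,3,2,4]" unfolding contains_1324_iff by blast
    then show False using assms(5) by blast
  qed
qed

text \<open>Since \<alpha> is \<sigma> followed by an identity, the new entry may be placed directly
  before the last component; later arguments need to know only \<tau>, not \<sigma> and m.\<close>

lemma f_tilde_dsum:
  assumes "\<alpha> \<in> perms a" "0 < a" "\<tau> \<in> perms t" "0 < t" "splits \<tau> = {}" "avoids (dsum \<alpha> \<tau>) [1,3,2,4]"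
  shows "f_tilde (dsum \<alpha> \<tau>) = dsum \<alpha> (dsum [1] \<tau>)"
proof -
  note av = dsum_avoids_1324D[OF assms(1-4,6)]
  obtain \<sigma> m where s: "nonempty_indecomposable \<sigma>" "avoids \<sigma> [1,3,2]" "\<alpha> = dsum \<sigma> (id_perm m)"
    using avoids_132_decomp[OF assms(1,2) av(1)] .
  have t: "nonempty_indecomposable \<tau>"
    using assms(3-5) length_perms[OF assms(3)] by (auto simp: nonempty_indecomposable_iff)
  have e: "dsum \<alpha> \<tau> = dsum \<sigma> (dsum (id_perm m) \<tau>)"
    "dsum \<alpha> (dsum [1] \<tau>) = dsum \<sigma> (dsum (id_perm (m + 1)) \<tau>)"
    unfolding s(3) by (simp_all add: dsum_assoc id_perm_Suc')
  show ?thesis unfolding f_tilde_def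
  proof (rule the_equality)
    show "\<exists>\<sigma>' m' \<tau>'. nonempty_indecomposable \<sigma>' \<and> avoids \<sigma>' [1,3,2] \<and>
      nonempty_indecomposable \<tau>' \<and> avoids \<tau>' [2,1,3] \<and>
      dsum \<alpha> \<tau> = dsum \<sigma>' (dsum (id_perm m') \<tau>') \<and>
      dsum \<alpha> (dsum [1] \<tau>) = dsum \<sigma>' (dsum (id_perm (m' + 1)) \<tau>')"
      using s t av e by blast
  next
    fix \<rho> assume "\<exists>\<sigma>' m' \<tau>'. nonempty_indecomposable \<sigma>' \<and> avoids \<sigma>' [1,3,2] \<and>
      nonempty_indecomposable \<tau>' \<and> avoids \<tau>' [2,1,3] \<and>
      dsum \<alpha> \<tau> = dsum \<sigma>' (dsum (id_perm m') \<tau>') \<and> \<rho> = dsum \<sigma>' (dsum (id_perm (m' + 1)) \<tau>')"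
    then obtain \<sigma>' m' \<tau>' where r: "nonempty_indecomposable \<sigma>'" "nonempty_indecomposable \<tau>'"
      "dsum \<alpha> \<tau> = dsum \<sigma>' (dsum (id_perm m') \<tau>')" "\<rho> = dsum \<sigma>' (dsum (id_perm (m' + 1)) \<tau>')"
      by blast
    have "\<sigma> = \<sigma>' \<and> m = m' \<and> \<tau> = \<tau>'"
      by (rule dsum_id_inject[OF s(1) t r(1,2)]) (use e(1) r(3) in simp)
    then show "\<rho> = dsum \<alpha> (dsum [1] \<tau>)" using r(4) e(2) by simp
  qed
qed

section \<open>Deleting the first, last, least or greatest entry, under the symmetries\<close>

lemma decomposable_del_iff:
  "\<pi> \<in> perms n \<Longrightarrow> e \<in> {1..n} \<Longrightarrow> decomposable (del \<pi> e) \<longleftrightarrow> splits (removeAll e \<pi>) \<noteq> {}"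
  using decomposable_iff[OF del_perms] splits_del by metis

lemma hd_nth_perm: "\<pi> \<in> perms n \<Longrightarrow> 0 < n \<Longrightarrow> hd \<pi> = \<pi> ! 0"
  using length_perms by (metis hd_conv_nth length_greater_0_conv)

lemma last_nth_perm: "\<pi> \<in> perms n \<Longrightarrow> 0 < n \<Longrightarrow> last \<pi> = \<pi> ! (n - 1)"
  using length_perms by (metis last_conv_nth length_greater_0_conv)

context
  fixes \<pi> n assumes p: "\<pi> \<in> perms n" and n: "0 < n"
begin

lemma splits_removeAll_1_inv_perm:
  "splits (removeAll 1 (inv_perm \<pi>)) = splits (removeAll (hd \<pi>) \<pi>)"
  using splits_removeAll_inv_perm[OF p n] hd_nth_perm[OF p n] by simp

lemma splits_removeAll_n_inv_perm:
  "splits (removeAll n (inv_perm \<pi>)) = splits (removeAll (last \<pi>) \<pi>)"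
  using splits_removeAll_inv_perm[OF p, of "n - 1"] last_nth_perm[OF p n] n by simp

lemma hd_rc: "hd (rc \<pi>) = n + 1 - last \<pi>"
  using rc_nth[of 0 \<pi>] length_perms[OF p] n hd_nth_perm[OF rc_perms[OF p] n] last_nth_perm[OF p n] by simp

lemma last_rc: "last (rc \<pi>) = n + 1 - hd \<pi>"
  using rc_nth[of "n - 1" \<pi>] length_perms[OF p] n last_nth_perm[OF rc_perms[OF p] n] hd_nth_perm[OF p n] by simp

lemma splits_removeAll_hd_rc:
  "splits (removeAll (hd (rc \<pi>)) (rc \<pi>)) = (\<lambda>c. n - 1 - c) ` splits (removeAll (last \<pi>) \<pi>)"
  unfolding hd_rc by (rule splits_removeAll_rc[OF p]) (use perms_hd_last(2)[OF p n] in auto)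

lemma splits_removeAll_last_rc:
  "splits (removeAll (last (rc \<pi>)) (rc \<pi>)) = (\<lambda>c. n - 1 - c) ` splits (removeAll (hd \<pi>) \<pi>)"
  unfolding last_rc by (rule splits_removeAll_rc[OF p]) (use perms_hd_last(1)[OF p n] in auto)

lemma splits_removeAll_1_rc:
  "splits (removeAll 1 (rc \<pi>)) = (\<lambda>c. n - 1 - c) ` splits (removeAll n \<pi>)"
  using splits_removeAll_rc[OF p, of n] n by simp

lemma splits_removeAll_n_rc:
  "splits (removeAll n (rc \<pi>)) = (\<lambda>c. n - 1 - c) ` splits (removeAll 1 \<pi>)"
  using splits_removeAll_rc[OF p, of 1] n by simp

end

lemma splits_removeAll_hd_inv_perm:
  assumes "\<pi> \<in> perms n" "0 < n"
  shows "splits (removeAll (hd (inv_perm \<pi>)) (inv_perm \<pi>)) = splits (removeAll 1 \<pi>)"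
  using splits_removeAll_1_inv_perm[OF inv_perm_perms[OF assms(1)] assms(2)]
  by (simp add: inv_perm_inv_perm[OF assms(1)])

lemma splits_removeAll_last_inv_perm:
  assumes "\<pi> \<in> perms n" "0 < n"
  shows "splits (removeAll (last (inv_perm \<pi>)) (inv_perm \<pi>)) = splits (removeAll n \<pi>)"
  using splits_removeAll_n_inv_perm[OF inv_perm_perms[OF assms(1)] assms(2)]
  by (simp add: inv_perm_inv_perm[OF assms(1)])

lemma almost_decomposableI:
  assumes "\<pi> \<in> perms n" "0 < n" "splits \<pi> = {}" "e \<in> {1, hd \<pi>, n, last \<pi>}" "splits (removeAll e \<pi>) \<noteq> {}"
  shows "almost_decomposable \<pi>"
proof -
  have "e \<in> {1..n}" using assms(4) perms_hd_last[OF assms(1,2)] assms(2) by auto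
  then show ?thesis unfolding almost_decomposable_def length_perms[OF assms(1)]
    using assms decomposable_iff[OF assms(1)] decomposable_del_iff[OF assms(1)] by blast
qed

lemma f_incompatibleI:
  assumes "\<pi> \<in> perms n" "decomposable \<pi> \<or> almost_decomposable \<pi>"
    "avoids \<pi> [1,3,2,4]" "avoids \<pi> p" "\<not> avoids (f_map \<pi>) p"
  shows "f_incompatible p"
  using assms unfolding f_compatible_def by blast

subsection \<open>Witnesses of incompatibility\<close>

text \<open>A cut no later than the end of \<open>xs\<close> would have a on its left and the
  smaller y on its right; a later one would be a cut of \<open>ys\<close>.\<close>

lemma splits_Cons_append_empty:
  assumes "splits ys = {}" "y \<in> set ys" "y < a"
  shows "splits (a # xs @ ys) = {}"
proof (rule equals0I)
  fix j assume j: "j \<in> splits (a # xs @ ys)"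
  then have j': "0 < j" "j < Suc (length xs + length ys)"
    and lt: "\<And>u v. u \<in> set (take j (a # xs @ ys)) \<Longrightarrow> v \<in> set (drop j (a # xs @ ys)) \<Longrightarrow> u < v"
    by (auto simp: splits_def)
  show False
  proof (cases "j \<le> Suc (length xs)")
    case True
    then have "drop j (a # xs @ ys) = drop (j - 1) xs @ ys" using j' by (cases j) simp_all
    then have "y \<in> set (drop j (a # xs @ ys))" using assms(2) by simp
    moreover have "a \<in> set (take j (a # xs @ ys))" using j' by (cases j) simp_all
    ultimately show False using lt assms(3) by fastforce
  next
    case False
    define k where "k = j - Suc (length xs)"
    have k: "0 < k" "k < length ys" "j = Suc (length xs + k)" using False j' by (simp_all add: k_def)
    have "u < v" if "u \<in> set (take k ys)" "v \<in> set (drop k ys)" for u v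
      by (rule lt) (use that k in simp_all)
    then have "k \<in> splits ys" using k by (simp add: splits_def)
    then show False using assms(1) by blast
  qed
qed

text \<open>If \<open>\<pi>\<close> arises from \<open>\<alpha> \<oplus> \<tau>\<close>, with \<open>\<tau>\<close> its last component, by prepending a value \<open>a\<close> that exceeds
  an entry of \<open>\<tau>\<close>, then \<open>f(\<pi>)\<close> arises from \<open>\<alpha> \<oplus> 1 \<oplus> \<tau>\<close> by prepending the same \<open>a\<close>.\<close>

locale witness =
  fixes \<alpha> \<tau> :: "nat list" and c t a :: nat
  assumes alpha: "\<alpha> \<in> perms c" and c0: "0 < c"
    and tau: "\<tau> \<in> perms t" and t0: "0 < t" and tau_indec: "splits \<tau> = {}"
    and avoids_sum: "avoids (dsum \<alpha> \<tau>) [1,3,2,4]"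
    and a_ge: "c + 2 \<le> a" and a_le: "a \<le> c + t + 1"
begin

abbreviation "N \<equiv> Suc (c + t)"

definition \<pi> where "\<pi> = ins a (dsum \<alpha> \<tau>)"
definition F where "F = ins a (dsum \<alpha> (dsum [1] \<tau>))"
definition \<tau>' where "\<tau>' = map (\<lambda>x. if x < a then x else Suc x) (map (\<lambda>x. x + c) \<tau>)"

lemma pi_perms: "\<pi> \<in> perms N"
  unfolding \<pi>_def by (rule ins_perms[OF dsum_perms[OF alpha tau]]) (use a_ge a_le in auto)

lemma sum1_perms: "dsum \<alpha> (dsum [1] \<tau>) \<in> perms (c + (1 + t))"
  by (rule dsum_perms[OF alpha dsum_perms[OF _ tau]]) (simp add: perms_iff)

lemma F_perms: "F \<in> perms (Suc N)"
proof -
  have "F \<in> perms (Suc (c + (1 + t)))"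
    unfolding F_def by (rule ins_perms[OF sum1_perms]) (use a_ge a_le in auto)
  then show ?thesis by simp
qed

lemma pi_eq: "\<pi> = a # \<alpha> @ \<tau>'"
proof -
  have "length \<alpha> = c" "set \<alpha> = {1..c}" using alpha length_perms perms_iff by auto
  then show ?thesis using a_ge
    by (auto simp: \<pi>_def ins_def dsum_def \<tau>'_def intro!: map_idI)
qed

lemma splits_tau': "splits \<tau>' = {}"
proof -
  have "splits \<tau>' = splits (map (\<lambda>x. x + c) \<tau>)"
    unfolding \<tau>'_def by (rule splits_order_iso, rule order_iso_map) (simp add: strict_mono_on_def)
  then show ?thesis using tau_indec by simp
qed

lemma tau'_ge: "x \<in> set \<tau>' \<Longrightarrow> c + 1 \<le> x"
proof -
  assume "x \<in> set \<tau>'"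
  then obtain y where y: "y \<in> set \<tau>" "x = y + c \<or> x = Suc (y + c)" by (auto simp: \<tau>'_def split: if_splits)
  then have "1 \<le> y" using tau unfolding perms_iff by simp
  then show ?thesis using y(2) by linarith
qed

text \<open>By \<open>a_ge\<close> the least entry of the last component lies below a. This single
  entry blocks every cut before that component.\<close>

lemma tau'_low: "c + 1 \<in> set \<tau>'"
proof -
  have "1 \<in> set \<tau>" using tau t0 unfolding perms_iff by simp
  then have "1 + c \<in> set (map (\<lambda>x. x + c) \<tau>)" by simp
  then show ?thesis using a_ge unfolding \<tau>'_def by force
qed

lemma splits_pi: "splits \<pi> = {}"
  unfolding pi_eq by (rule splits_Cons_append_empty[OF splits_tau' tau'_low]) (use a_ge in simp)

text \<open>The value 1 belongs to \<alpha>, and the obstruction to a cut involves only a and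
  \<open>\<tau>'\<close>.\<close>

lemma splits_removeAll_1: "splits (removeAll 1 \<pi>) = {}"
proof -
  have "1 \<notin> set \<tau>'" using tau'_ge[of 1] c0 by linarith
  moreover have "a \<noteq> 1" using a_ge by simp
  ultimately have "removeAll 1 \<pi> = a # removeAll 1 \<alpha> @ \<tau>'"
    unfolding pi_eq by (simp add: removeAll_id)
  then show ?thesis
    using splits_Cons_append_empty[OF splits_tau' tau'_low] a_ge by simp
qed

lemma hd_pi: "hd \<pi> = a"
  by (simp add: \<pi>_def)

lemma splits_removeAll_hd: "splits (removeAll (hd \<pi>) \<pi>) \<noteq> {}"
proof -
  have "distinct \<pi>" "\<pi> \<noteq> []" using pi_perms by (auto simp: perms_iff)
  then have "splits (removeAll (hd \<pi>) \<pi>) = splits (tl \<pi>)" by (simp add: removeAll_hd)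
  also have "\<dots> = splits (dsum \<alpha> \<tau>)" unfolding \<pi>_def by (rule splits_tl_ins)
  finally show ?thesis using splits_dsum[OF alpha tau c0 t0] by blast
qed

text \<open>Only an occurrence that uses a as its 1 would be new. There the first entry of \<alpha>
  can replace a: it is smaller than a, and it is not the 3 of the occurrence, since that exceeds
  a.\<close>

lemma avoids_pi: "avoids \<pi> [1,3,2,4]"
proof (rule ccontr)
  assume "\<not> avoids \<pi> [1,3,2,4]"
  then obtain i j k l where ijkl: "i < j" "j < k" "k < l" "l < length \<pi>"
     "\<pi> ! i < \<pi> ! k" "\<pi> ! k < \<pi> ! j" "\<pi> ! j < \<pi> ! l"
    unfolding contains_1324_iff by blast
  have tl: "avoids (tl \<pi>) [1,3,2,4]"
    unfolding \<pi>_def using avoids_order_iso[OF tl_ins_order_iso] avoids_sum by blast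
  have n: "\<pi> ! m = tl \<pi> ! (m - 1)" if "0 < m" for m
    using that unfolding pi_eq by simp
  have "\<exists>i'<j - 1. tl \<pi> ! i' < \<pi> ! k"
  proof (cases "i = 0")
    case True
    have p0: "tl \<pi> ! 0 \<le> c"
      unfolding pi_eq using perms_nth[OF alpha, of 0] c0 length_perms[OF alpha] by (simp add: nth_append)
    have a: "a < \<pi> ! k" "a < \<pi> ! j" using ijkl True by (simp_all add: pi_eq)
    have "j - 1 \<noteq> 0"
    proof
      assume "j - 1 = 0"
      then have "\<pi> ! j = tl \<pi> ! 0" using n ijkl(1) by simp
      then show False using p0 a a_ge by linarith
    qed
    then show ?thesis using p0 a a_ge by (intro exI[of _ 0]) simp
  next
    case False
    then show ?thesis using n ijkl by (intro exI[of _ "i - 1"]) auto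
  qed
  then obtain i' where i': "i' < j - 1" "tl \<pi> ! i' < \<pi> ! k" by blast
  have "j - 1 < k - 1" "k - 1 < l - 1" "l - 1 < length (tl \<pi>)" using ijkl i' by simp_all
  moreover have "\<pi> ! j = tl \<pi> ! (j - 1)" "\<pi> ! k = tl \<pi> ! (k - 1)" "\<pi> ! l = tl \<pi> ! (l - 1)"
    using n ijkl by simp_all
  ultimately have "\<not> avoids (tl \<pi>) [1,3,2,4]" unfolding contains_1324_iff using i' ijkl by metis
  then show False using tl by blast
qed

lemma f_case1_pi: "f_case1 \<pi> = F"
proof -
  have d: "del \<pi> (hd \<pi>) = dsum \<alpha> \<tau>"
    unfolding hd_pi unfolding \<pi>_def
    by (rule del_ins[OF dsum_perms[OF alpha tau]]) (use a_ge a_le in auto)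
  have ft: "f_tilde (del \<pi> (hd \<pi>)) = dsum \<alpha> (dsum [1] \<tau>)"
    unfolding d by (rule f_tilde_dsum[OF alpha c0 tau t0 tau_indec avoids_sum])
  show ?thesis unfolding f_case1_def ft length_perms[OF pi_perms]
  proof (rule the_equality)
    have "del F a = dsum \<alpha> (dsum [1] \<tau>)"
      unfolding F_def by (rule del_ins[OF sum1_perms]) (use a_ge a_le in auto)
    then show "F \<in> perms (N + 1) \<and> hd F = hd \<pi> \<and> del F (hd \<pi>) = dsum \<alpha> (dsum [1] \<tau>)"
      using F_perms hd_pi by (simp add: F_def)
  next
    fix \<rho> assume "\<rho> \<in> perms (N + 1) \<and> hd \<rho> = hd \<pi> \<and> del \<rho> (hd \<pi>) = dsum \<alpha> (dsum [1] \<tau>)"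
    then show "\<rho> = F" using ins_del[of \<rho> "N + 1"] hd_pi by (simp add: F_def)
  qed
qed

lemma N0: "0 < N" by simp

lemma indecomposable_sym:
  "\<not> decomposable \<pi>" "\<not> decomposable (inv_perm \<pi>)"
  "\<not> decomposable (rc \<pi>)" "\<not> decomposable (rc (inv_perm \<pi>))"
  using decomposable_iff[OF pi_perms] decomposable_iff[OF inv_perm_perms[OF pi_perms]]
    decomposable_iff[OF rc_perms[OF pi_perms]] decomposable_iff[OF rc_perms[OF inv_perm_perms[OF pi_perms]]]
    splits_pi splits_inv_perm[OF pi_perms] splits_rc[OF pi_perms] splits_rc[OF inv_perm_perms[OF pi_perms]]
  by simp_all

lemma dec_del_hd_1:
  assumes "\<rho> \<in> perms N"
  shows "decomposable (del \<rho> (hd \<rho>)) \<longleftrightarrow> splits (removeAll (hd \<rho>) \<rho>) \<noteq> {}"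
    "decomposable (del \<rho> 1) \<longleftrightarrow> splits (removeAll 1 \<rho>) \<noteq> {}"
  using decomposable_del_iff[OF assms] perms_hd_last(1)[OF assms N0] by simp_all

lemma f_case12_pi: "f_case12 \<pi> = F" "f_case12 (inv_perm \<pi>) = inv_perm F"
proof -
  show "f_case12 \<pi> = F"
    unfolding f_case12_def using dec_del_hd_1(1)[OF pi_perms] splits_removeAll_hd f_case1_pi by simp
  have "\<not> decomposable (del (inv_perm \<pi>) (hd (inv_perm \<pi>)))"
    using dec_del_hd_1(1)[OF inv_perm_perms[OF pi_perms]] splits_removeAll_hd_inv_perm[OF pi_perms N0]
      splits_removeAll_1 by simp
  then show "f_case12 (inv_perm \<pi>) = inv_perm F"
    unfolding f_case12_def using f_case1_pi inv_perm_inv_perm[OF pi_perms] by simp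
qed

lemma f_map_pi: "f_map \<pi> = F"
  unfolding f_map_def
  using indecomposable_sym(1) dec_del_hd_1(1)[OF pi_perms] splits_removeAll_hd f_case12_pi(1) by simp

lemma f_map_inv_pi: "f_map (inv_perm \<pi>) = inv_perm F"
proof -
  have "decomposable (del (inv_perm \<pi>) 1)"
    using dec_del_hd_1(2)[OF inv_perm_perms[OF pi_perms]] splits_removeAll_1_inv_perm[OF pi_perms N0]
      splits_removeAll_hd by simp
  then show ?thesis unfolding f_map_def using indecomposable_sym(2) f_case12_pi(2) by simp
qed

lemma f_incompatible_witness:
  assumes "q \<in> perms k" "avoids \<pi> q" "\<not> avoids F q"
  shows "f_incompatible q" "f_incompatible (inv_perm q)"
proof -
  note ip = inv_perm_perms[OF pi_perms]
  have "almost_decomposable \<pi>"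
    using splits_removeAll_hd by (intro almost_decomposableI[OF pi_perms N0 splits_pi, of "hd \<pi>"]) auto
  then show "f_incompatible q"
    using f_incompatibleI[OF pi_perms _ avoids_pi assms(2)] assms(3) f_map_pi by simp
  have "splits (inv_perm \<pi>) = {}" using splits_inv_perm[OF pi_perms] splits_pi by simp
  then have "almost_decomposable (inv_perm \<pi>)"
    using splits_removeAll_1_inv_perm[OF pi_perms N0] splits_removeAll_hd
    by (intro almost_decomposableI[OF ip N0, of 1]) auto
  moreover have "avoids (inv_perm \<pi>) [1,3,2,4]"
    using avoids_inv_perm[OF pi_perms perm_1324] inv_perm_1324 avoids_pi by simp
  moreover have "avoids (inv_perm \<pi>) (inv_perm q)" "\<not> avoids (inv_perm F) (inv_perm q)"
    using avoids_inv_perm[OF pi_perms assms(1)] avoids_inv_perm[OF F_perms assms(1)] assms by simp_all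
  ultimately show "f_incompatible (inv_perm q)"
    using f_incompatibleI[OF ip] f_map_inv_pi by simp
qed

text \<open>The two assumptions say that the reverse-complement of \<open>\<pi>\<close> falls under neither case (1) nor case (2)
  of the definition of \<open>f\<close>.\<close>

lemma f_map_rc_pi:
  assumes "splits (butlast \<pi>) = {}" "splits (removeAll N \<pi>) = {}"
  shows "f_map (rc \<pi>) = rc F" "f_map (rc (inv_perm \<pi>)) = rc (inv_perm F)"
proof -
  note ip = inv_perm_perms[OF pi_perms]
  have "distinct \<pi>" "\<pi> \<noteq> []" using pi_perms by (auto simp: perms_iff)
  then have bl: "splits (removeAll (last \<pi>) \<pi>) = {}" using assms(1) by (simp add: removeAll_last)
  have "\<not> decomposable (del (rc \<pi>) (hd (rc \<pi>)))" "\<not> decomposable (del (rc \<pi>) 1)"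
    using dec_del_hd_1[OF rc_perms[OF pi_perms]] splits_removeAll_hd_rc[OF pi_perms N0]
      splits_removeAll_1_rc[OF pi_perms N0] bl assms(2) by simp_all
  then show "f_map (rc \<pi>) = rc F"
    unfolding f_map_def using indecomposable_sym(3) rc_rc[OF pi_perms] f_case12_pi(1) by simp
  have "\<not> decomposable (del (rc (inv_perm \<pi>)) (hd (rc (inv_perm \<pi>))))"
      "\<not> decomposable (del (rc (inv_perm \<pi>)) 1)"
    using dec_del_hd_1[OF rc_perms[OF ip]] splits_removeAll_hd_rc[OF ip N0]
      splits_removeAll_1_rc[OF ip N0] splits_removeAll_last_inv_perm[OF pi_perms N0]
      splits_removeAll_n_inv_perm[OF pi_perms N0] bl assms(2) by simp_all
  then show "f_map (rc (inv_perm \<pi>)) = rc (inv_perm F)"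
    unfolding f_map_def using indecomposable_sym(4) rc_rc[OF ip] f_case12_pi(2) by simp
qed

lemma f_incompatible_rc_witness:
  assumes "q \<in> perms k" "avoids \<pi> q" "\<not> avoids F q"
    "splits (butlast \<pi>) = {}" "splits (removeAll N \<pi>) = {}"
  shows "f_incompatible (rc q)" "f_incompatible (inv_perm (rc q))"
proof -
  note ip = inv_perm_perms[OF pi_perms]
  note rp = rc_perms[OF pi_perms]
  note rip = rc_perms[OF ip]
  note f = f_map_rc_pi[OF assms(4,5)]
  have "almost_decomposable (rc \<pi>)"
    using splits_removeAll_last_rc[OF pi_perms N0] splits_removeAll_hd splits_rc[OF pi_perms] splits_pi
    by (intro almost_decomposableI[OF rp N0, of "last (rc \<pi>)"]) auto
  moreover have "avoids (rc \<pi>) [1,3,2,4]"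
    using avoids_rc[OF pi_perms perm_1324] rc_1324 avoids_pi by simp
  moreover have "avoids (rc \<pi>) (rc q)" "\<not> avoids (rc F) (rc q)"
    using avoids_rc[OF pi_perms assms(1)] avoids_rc[OF F_perms assms(1)] assms by simp_all
  ultimately show "f_incompatible (rc q)" using f_incompatibleI[OF rp] f by simp
  have "splits (rc (inv_perm \<pi>)) = {}"
    using splits_inv_perm[OF pi_perms] splits_rc[OF ip] splits_pi by simp
  \<comment> \<open>Deleting the maximum here mirrors deleting 1 from the inverse, hence deleting
    the first entry of \<pi>.\<close>
  then have "almost_decomposable (rc (inv_perm \<pi>))"
    using splits_removeAll_n_rc[OF ip N0] splits_removeAll_1_inv_perm[OF pi_perms N0] splits_removeAll_hd
    by (intro almost_decomposableI[OF rip N0, of N]) auto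
  moreover have "avoids (rc (inv_perm \<pi>)) [1,3,2,4]"
    using avoids_rc[OF ip perm_1324] rc_1324 avoids_inv_perm[OF pi_perms perm_1324] inv_perm_1324 avoids_pi
    by simp
  moreover have "avoids (rc (inv_perm \<pi>)) (rc (inv_perm q))" "\<not> avoids (rc (inv_perm F)) (rc (inv_perm q))"
    using avoids_inv_perm[OF pi_perms assms(1)] avoids_inv_perm[OF F_perms assms(1)] assms(2,3)
      avoids_rc[OF ip inv_perm_perms[OF assms(1)]]
      avoids_rc[OF inv_perm_perms[OF F_perms] inv_perm_perms[OF assms(1)]] by simp_all
  ultimately show "f_incompatible (inv_perm (rc q))"
    using f_incompatibleI[OF rip] f inv_perm_rc[OF assms(1)] by simp
qed

end

subsection \<open>Incompatible patterns\<close>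

text \<open>Conditions (b), (c) and (d) reduce to \<open>early_splits\<close> or \<open>indec_tail\<close> once condition (a) is excluded.
  The condition \<open>max_head\<close> is not one of the paper's: it arises when \<open>q\<close> satisfies \<open>indec_tail\<close>, ends in \<open>1\<close>
  and \<open>q\<^sup>r\<^sup>c\<close> is to be shown incompatible.\<close>

definition early_splits :: "nat list \<Rightarrow> bool" where
  "early_splits q \<longleftrightarrow> hd q < length q \<and> splits (tl q) \<noteq> {} \<and> (\<forall>c\<in>splits (tl q). c < hd q)"

definition indec_tail :: "nat list \<Rightarrow> bool" where
  "indec_tail q \<longleftrightarrow> 1 < hd q \<and> hd q < length q \<and> splits (tl q) = {} \<and> avoids (tl q) [2,1,3]"

definition max_head :: "nat list \<Rightarrow> bool" where
  "max_head q \<longleftrightarrow> hd q = length q \<and> 2 \<le> card (splits (tl q))"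

text \<open>In a 1324-avoider the cuts form an interval, so all components except the first and the
  last are single entries: an inversion between two cuts would form a 1324 with the first entry and
  the entry just behind the later cut.\<close>

lemma splits_between:
  assumes "distinct s" "avoids s [1,3,2,4]" "c1 \<in> splits s" "c2 \<in> splits s" "c1 < c" "c < c2"
  shows "c \<in> splits s"
proof -
  have c2: "0 < c1" "c2 < length s"
    and s1: "\<And>i j. i < c1 \<Longrightarrow> c1 \<le> j \<Longrightarrow> j < length s \<Longrightarrow> s ! i < s ! j"
    and s2: "\<And>i j. i < c2 \<Longrightarrow> c2 \<le> j \<Longrightarrow> j < length s \<Longrightarrow> s ! i < s ! j"
    using assms(3,4) unfolding splits_iff_nth by blast+
  have "s ! i < s ! j" if ij: "i < c" "c \<le> j" "j < length s" for i j
  proof -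
    consider "i < c1" | "c2 \<le> j" | "c1 \<le> i" "j < c2" by linarith
    then show ?thesis
    proof cases
      case 1
      then show ?thesis using s1[of i j] ij assms(5) by simp
    next
      case 2
      then show ?thesis using s2[of i j] ij assms(6) by simp
    next
      case 3
      show ?thesis
      proof (rule ccontr)
        assume "\<not> s ! i < s ! j"
        moreover have "s ! i \<noteq> s ! j" using assms(1) ij by (simp add: nth_eq_iff_index_eq)
        ultimately have "s ! j < s ! i" by simp
        moreover have "s ! 0 < s ! j" "s ! i < s ! c2" "0 < i" "i < j" "j < c2"
          using s1[of 0 j] s2[of i c2] c2 ij 3 by simp_all
        ultimately have "\<not> avoids s [1,3,2,4]" unfolding contains_1324_iff using c2(2) by blast
        then show False using assms(2) by blast
      qed
    qed
  qed
  then show ?thesis unfolding splits_iff_nth using assms(5,6) c2 by simp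
qed

lemma perms_1: "\<beta> \<in> perms 1 \<Longrightarrow> \<beta> = [1]"
  using order_iso_perms_eq[of \<beta> 1 "[1]"] length_perms[of \<beta> 1]
  by (auto simp: order_iso_def perms_iff)

text \<open>The last two cuts are adjacent by \<open>splits_between\<close>, so the last component
  but one is a single entry.\<close>

lemma two_splitsE:
  assumes "\<rho> \<in> perms n" "avoids \<rho> [1,3,2,4]" "2 \<le> card (splits \<rho>)"
  obtains \<alpha> \<tau> c t where "\<alpha> \<in> perms c" "0 < c" "\<tau> \<in> perms t" "0 < t" "splits \<tau> = {}"
    "\<rho> = dsum \<alpha> (dsum [1] \<tau>)" "n = c + 1 + t"
proof -
  have d: "distinct \<rho>" using assms(1) by (simp add: perms_iff)
  have ne: "splits \<rho> \<noteq> {}" using assms(3) by auto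
  define m where "m = Max (splits \<rho>)"
  have m: "m \<in> splits \<rho>" "\<And>j. j \<in> splits \<rho> \<Longrightarrow> j \<le> m"
    using finite_splits ne by (simp_all add: m_def)
  have "\<exists>j\<in>splits \<rho>. j \<noteq> m"
  proof (rule ccontr)
    assume "\<not> ?thesis"
    then have "splits \<rho> \<subseteq> {m}" by blast
    then have "card (splits \<rho>) \<le> card {m}" by (intro card_mono) simp_all
    then show False using assms(3) by simp
  qed
  then obtain j where j: "j \<in> splits \<rho>" "j < m" using m(2) by fastforce
  define c where "c = m - 1"
  have mc: "m = Suc c" using j by (simp add: c_def)
  have "c \<in> splits \<rho>"
  proof (cases "j = c")
    case False
    then show ?thesis using splits_between[OF d assms(2) j(1) m(1)] j mc by simp
  qed (use j in simp)
  then obtain \<alpha> \<beta> where ab: "\<alpha> \<in> perms c" "\<beta> \<in> perms (n - c)" "\<rho> = dsum \<alpha> \<beta>" "0 < c" "0 < n - c"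
    using perm_splitE[OF assms(1)] by blast
  have sp: "splits \<rho> = splits \<alpha> \<union> {c} \<union> (\<lambda>j. j + c) ` splits \<beta>"
    using splits_dsum[OF ab(1,2,4,5)] ab(3) by simp
  have "m \<notin> splits \<alpha>" using mc length_perms[OF ab(1)] by (simp add: splits_def)
  then obtain j' where "j' \<in> splits \<beta>" "m = j' + c" using m(1) mc unfolding sp by auto
  then have "1 \<in> splits \<beta>" using mc by simp
  then obtain \<beta>1 \<tau> where t: "\<beta>1 \<in> perms 1" "\<tau> \<in> perms (n - c - 1)" "\<beta> = dsum \<beta>1 \<tau>" "0 < n - c - 1"
    using perm_splitE[OF ab(2)] by metis
  have sp2: "splits \<beta> = splits \<beta>1 \<union> {1} \<union> (\<lambda>j. j + 1) ` splits \<tau>"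
    using splits_dsum[OF t(1,2) _ t(4)] t(3) by simp
  have "splits \<tau> = {}"
  proof (rule equals0I)
    fix j assume "j \<in> splits \<tau>"
    then have "j + 1 + c \<in> splits \<rho>" "0 < j" unfolding sp sp2 by (auto simp: splits_def)
    then show False using m(2)[of "j + 1 + c"] mc by simp
  qed
  then show ?thesis using that[OF ab(1,4) t(2,4)] ab t perms_1[OF t(1)] by simp
qed

text \<open>The place of the 2 of an occurrence decides. If it is in \<alpha>, the preceding 1 and 3
  form a 132 with it there; if it is in \<tau>, the larger 3 and the later 4 lie in \<tau> as well
  and form a 213 with it.\<close>

lemma avoids_dsum_1324I:
  assumes "\<alpha> \<in> perms c" "\<tau> \<in> perms t" "avoids \<alpha> [1,3,2]" "avoids \<tau> [2,1,3]"
  shows "avoids (dsum \<alpha> \<tau>) [1,3,2,4]"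
proof (rule ccontr)
  have l: "length \<alpha> = c" "length \<tau> = t" using assms length_perms by auto
  assume "\<not> avoids (dsum \<alpha> \<tau>) [1,3,2,4]"
  then obtain i j k m where ijk: "i < j" "j < k" "k < m" "m < c + t"
    "dsum \<alpha> \<tau> ! i < dsum \<alpha> \<tau> ! k" "dsum \<alpha> \<tau> ! k < dsum \<alpha> \<tau> ! j" "dsum \<alpha> \<tau> ! j < dsum \<alpha> \<tau> ! m"
    unfolding contains_1324_iff length_dsum l by blast
  have lo: "dsum \<alpha> \<tau> ! x = \<alpha> ! x" "\<alpha> ! x \<le> c" if "x < c" for x
    using that l perms_nth[OF assms(1)] by (simp_all add: nth_dsum_left)
  have hi: "dsum \<alpha> \<tau> ! x = \<tau> ! (x - c) + c" "1 \<le> \<tau> ! (x - c)" if "c \<le> x" "x < c + t" for x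
    using nth_dsum_right[of "x - c" \<tau> \<alpha>] perms_nth[OF assms(2), of "x - c"] that l by simp_all
  show False
  proof (cases "k < c")
    case True
    then have "\<alpha> ! i < \<alpha> ! k" "\<alpha> ! k < \<alpha> ! j" using ijk lo by simp_all
    then have "\<not> avoids \<alpha> [1,3,2]" unfolding contains_132_iff l using True ijk by blast
    then show False using assms(3) by blast
  next
    case False
    then have "c < dsum \<alpha> \<tau> ! k" using hi[of k] ijk by simp
    then have "\<not> j < c" using lo[of j] ijk by linarith
    then have "\<tau> ! (k - c) < \<tau> ! (j - c)" "\<tau> ! (j - c) < \<tau> ! (m - c)"
      using ijk hi[of j] hi[of k] hi[of m] False by simp_all
    moreover have "j - c < k - c" "k - c < m - c" "m - c < length \<tau>"
      using ijk(1-4) \<open>\<not> j < c\<close> l by linarith+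
    ultimately have "\<not> avoids \<tau> [2,1,3]" unfolding contains_213_iff by blast
    then show False using assms(4) by blast
  qed
qed

lemma not_avoids_self: "\<not> avoids p p"
  unfolding avoids_def by (metis order_iso_def subseq_order.order_refl)

text \<open>This settles condition (a): p is the image under f of
  \<open>dsum \<alpha> \<tau>\<close>, which is too short to contain p.\<close>

lemma two_splits_f_incompatible:
  assumes "p \<in> perms n" "avoids p [1,3,2,4]" "2 \<le> card (splits p)"
  shows "f_incompatible p"
proof -
  obtain \<alpha> \<tau> c t where *: "\<alpha> \<in> perms c" "0 < c" "\<tau> \<in> perms t" "0 < t" "splits \<tau> = {}"
    "p = dsum \<alpha> (dsum [1] \<tau>)" "n = c + 1 + t" using two_splitsE[OF assms] .
  have p1: "[1] \<in> perms 1" by (simp add: perms_iff)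
  have "avoids \<alpha> [1,3,2]"
    using dsum_avoids_1324D(1)[OF *(1,2) dsum_perms[OF p1 *(3)]] assms(2) *(6) by simp
  moreover have "avoids \<tau> [2,1,3]"
    using dsum_avoids_1324D(2)[OF dsum_perms[OF *(1) p1] _ *(3,4)] assms(2) *(6) by (simp add: dsum_assoc)
  ultimately have av: "avoids (dsum \<alpha> \<tau>) [1,3,2,4]" by (rule avoids_dsum_1324I[OF *(1,3)])
  have pp: "dsum \<alpha> \<tau> \<in> perms (c + t)" by (rule dsum_perms[OF *(1,3)])
  have dec: "decomposable (dsum \<alpha> \<tau>)"
    using decomposable_iff[OF pp] splits_dsum[OF *(1,3,2,4)] by simp
  have "f_map (dsum \<alpha> \<tau>) = p"
    unfolding f_map_def using dec f_tilde_dsum[OF *(1-5) av] *(6) by simp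
  moreover have "avoids (dsum \<alpha> \<tau>) p" by (rule avoids_longer) (simp add: *(6))
  ultimately show ?thesis
    using f_incompatibleI[OF pp _ av] dec not_avoids_self by simp
qed

context witness
begin

lemma F_eq: "F = a # \<alpha> @ Suc c # map (\<lambda>y. if y + c + 1 < a then y + c + 1 else y + c + 2) \<tau>"
proof -
  have "length \<alpha> = c" "set \<alpha> = {1..c}" using alpha length_perms perms_iff by auto
  then show ?thesis using a_ge
    by (auto simp: F_def ins_def dsum_def intro!: map_idI)
qed

end

lemma tl_order_iso_del:
  assumes "q \<in> perms n" "0 < n" shows "order_iso (del q (hd q)) (tl q)"
proof -
  have "distinct q" "q \<noteq> []" using assms length_perms[OF assms(1)] by (auto simp: perms_iff)
  then show ?thesis unfolding del_def using removeAll_hd order_iso_standardize by metis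
qed

text \<open>The witness is \<open>q\<close> with the values \<open>q\<^sub>1\<close> and \<open>q\<^sub>1 + 1\<close> exchanged.\<close>

lemma early_splits_witness:
  assumes "q \<in> perms n" "avoids q [1,3,2,4]" "early_splits q"
  obtains \<alpha> \<tau> c t where "witness \<alpha> \<tau> c t (Suc (hd q))" "n = Suc (c + t)"
    "q = ins (hd q) (dsum \<alpha> \<tau>)" "c < hd q"
proof -
  have es: "hd q < n" "splits (tl q) \<noteq> {}" "\<And>c. c \<in> splits (tl q) \<Longrightarrow> c < hd q"
    using assms(3) length_perms[OF assms(1)] by (auto simp: early_splits_def)
  have n0: "0 < n" using es(1) by simp
  define \<rho> where "\<rho> = del q (hd q)"
  have oi: "order_iso \<rho> (tl q)" unfolding \<rho>_def by (rule tl_order_iso_del[OF assms(1) n0])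
  have rp: "\<rho> \<in> perms (n - 1)"
    unfolding \<rho>_def by (rule del_perms[OF assms(1) perms_hd_last(1)[OF assms(1) n0]])
  have sp: "splits \<rho> = splits (tl q)" by (rule splits_order_iso[OF oi])
  have "subseq (tl q) q" by (cases q) auto
  then have av: "avoids \<rho> [1,3,2,4]" using avoids_order_iso[OF oi] avoids_subseq[OF assms(2)] by blast
  define c where "c = Max (splits \<rho>)"
  have c: "c \<in> splits \<rho>" "\<And>j. j \<in> splits \<rho> \<Longrightarrow> j \<le> c"
    using finite_splits es(2) sp by (simp_all add: c_def)
  obtain \<alpha> \<tau> where ab: "\<alpha> \<in> perms c" "\<tau> \<in> perms (n - 1 - c)" "\<rho> = dsum \<alpha> \<tau>" "0 < c" "0 < n - 1 - c"
    using perm_splitE[OF rp c(1)] .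
  have "splits \<tau> = {}"
  proof (rule equals0I)
    fix j assume "j \<in> splits \<tau>"
    then have "j + c \<in> splits \<rho>" "0 < j" using splits_dsum[OF ab(1,2,4,5)] ab(3) by (auto simp: splits_def)
    then show False using c(2)[of "j + c"] by simp
  qed
  \<comment> \<open>For the last cut c this is the bound \<open>a_ge\<close> of the locale, with a =
    \<open>Suc (hd q)\<close>.\<close>
  moreover have "c < hd q" using c(1) sp es(3) by blast
  ultimately have "witness \<alpha> \<tau> c (n - 1 - c) (Suc (hd q))"
    using ab av es(1) by (unfold_locales) simp_all
  moreover have "q = ins (hd q) (dsum \<alpha> \<tau>)"
    using ins_del[OF assms(1) n0] ab(3) by (simp add: \<rho>_def)
  ultimately show ?thesis using that \<open>c < hd q\<close> ab(5) by simp
qed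

lemma (in witness) early_splits_pattern:
  assumes "a = Suc b" "c < b" "q = ins b (dsum \<alpha> \<tau>)"
  shows "avoids \<pi> q" "\<not> avoids F q" "q \<in> perms N"
proof -
  have ls: "length \<alpha> = c" "set \<alpha> = {1..c}" "set \<tau> = {1..t}" using alpha tau length_perms perms_iff by auto
  show qp: "q \<in> perms N" unfolding assms(3)
    by (rule ins_perms[OF dsum_perms[OF alpha tau]]) (use assms(1,2) a_le in auto)
  have "hd \<pi> \<noteq> hd q" using hd_pi assms(1,3) by simp
  then have "\<pi> \<noteq> q" by blast
  then show "avoids \<pi> q" by (rule avoids_same_length[OF pi_perms qp])
  \<comment> \<open>Skips c + 1, the value inserted by f; b lies above c and is therefore sent to
    a.\<close>
  define h where "h x = (if x \<le> c then x else Suc x)" for x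
  have "map h q = a # \<alpha> @ map (\<lambda>y. if y + c + 1 < a then y + c + 1 else y + c + 2) \<tau>"
    unfolding assms(3) ins_def dsum_def using ls assms(1,2)
    by (auto simp: h_def intro!: map_idI)
  then have "subseq (map h q) F" unfolding F_eq by (simp add: subseq_append' list_emb_Cons)
  moreover have "strict_mono_on (set q) h" by (simp add: strict_mono_on_def h_def)
  ultimately show "\<not> avoids F q" by (rule not_avoids_map[rotated])
qed

lemma early_splits_f_incompatible:
  assumes "q \<in> perms n" "avoids q [1,3,2,4]" "early_splits q"
  shows "f_incompatible q" "f_incompatible (inv_perm q)"
proof -
  obtain \<alpha> \<tau> c t where *: "witness \<alpha> \<tau> c t (Suc (hd q))" "n = Suc (c + t)"
    "q = ins (hd q) (dsum \<alpha> \<tau>)" "c < hd q" using early_splits_witness[OF assms] .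
  interpret witness \<alpha> \<tau> c t "Suc (hd q)" by (fact *(1))
  note ep = early_splits_pattern[OF refl *(4,3)]
  show "f_incompatible q" "f_incompatible (inv_perm q)"
    using f_incompatible_witness[OF ep(3,1,2)] by blast+
qed

text \<open>If \<open>q\<close> arises from \<open>\<alpha> \<oplus> 1 \<oplus> \<tau>\<close> by prepending the maximum \<open>n\<close>, the witness arises from
  \<open>\<alpha> \<oplus> ((t + 1) \<tau>)\<close> by prepending \<open>n\<close>, where \<open>t\<close> is the length of \<open>\<tau>\<close>.\<close>

lemma max_head_f_incompatible:
  assumes "q \<in> perms n" "avoids q [1,3,2,4]" "max_head q"
  shows "f_incompatible q" "f_incompatible (inv_perm q)"
proof -
  have hd: "hd q = n" and two: "2 \<le> card (splits (tl q))"
    using assms(3) length_perms[OF assms(1)] by (auto simp: max_head_def)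
  have n0: "0 < n" using two length_perms[OF assms(1)] by (cases "n = 0") (auto simp: splits_def)
  define \<rho> where "\<rho> = del q (hd q)"
  have oi: "order_iso \<rho> (tl q)" unfolding \<rho>_def by (rule tl_order_iso_del[OF assms(1) n0])
  have rp: "\<rho> \<in> perms (n - 1)"
    unfolding \<rho>_def by (rule del_perms[OF assms(1) perms_hd_last(1)[OF assms(1) n0]])
  have sp: "splits \<rho> = splits (tl q)" by (rule splits_order_iso[OF oi])
  have "subseq (tl q) q" by (cases q) auto
  then have av: "avoids \<rho> [1,3,2,4]" using avoids_order_iso[OF oi] avoids_subseq[OF assms(2)] by blast
  obtain \<alpha> \<tau> c t where *: "\<alpha> \<in> perms c" "0 < c" "\<tau> \<in> perms t" "0 < t" "splits \<tau> = {}"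
    "\<rho> = dsum \<alpha> (dsum [1] \<tau>)" "n - 1 = c + 1 + t" using two_splitsE[OF rp av two[folded sp]] .
  have n: "n = c + t + 2" using *(7) by simp
  have p1: "[1] \<in> perms 1" by (simp add: perms_iff)
  have ls: "length \<alpha> = c" "set \<alpha> = {1..c}" "length \<tau> = t" "set \<tau> = {1..t}"
    using * length_perms perms_iff by auto
  have q: "q = ins n (dsum \<alpha> (dsum [1] \<tau>))" using ins_del[OF assms(1) n0] *(6) hd by (simp add: \<rho>_def)
  \<comment> \<open>A leading maximum makes the component indecomposable and creates no 213. In F it
    becomes n + 1 and overtakes the first entry n; omitting it leaves q.\<close>
  define \<tau>2 where "\<tau>2 = Suc t # \<tau>"
  have "avoids \<alpha> [1,3,2]"
    using dsum_avoids_1324D(1)[OF *(1,2) dsum_perms[OF p1 *(3)]] av *(6) by simp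
  moreover have av213: "avoids \<tau> [2,1,3]"
    using dsum_avoids_1324D(2)[OF dsum_perms[OF *(1) p1] _ *(3,4)] av *(6) by (simp add: dsum_assoc)
  have t2p: "\<tau>2 \<in> perms (Suc t)"
    using *(3) unfolding perms_iff \<tau>2_def by (auto simp: atLeastAtMostSuc_conv)
  have "avoids \<tau>2 [2,1,3]"
  proof (rule ccontr)
    assume "\<not> avoids \<tau>2 [2,1,3]"
    then obtain i j k where ijk: "i < j" "j < k" "k < Suc t" "\<tau>2 ! j < \<tau>2 ! i" "\<tau>2 ! i < \<tau>2 ! k"
      unfolding contains_213_iff \<tau>2_def using ls by auto
    have "i \<noteq> 0"
    proof
      assume "i = 0"
      then have "Suc t < \<tau>2 ! k" using ijk by (simp add: \<tau>2_def)
      then show False using perms_nth[OF t2p ijk(3)] by simp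
    qed
    then have "\<tau> ! (j - 1) < \<tau> ! (i - 1)" "\<tau> ! (i - 1) < \<tau> ! (k - 1)" "i - 1 < j - 1" "j - 1 < k - 1"
        "k - 1 < length \<tau>"
      using ijk ls by (simp_all add: \<tau>2_def)
    then have "\<not> avoids \<tau> [2,1,3]" unfolding contains_213_iff by blast
    then show False using av213 by blast
  qed
  ultimately have av2: "avoids (dsum \<alpha> \<tau>2) [1,3,2,4]" using avoids_dsum_1324I[OF *(1) t2p] by blast
  have "splits \<tau>2 = {}"
    using splits_Cons_append_empty[OF *(5), of 1 "Suc t" "[]"] ls *(4) by (simp add: \<tau>2_def)
  then interpret witness \<alpha> \<tau>2 c "Suc t" n
    using * t2p av2 n by unfold_locales simp_all
  have NN: "N = n" using n by simp
  have "\<pi> \<noteq> q"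
  proof
    assume "\<pi> = q"
    then have "del \<pi> n = del q n" by simp
    moreover have "del \<pi> n = dsum \<alpha> \<tau>2"
      unfolding \<pi>_def by (rule del_ins[OF dsum_perms[OF *(1) t2p]]) (use n in auto)
    moreover have "del q n = dsum \<alpha> (dsum [1] \<tau>)" using *(6) hd by (simp add: \<rho>_def)
    ultimately have "\<tau>2 ! 0 + c = dsum [1] \<tau> ! 0 + c"
      using nth_dsum_right[of 0 \<tau>2 \<alpha>] nth_dsum_right[of 0 "dsum [1] \<tau>" \<alpha>] by (simp add: \<tau>2_def)
    then show False using *(4) by (simp add: \<tau>2_def dsum_def)
  qed
  then have a: "avoids \<pi> q" using avoids_same_length[of \<pi> n q] pi_perms assms(1) NN by simp
  have "q = n # \<alpha> @ Suc c # map (\<lambda>y. y + c + 1) \<tau>"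
    unfolding q ins_def dsum_def using ls n by (auto intro!: map_idI)
  moreover have "map (\<lambda>y. if y + c + 1 < n then y + c + 1 else y + c + 2) \<tau> = map (\<lambda>y. y + c + 1) \<tau>"
    by (rule map_cong) (use ls n in auto)
  then have "F = n # \<alpha> @ Suc c # Suc n # map (\<lambda>y. y + c + 1) \<tau>"
    unfolding F_eq by (simp add: \<tau>2_def n)
  ultimately have "subseq q F" by (simp add: subseq_append' list_emb_Cons)
  then have "\<not> avoids F q" unfolding avoids_def by (auto simp: order_iso_def)
  then show "f_incompatible q" "f_incompatible (inv_perm q)"
    using f_incompatible_witness[OF assms(1) a] by blast+
qed

subsection \<open>Reverse-complements\<close>

text \<open>The entries before a cut c are 1, ..., c and include the first entry. As that is not 1,
  the block has a further entry and survives the removal of its head.\<close>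

lemma split_tl:
  assumes "q \<in> perms n" "c \<in> splits q" "1 < hd q"
  shows "c - 1 \<in> splits (tl q)" "hd q \<le> c" "1 < c"
proof -
  have c: "0 < c" "c < length q" using assms(2) by (auto simp: splits_def)
  then obtain b T where q: "q = b # T" by (cases q) auto
  obtain c' where c': "c = Suc c'" using c by (cases c) auto
  have "b \<in> set (take c q)" using q c' by simp
  then have b: "b \<le> c" unfolding splits_perm_set(1)[OF assms(1,2)] by simp
  then show "hd q \<le> c" using q by simp
  show "1 < c" using b assms(3) q by simp
  then show "c - 1 \<in> splits (tl q)" using assms(2) q c' by (auto simp: splits_def)
qed

text \<open>An entry y behind the cut exceeds the c entries before it, so y > c. If the first entry
  were larger than y, it would be at least c + 2.\<close>

lemma split_ConsI:
  assumes "q \<in> perms n" "c \<in> splits (tl q)" "hd q \<le> Suc c"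
  shows "Suc c \<in> splits q"
proof -
  have c: "0 < c" "c < length (tl q)" using assms(2) by (auto simp: splits_def)
  then obtain b T where q: "q = b # T" by (cases q) auto
  have T: "distinct T" "b \<notin> set T" "set T \<subseteq> {1..n}" using assms(1) q by (auto simp: perms_iff)
  have lt: "\<And>x y. x \<in> set (take c T) \<Longrightarrow> y \<in> set (drop c T) \<Longrightarrow> x < y"
    using assms(2) q by (auto simp: splits_def)
  have "b < y" if y: "y \<in> set (drop c T)" for y
  proof (rule ccontr)
    assume "\<not> b < y"
    moreover have "y \<noteq> b" using T(2) y in_set_dropD by fastforce
    ultimately have yb: "y < b" by simp
    have "set (take c T) \<subseteq> {1..<y}"
    proof
      fix x assume x: "x \<in> set (take c T)"
      then have "x \<in> {1..n}" using T(3) in_set_takeD[OF x] by blast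
      then show "x \<in> {1..<y}" using lt[OF x y] by simp
    qed
    then have "card (set (take c T)) \<le> y - 1" using card_mono[of "{1..<y}"] by simp
    moreover have "card (set (take c T)) = c" using T(1) c q by (simp add: distinct_card)
    ultimately show False using yb assms(3) q c by simp
  qed
  then show ?thesis using lt c q by (auto simp: splits_def)
qed

lemma ins_Suc:
  "ins (Suc b) \<rho> = map (transpose b (Suc b)) (ins b \<rho>)"
  by (auto simp: ins_def transpose_def)

text \<open>After the exchange the list starts with b + 1, so the smaller entry b, formerly b + 1,
  cannot stand behind the cut. With both values on the left, undoing the exchange does not affect
  the cut.\<close>

lemma splits_map_transpose:
  assumes "distinct (b # s)" "d \<in> splits (map (transpose b (Suc b)) (b # s))"
  shows "d \<in> splits (b # s)" "Suc b \<notin> set (drop d (b # s))"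
proof -
  define tr where "tr = transpose b (Suc b)"
  have tr: "tr b = Suc b" "tr (Suc b) = b" "\<And>x. x \<noteq> b \<Longrightarrow> x \<noteq> Suc b \<Longrightarrow> tr x = x"
    by (simp_all add: tr_def transpose_def)
  define u where "u = b # s"
  have "d \<in> splits (map tr u)" using assms(2) unfolding tr_def u_def .
  then have "0 < d" "d < length u"
    and "\<And>x y. x \<in> set (take d u) \<Longrightarrow> y \<in> set (drop d u) \<Longrightarrow> tr x < tr y"
    unfolding splits_def take_map drop_map by simp_all
  then have d: "0 < d" "d < length (b # s)"
    and lt: "\<And>x y. x \<in> set (take d (b # s)) \<Longrightarrow> y \<in> set (drop d (b # s)) \<Longrightarrow> tr x < tr y"
    unfolding u_def by blast+
  have b: "b \<in> set (take d (b # s))" using d by (cases d) simp_all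
  then have bn: "b \<notin> set (drop d (b # s))"
    using assms(1) by (metis append_take_drop_id disjoint_iff distinct_append)
  show sb: "Suc b \<notin> set (drop d (b # s))" using lt[OF b] tr by fastforce
  have "x < y" if x: "x \<in> set (take d (b # s))" and y: "y \<in> set (drop d (b # s))" for x y
  proof -
    have ty: "tr y = y" using tr(3) y bn sb by metis
    have yb: "y \<noteq> b" "y \<noteq> Suc b" using y bn sb by metis+
    consider "x = b" | "x = Suc b" | "x \<noteq> b" "x \<noteq> Suc b" by blast
    then show ?thesis using lt[OF x y] tr ty yb by cases simp_all
  qed
  then show "d \<in> splits (b # s)" using d by (simp add: splits_def)
qed

text \<open>In \<open>rc q\<close> the first entry is n + 1 - \<open>last q\<close>, and a cut c of
  \<open>butlast q\<close>, a list of length n - 1, becomes n - 1 - c. So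
  \<open>last q < c + 2\<close> is the inequality demanded by \<open>early_splits\<close>, and
  \<open>1 < last q\<close> says that \<open>rc q\<close> does not start with its maximum.\<close>

lemma early_splits_rcI:
  assumes "q \<in> perms n" "0 < n" "1 < last q" "splits (butlast q) \<noteq> {}"
    "\<And>c. c \<in> splits (butlast q) \<Longrightarrow> last q < c + 2"
  shows "early_splits (rc q)"
proof -
  have d: "distinct q" "q \<noteq> []" using assms(1,2) by (auto simp: perms_iff)
  have d': "distinct (rc q)" "rc q \<noteq> []" using rc_perms[OF assms(1)] assms(2) by (auto simp: perms_iff)
  have s: "splits (tl (rc q)) = (\<lambda>c. n - 1 - c) ` splits (butlast q)"
    using splits_removeAll_hd_rc[OF assms(1,2)] by (simp add: removeAll_hd[OF d'] removeAll_last[OF d])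
  have "n - 1 - c < n + 1 - last q" if c: "c \<in> splits (butlast q)" for c
  proof -
    have "c < n - 1" using c length_perms[OF assms(1)] by (simp add: splits_def)
    then show ?thesis using assms(5)[OF c] by linarith
  qed
  then show ?thesis
    unfolding early_splits_def s hd_rc[OF assms(1,2)] using assms(2-4) length_perms[OF assms(1)] by auto
qed

text \<open>The counterpart for the maximum, whose zero-based position is k: the inverse of
  \<open>rc q\<close> starts with n - k, and cuts again become n - 1 - c.\<close>

lemma early_splits_inv_rcI:
  assumes "q \<in> perms n" "q ! k = n" "0 < k" "k < n" "splits (removeAll n q) \<noteq> {}"
    "\<And>c. c \<in> splits (removeAll n q) \<Longrightarrow> k \<le> c"
  shows "early_splits (inv_perm (rc q))"
proof -
  define r where "r = inv_perm (rc q)"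
  note rp = rc_perms[OF assms(1)]
  have ip: "r \<in> perms n" unfolding r_def by (rule inv_perm_perms[OF rp])
  have n0: "0 < n" using assms(4) by simp
  have d': "distinct r" "r \<noteq> []" using ip n0 by (auto simp: perms_iff)
  have "splits (tl r) = splits (removeAll (hd r) r)" by (simp add: removeAll_hd[OF d'])
  also have "\<dots> = splits (removeAll 1 (rc q))"
    unfolding r_def by (rule splits_removeAll_hd_inv_perm[OF rp n0])
  also have "\<dots> = (\<lambda>c. n - 1 - c) ` splits (removeAll n q)" by (rule splits_removeAll_1_rc[OF assms(1) n0])
  finally have s: "splits (tl r) = (\<lambda>c. n - 1 - c) ` splits (removeAll n q)" .
  have kn: "n - 1 - k < n" "n - 1 - (n - 1 - k) = k" using assms(4) by simp_all
  then have "rc q ! (n - 1 - k) = 1"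
    using rc_nth[of "n - 1 - k" q] assms(2) length_perms[OF assms(1)] by simp
  then have "r ! 0 = Suc (n - 1 - k)" unfolding r_def using inv_perm_nth[OF rp kn(1)] by simp
  then have hd: "hd r = n - k" using hd_nth_perm[OF ip n0] assms(4) by simp
  have "n - 1 - c < n - k" if "c \<in> splits (removeAll n q)" for c
    using assms(6)[OF that] assms(4) by linarith
  then have "early_splits r"
    unfolding early_splits_def s hd using assms(3-5) length_perms[OF ip] by auto
  then show ?thesis by (simp add: r_def)
qed

text \<open>If an entry x before the cut exceeded the last entry, all values up to x except the last
  entry would stand before the cut, so x would be at most c + 1 and the last entry at most c. Hence
  the last entry can be put back. The common prefix has length c + 1 because the entry just behind
  the cut matters later.\<close>

lemma split_butlast:
  assumes "q \<in> perms n" "c \<in> splits (butlast q)" "c + 2 \<le> last q"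
  shows "take (Suc c) (butlast q) = take (Suc c) q" "c \<in> splits q"
proof -
  have l: "length q = n" "distinct q" "set q = {1..n}" using assms(1) length_perms perms_iff by auto
  have c: "0 < c" "Suc c < n" using assms(2) l by (auto simp: splits_def)
  then have ne: "q \<noteq> []" using l by auto
  show t: "take (Suc c) (butlast q) = take (Suc c) q" using c l by (simp add: butlast_conv_take)
  have tc: "take c (butlast q) = take c q" using c l by (simp add: butlast_conv_take)
  have q: "q = butlast q @ [last q]" using ne by simp
  have lb: "last q \<notin> set (butlast q)" using l(2) q by (metis distinct_append disjoint_iff list.set_intros(1))
  have lt: "\<And>x y. x \<in> set (take c q) \<Longrightarrow> y \<in> set (drop c (butlast q)) \<Longrightarrow> x < y"
    using assms(2) tc by (auto simp: splits_def)
  have un: "set (take c q) \<union> set (drop c (butlast q)) = {1..n} - {last q}"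
  proof -
    have "set (take c q) \<union> set (drop c (butlast q)) = set (butlast q)"
      by (metis tc append_take_drop_id set_append)
    moreover have "set q = insert (last q) (set (butlast q))" by (subst q) simp
    ultimately show ?thesis using lb l(3) by auto
  qed
  have bd: "x < last q" if x: "x \<in> set (take c q)" for x
  proof (rule ccontr)
    assume "\<not> x < last q"
    moreover have "x \<in> {1..n} - {last q}" using un x by blast
    then have "x \<noteq> last q" "x \<le> n" by simp_all
    ultimately have xl: "last q < x" by simp
    have "{1..x} - {last q} \<subseteq> set (take c q)"
    proof
      fix y assume y: "y \<in> {1..x} - {last q}"
      then have "y \<in> set (take c q) \<union> set (drop c (butlast q))" unfolding un using \<open>x \<le> n\<close> by simp
      moreover have "y \<notin> set (drop c (butlast q))"
      proof
        assume "y \<in> set (drop c (butlast q))"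
        from lt[OF x this] y show False by simp
      qed
      ultimately show "y \<in> set (take c q)" by blast
    qed
    then have "card ({1..x} - {last q}) \<le> card (set (take c q))" by (intro card_mono) simp_all
    also have "card (set (take c q)) = c" using l c by (simp add: distinct_card)
    finally have "x - 1 \<le> c" using xl assms(3) by simp
    then show False using xl assms(3) by simp
  qed
  have "drop c q = drop c (butlast q) @ [last q]"
    by (subst q) (use c l in simp)
  then have "x < y" if "x \<in> set (take c q)" "y \<in> set (drop c q)" for x y
    using that lt bd by auto
  then show "c \<in> splits q" using c l by (simp add: splits_def)
qed

text \<open>The maximum stands behind the cut, where putting it back is harmless.\<close>

lemma split_removeAll_max:
  assumes "q \<in> perms n" "q ! k = n" "k < n" "c \<in> splits (removeAll n q)" "c < k"
  shows "take (Suc c) (removeAll n q) = take (Suc c) q" "c \<in> splits q"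
proof -
  have l: "length q = n" "distinct q" "set q = {1..n}" using assms(1) length_perms perms_iff by auto
  have q: "q = take k q @ n # drop (Suc k) q" using assms(2,3) l by (metis id_take_nth_drop)
  have "n \<notin> set (take k q)" "n \<notin> set (drop (Suc k) q)"
    using l(2) by (subst (asm) q, simp)+
  then have r: "removeAll n q = take k q @ drop (Suc k) q"
    by (subst q) (simp add: removeAll_id)
  show "take (Suc c) (removeAll n q) = take (Suc c) q"
    unfolding r using assms(3,5) l by (simp add: take_append min_def)
  have tc: "take c (removeAll n q) = take c q"
    unfolding r using assms(3,5) l by (simp add: take_append min_def)
  have lt: "\<And>x y. x \<in> set (take c q) \<Longrightarrow> y \<in> set (drop c (removeAll n q)) \<Longrightarrow> x < y"
    using assms(4) tc by (auto simp: splits_def)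
  have "set (drop c q) \<subseteq> insert n (set (drop c (removeAll n q)))"
  proof -
    have "drop c q = drop c (take k q) @ n # drop (Suc k) q"
      by (subst q) (use assms(3,5) l in simp)
    moreover have "drop c (removeAll n q) = drop c (take k q) @ drop (Suc k) q"
      unfolding r using assms(3,5) l by simp
    ultimately show ?thesis by auto
  qed
  moreover have "x < n" if "x \<in> set (take c q)" for x
  proof -
    have "x \<in> set (removeAll n q)" using that tc by (metis in_set_takeD)
    then have "x \<in> {1..n}" "x \<noteq> n" using l(3) by auto
    then show ?thesis by simp
  qed
  ultimately have "x < y" if "x \<in> set (take c q)" "y \<in> set (drop c q)" for x y
    using that lt by blast
  then show "c \<in> splits q" using assms(3-5) l by (simp add: splits_def)
qed

text \<open>Suppose c cuts both q and \<open>removeAll e q\<close>, and let b = \<open>hd q\<close>.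
  The condition on cuts of \<open>tl q\<close> forces c = b, so q begins with the values 1, ..., b
  in some order. If the next entry is b + 1, then c + 1 cuts q and c cuts \<open>tl q\<close>,
  against \<open>early_splits\<close>. Otherwise it is larger; since b + 1 must stand before the cut
  d, the entries b, this one, b + 1 and the one just behind d form a 1324.\<close>

lemma early_splits_no_common_split:
  assumes "q \<in> perms n" "avoids q [1,3,2,4]" "early_splits q"
    and "e \<in> set q" "e \<noteq> hd q" "e \<noteq> Suc (hd q)"
    and "d \<in> splits (map (transpose (hd q) (Suc (hd q))) (removeAll e q))"
    and "c \<in> splits (removeAll e q)" "c \<in> splits q"
    and "take (Suc c) (removeAll e q) = take (Suc c) q"
  shows False
proof -
  define b s where "b = hd q" and "s = removeAll e q"
  have l: "length q = n" "distinct q" "set q = {1..n}" using assms(1) length_perms perms_iff by auto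
  have es: "b < n" "splits (tl q) \<noteq> {}" "\<And>c. c \<in> splits (tl q) \<Longrightarrow> c < b"
    using assms(3) l by (auto simp: early_splits_def b_def)
  have b1: "1 < b"
  proof -
    obtain j where "j \<in> splits (tl q)" using es(2) by blast
    then have "0 < j" "j < b" using es(3) by (auto simp: splits_def)
    then show ?thesis by simp
  qed
  obtain T where q: "q = b # T" using es(1) l b_def by (cases q) auto
  have s: "s = b # removeAll e T" using assms(5) by (simp add: s_def q)
  have ds: "distinct s" using l(2) by (simp add: s_def distinct_removeAll)
  have ls: "length s = n - 1"
    using l assms(4) by (simp add: s_def length_remove1 flip: distinct_remove1_removeAll)
  have d: "d \<in> splits s" "Suc b \<notin> set (drop d s)"
    using splits_map_transpose[of b "removeAll e T" d] assms(7) ds unfolding s_def[symmetric] b_def[symmetric]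
    by (simp_all add: s)
  have cq: "c \<in> splits q" "c \<in> splits s" using assms(8,9) by (simp_all add: s_def)
  have ct: "c - 1 < b" "b \<le> c" using split_tl[OF assms(1) cq(1)] es(3) b1 by (auto simp: b_def)
  then have cb: "c = b" by simp
  have cl: "c < length s" using cq(2) by (simp add: splits_def)
  have tk: "take (Suc c) s = take (Suc c) q" using assms(10) by (simp add: s_def)
  have sc: "s ! c = q ! c" using tk by (metis lessI nth_take)
  have tc: "take c s = take c q" using tk by (metis le_Suc_eq min_def order_refl take_take)
  have set_tc: "set (take c q) = {1..c}" by (rule splits_perm_set(1)[OF assms(1) cq(1)])
  have "q ! c \<in> set (drop c q)" using cl ls l by (metis Cons_nth_drop_Suc list.set_intros(1) less_imp_diff_less less_le_trans nat_less_le diff_le_self)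
  then have gt: "c < q ! c" unfolding splits_perm_set(2)[OF assms(1) cq(1)] by simp
  show False
  proof (cases "q ! c = Suc b")
    case True
    have "set (take (Suc c) q) = insert (q ! c) (set (take c q))"
      using cl ls l by (simp add: take_Suc_conv_app_nth)
    also have "\<dots> = insert (Suc c) {1..c}" using set_tc True cb by simp
    also have "\<dots> = {1..Suc c}" by (simp add: atLeastAtMostSuc_conv)
    finally have "Suc c \<in> splits q" by (rule splits_permI[OF assms(1)]) (use cl ls in simp_all)
    then have "c \<in> splits (tl q)" using split_tl(1)[OF assms(1)] b1 by (fastforce simp: b_def)
    then show False using es(3) cb by blast
  next
    case False
    have "Suc b \<in> set s" using es(1) l(3) assms(6) by (simp add: s_def b_def)
    then have "Suc b \<in> set (take d s)" using d(2) by (metis UnE append_take_drop_id set_append)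
    then obtain i where i: "i < d" "s ! i = Suc b" by (auto simp: in_set_conv_nth)
    have dl: "d < length s" using d(1) by (simp add: splits_def)
    have "\<not> i < c"
    proof
      assume "i < c"
      then have "s ! i \<in> set (take c s)" using cl by (metis in_set_conv_nth length_take min_less_iff_conj nth_take order.strict_trans)
      then show False unfolding tc set_tc using i cb by simp
    qed
    moreover have "i \<noteq> c" using False sc i by auto
    ultimately have ci: "c < i" by simp
    have "s ! c < s ! d" using d(1) ci i(1) dl unfolding splits_iff_nth by simp
    moreover have "s ! i < s ! c" using gt False i(2) cb sc by simp
    moreover have "s ! 0 < s ! i" using i(2) by (simp add: s)
    moreover have "0 < c" using cb b1 by simp
    ultimately have "\<not> avoids s [1,3,2,4]" unfolding contains_1324_iff using ci i(1) dl by blast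
    moreover have "avoids s [1,3,2,4]"
      unfolding s_def removeAll_filter_not_eq by (rule avoids_subseq[OF assms(2) subseq_filter_left])
    ultimately show False by blast
  qed
qed

text \<open>When the witness for \<open>q\<close> loses its indecomposability by deletion of its last entry or of its maximum, its
  reverse-complement may be treated differently by \<open>f\<close>. But then \<open>q\<^sup>r\<^sup>c\<close> or its inverse has early splits
  itself.\<close>

lemma early_splits_overlap_last:
  assumes "q \<in> perms n" "avoids q [1,3,2,4]" "early_splits q"
    and "splits (butlast (map (transpose (hd q) (Suc (hd q))) q)) \<noteq> {}"
  shows "early_splits (rc q)"
proof -
  define b where "b = hd q"
  have l: "length q = n" "distinct q" "set q = {1..n}" using assms(1) length_perms perms_iff by auto
  have es: "b < n" "splits (tl q) \<noteq> {}"
    using assms(3) l by (auto simp: early_splits_def b_def)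
  obtain j where j: "j \<in> splits (tl q)" using es(2) by blast
  then have j': "0 < j" "j < length (tl q)"
    "\<And>x y. x \<in> set (take j (tl q)) \<Longrightarrow> y \<in> set (drop j (tl q)) \<Longrightarrow> x < y" by (auto simp: splits_def)
  have ne: "q \<noteq> []" "tl q \<noteq> []" using j'(2) by (cases q; fastforce)+
  obtain d where "d \<in> splits (butlast (map (transpose b (Suc b)) q))" using assms(4) b_def by blast
  then have d: "d \<in> splits (map (transpose b (Suc b)) (removeAll (last q) q))"
    by (simp add: removeAll_last[OF l(2) ne(1)] map_butlast)
  have lh: "last q \<noteq> hd q" using ne l(2) by (cases q) (auto split: if_splits)
  \<comment> \<open>The last entry stands behind a cut of \<open>tl q\<close>, so it cannot be
    1.\<close>
  have "last q = last (tl q)" using ne by (simp add: last_tl)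
  then have "last q = last (drop j (tl q))" "drop j (tl q) \<noteq> []" using j' by simp_all
  then have "last q \<in> set (drop j (tl q))" by (metis last_in_set)
  moreover have h1: "hd (tl q) \<in> set (take j (tl q))" using j' ne(2) by (cases "tl q"; cases j) simp_all
  ultimately have "hd (tl q) < last q" using j'(3) by blast
  moreover have "hd (tl q) \<in> {1..n}" using l(3) ne by (metis hd_in_set list.set_sel(2))
  ultimately have l1: "1 < last q" by simp
  obtain T where q: "q = b # T" using ne b_def by (cases q) auto
  have "removeAll (last q) (b # T) = b # removeAll (last q) T" using lh by (simp add: b_def)
  then have "removeAll (last q) q = b # removeAll (last q) T" unfolding q[symmetric] .
  moreover have "distinct (removeAll (last q) q)" using l(2) by (rule distinct_removeAll)
  ultimately have dq: "d \<in> splits (removeAll (last q) q)"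
    using splits_map_transpose(1)[of b "removeAll (last q) T" d] d by simp
  \<comment> \<open>A cut violating the bound would by \<open>split_butlast\<close> also cut q,
    which \<open>early_splits_no_common_split\<close> excludes.\<close>
  have ab: "last q < c + 2" if c: "c \<in> splits (butlast q)" for c
  proof (rule ccontr)
    assume "\<not> ?thesis"
    then have lc: "c + 2 \<le> last q" by simp
    note sb = split_butlast[OF assms(1) c lc]
    have "b \<le> c" using split_tl(2)[OF assms(1) sb(2)] j es assms(3) j'(1) unfolding early_splits_def b_def
      by fastforce
    then have "last q \<noteq> Suc b" using lc by simp
    then show False
      using early_splits_no_common_split[OF assms(1-3) _ lh _ d[unfolded b_def] _ sb(2)] sb(1) c ne(1)
      by (simp add: removeAll_last[OF l(2) ne(1)] b_def)
  qed
  show ?thesis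
    by (rule early_splits_rcI[OF assms(1) _ l1 _ ab])
      (use es dq in \<open>auto simp: removeAll_last[OF l(2) ne(1)]\<close>)
qed

lemma early_splits_overlap_max:
  assumes "q \<in> perms n" "avoids q [1,3,2,4]" "early_splits q" "Suc (hd q) < n"
    and "splits (removeAll n (map (transpose (hd q) (Suc (hd q))) q)) \<noteq> {}"
  shows "early_splits (inv_perm (rc q))"
proof -
  define b where "b = hd q"
  have l: "length q = n" "distinct q" "set q = {1..n}" using assms(1) length_perms perms_iff by auto
  have bn: "Suc b < n" using assms(4) by (simp add: b_def)
  obtain T where q: "q = b # T" using bn l b_def by (cases q) auto
  have "removeAll n (map (transpose b (Suc b)) q) = map (transpose b (Suc b)) (removeAll n q)"
    using bn by (auto simp: removeAll_filter_not_eq filter_map comp_def transpose_def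
      intro!: arg_cong[of _ _ "map _"] filter_cong)
  then obtain d where d: "d \<in> splits (map (transpose b (Suc b)) (removeAll n q))"
    using assms(5) b_def by auto
  have "removeAll n q = b # removeAll n T" using bn by (simp add: q)
  moreover have "distinct (removeAll n q)" using l(2) by (rule distinct_removeAll)
  ultimately have dq: "d \<in> splits (removeAll n q)"
    using splits_map_transpose(1)[of b "removeAll n T" d] d by simp
  obtain k where k: "k < n" "q ! k = n" using perms_surj[OF assms(1), of n] bn by auto
  have "k \<noteq> 0" using k bn q by (cases k) auto
  moreover have "k \<le> c" if c: "c \<in> splits (removeAll n q)" for c
  proof (rule ccontr)
    assume "\<not> k \<le> c"
    then have "c < k" by simp
    note sm = split_removeAll_max[OF assms(1) k(2,1) c this]
    show False
      using early_splits_no_common_split[OF assms(1-3) _ _ _ d[unfolded b_def] c sm(2,1)] bn l(3)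
      by (simp add: b_def)
  qed
  ultimately show ?thesis using early_splits_inv_rcI[OF assms(1) k(2) _ k(1)] dq by blast
qed

lemma early_splits_f_incompatible_rc:
  assumes "q \<in> perms n" "avoids q [1,3,2,4]" "early_splits q" "Suc (hd q) < n"
  shows "f_incompatible (rc q)" "f_incompatible (inv_perm (rc q))"
proof -
  note rp = rc_perms[OF assms(1)]
  have avr: "avoids (rc q) [1,3,2,4]" using avoids_rc[OF assms(1) perm_1324] rc_1324 assms(2) by simp
  have avir: "avoids (inv_perm (rc q)) [1,3,2,4]"
    using avoids_inv_perm[OF rp perm_1324] inv_perm_1324 avr by simp
  obtain \<alpha> \<tau> c t where *: "witness \<alpha> \<tau> c t (Suc (hd q))" "n = Suc (c + t)"
    "q = ins (hd q) (dsum \<alpha> \<tau>)" "c < hd q" using early_splits_witness[OF assms(1-3)] .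
  interpret witness \<alpha> \<tau> c t "Suc (hd q)" by (fact *(1))
  note ep = early_splits_pattern[OF refl *(4,3)]
  have pi: "\<pi> = map (transpose (hd q) (Suc (hd q))) q"
    unfolding \<pi>_def ins_Suc using *(3) by simp
  consider "splits (butlast \<pi>) \<noteq> {}" | "splits (removeAll n \<pi>) \<noteq> {}"
    | "splits (butlast \<pi>) = {}" "splits (removeAll n \<pi>) = {}" by blast
  then have "f_incompatible (rc q) \<and> f_incompatible (inv_perm (rc q))"
  proof cases
    case 1
    then have "early_splits (rc q)" using early_splits_overlap_last[OF assms(1-3)] pi by simp
    then show ?thesis using early_splits_f_incompatible[OF rp avr] by blast
  next
    case 2
    then have "early_splits (inv_perm (rc q))" using early_splits_overlap_max[OF assms] pi by simp
    from early_splits_f_incompatible[OF inv_perm_perms[OF rp] avir this]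
    show ?thesis using inv_perm_inv_perm[OF rp] by simp
  next
    case 3
    then show ?thesis using f_incompatible_rc_witness[OF ep(3,1,2)] *(2) by simp
  qed
  then show "f_incompatible (rc q)" "f_incompatible (inv_perm (rc q))" by blast+
qed

text \<open>An embedding of \<open>q\<close> into \<open>\<pi>\<close> misses only one entry, so the rank of the first entry drops by at most one.\<close>

lemma embedding_hd_le:
  assumes "\<pi> \<in> perms (Suc n)" "q \<in> perms n" "0 < n" "strict_mono_on {..<n} g" "g ` {..<n} \<subseteq> {..<Suc n}"
    "\<forall>i<n. \<forall>j<n. \<pi> ! g i < \<pi> ! g j \<longleftrightarrow> q ! i < q ! j" "g 0 = 0"
  shows "hd \<pi> \<le> Suc (hd q)"
proof -
  define A B where "A = {j. j < Suc n \<and> \<pi> ! j \<le> \<pi> ! 0}" and "B = {i. i < n \<and> q ! i \<le> q ! 0}"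
  have cA: "hd \<pi> = card A"
    using perms_nth_eq_card[OF assms(1), of 0] hd_nth_perm[OF assms(1)] by (simp add: A_def)
  have cB: "hd q = card B"
    using perms_nth_eq_card[OF assms(2,3)] hd_nth_perm[OF assms(2,3)] by (simp add: B_def)
  have inj: "inj_on g {..<n}" using assms(4) by (rule strict_mono_on_imp_inj_on)
  have "card ({..<Suc n} - g ` {..<n}) = 1"
    using assms(5) card_image[OF inj] by (subst card_Diff_subset) simp_all
  then obtain m where m: "{..<Suc n} - g ` {..<n} = {m}" by (auto simp: card_1_singleton_iff)
  have "A \<subseteq> insert m (g ` B)"
  proof
    fix j assume j: "j \<in> A"
    show "j \<in> insert m (g ` B)"
    proof (cases "j \<in> g ` {..<n}")
      case True
      then obtain i where i: "i < n" "j = g i" by blast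
      have "\<not> \<pi> ! g 0 < \<pi> ! g i" using j i assms(7) by (simp add: A_def)
      then have "\<not> q ! 0 < q ! i" using assms(3,6) i by blast
      then show ?thesis using i by (simp add: B_def)
    next
      case False
      have "j \<in> {..<Suc n}" using j by (simp add: A_def)
      then show ?thesis using False m by blast
    qed
  qed
  then have "card A \<le> card (insert m (g ` B))" by (intro card_mono) (simp_all add: B_def)
  also have "\<dots> \<le> Suc (card (g ` B))" by (rule card_insert_le_m1) simp_all
  also have "card (g ` B) \<le> card B" by (rule card_image_le) (simp add: B_def)
  finally show ?thesis using cA cB by simp
qed

text \<open>F starts with a, 1, 2, and dropping 1 and 2 leaves q shifted by 2. An occurrence of q in
  \<pi> would omit one entry. If it keeps the first entry, the rank of that is still at least b + 1;
  if it omits it, it starts with 1, whereas q starts with b > 1.\<close>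

lemma (in witness) indec_tail_pattern:
  assumes "\<alpha> = [1]" "c = 1" "a = Suc (Suc b)" "1 < b" "q = ins b \<tau>"
  shows "avoids \<pi> q" "\<not> avoids F q" "q \<in> perms (Suc t)"
    "\<pi> = Suc (Suc b) # 1 # map Suc (tl (ins (Suc b) \<tau>))"
proof -
  show qp: "q \<in> perms (Suc t)" unfolding assms(5)
    by (rule ins_perms[OF tau]) (use assms(2,3,4) a_le in auto)
  show pe: "\<pi> = Suc (Suc b) # 1 # map Suc (tl (ins (Suc b) \<tau>))"
    unfolding pi_eq \<tau>'_def using assms(1-3) by (simp add: ins_def)
  have "map (\<lambda>x. x + 2) q = a # map (\<lambda>y. if y + c + 1 < a then y + c + 1 else y + c + 2) \<tau>"
    unfolding assms(5) ins_def using assms(2,3) by simp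
  then have "subseq (map (\<lambda>x. x + 2) q)
      (a # \<alpha> @ Suc c # map (\<lambda>y. if y + c + 1 < a then y + c + 1 else y + c + 2) \<tau>)"
    by (simp add: assms(1) list_emb_Cons)
  then have "subseq (map (\<lambda>x. x + 2) q) F" unfolding F_eq .
  then show "\<not> avoids F q" by (rule not_avoids_map[rotated]) (simp add: strict_mono_on_def)
  show "avoids \<pi> q"
  proof (rule ccontr)
    assume "\<not> avoids \<pi> q"
    moreover have ll: "length \<pi> = Suc (Suc t)" "length q = Suc t"
      using length_perms[OF pi_perms] length_perms[OF qp] assms(2) by simp_all
    ultimately obtain g where g: "strict_mono_on {..<Suc t} g" "g ` {..<Suc t} \<subseteq> {..<Suc (Suc t)}"
      "\<forall>i<Suc t. \<forall>j<Suc t. \<pi> ! g i < \<pi> ! g j \<longleftrightarrow> q ! i < q ! j"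
      unfolding not_avoids_iff by auto
    have pp: "\<pi> \<in> perms (Suc (Suc t))" using pi_perms assms(2) by simp
    show False
    proof (cases "g 0 = 0")
      case True
      have "hd \<pi> \<le> Suc (hd q)" by (rule embedding_hd_le[OF pp qp _ g True]) simp
      then show False using hd_pi assms(3,5) by simp
    next
      case False
      have ge: "Suc i \<le> g i" if "i < Suc t" for i
        using that
      proof (induction i)
        case 0
        then show ?case using False by simp
      next
        case (Suc i)
        have "g i < g (Suc i)" by (rule strict_mono_onD[OF g(1)]) (use Suc(2) in simp_all)
        then show ?case using Suc by simp
      qed
      \<comment> \<open>An embedding that starts at index 2 or later runs out of room.\<close>
      have g0: "g 0 = 1"
      proof (rule ccontr)
        assume "g 0 \<noteq> 1"
        then have "2 \<le> g 0" using False by simp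
        have "i + 2 \<le> g i" if "i < Suc t" for i
          using that
        proof (induction i)
          case 0
          then show ?case using \<open>2 \<le> g 0\<close> by simp
        next
          case (Suc i)
          have "g i < g (Suc i)" by (rule strict_mono_onD[OF g(1)]) (use Suc(2) in simp_all)
          then show ?case using Suc by simp
        qed
        from this[of t] have "t + 2 \<le> g t" by simp
        moreover have "g t < Suc (Suc t)" using g(2) by (simp add: image_subset_iff)
        ultimately show False by simp
      qed
      \<comment> \<open>The least entry of q would have to be matched below the value 1 of
        \<pi>.\<close>
      obtain j where j: "j < Suc t" "q ! j = 1" using perms_surj[OF qp, of 1] by auto
      have "q ! 0 = b" by (simp add: assms(5) ins_def)
      then have "q ! j < q ! 0" using j assms(4) by simp
      then have "\<pi> ! g j < \<pi> ! g 0" using g(3) j(1) by simp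
      then have "\<pi> ! g j < 1" using g0 pe by simp
      moreover have "g j < Suc (Suc t)" using g(2) j(1) by (simp add: image_subset_iff)
      then have "1 \<le> \<pi> ! g j" using perms_nth[OF pp] by blast
      ultimately show False by simp
    qed
  qed
qed

lemma indec_tail_witness:
  assumes "q \<in> perms n" "indec_tail q"
  shows "witness [1] (del q (hd q)) 1 (n - 1) (Suc (Suc (hd q)))" "q = ins (hd q) (del q (hd q))"
proof -
  have it: "1 < hd q" "hd q < n" "splits (tl q) = {}" "avoids (tl q) [2,1,3]"
    using assms length_perms[OF assms(1)] by (auto simp: indec_tail_def)
  have n0: "0 < n" using it by simp
  define \<rho> where "\<rho> = del q (hd q)"
  have oi: "order_iso \<rho> (tl q)" unfolding \<rho>_def by (rule tl_order_iso_del[OF assms(1) n0])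
  have rp: "\<rho> \<in> perms (n - 1)"
    unfolding \<rho>_def by (rule del_perms[OF assms(1) perms_hd_last(1)[OF assms(1) n0]])
  have sp: "splits \<rho> = {}" using splits_order_iso[OF oi] it(3) by simp
  have p1: "[1] \<in> perms 1" by (simp add: perms_iff)
  have "avoids \<rho> [2,1,3]" using avoids_order_iso[OF oi] it(4) by blast
  moreover have "avoids [1] [1,3,2]" by (rule avoids_longer) simp
  ultimately have "avoids (dsum [1] \<rho>) [1,3,2,4]" using avoids_dsum_1324I[OF p1 rp] by blast
  then show "witness [1] \<rho> 1 (n - 1) (Suc (Suc (hd q)))"
    using it rp sp p1 by unfold_locales simp_all
  show "q = ins (hd q) \<rho>" using ins_del[OF assms(1) n0] by (simp add: \<rho>_def)
qed

lemma indec_tail_f_incompatible: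
  assumes "q \<in> perms n" "indec_tail q"
  shows "f_incompatible q" "f_incompatible (inv_perm q)"
proof -
  have h: "1 < hd q" using assms(2) by (simp add: indec_tail_def)
  interpret witness "[1]" "del q (hd q)" 1 "n - 1" "Suc (Suc (hd q))"
    by (rule indec_tail_witness(1)[OF assms])
  note ip = indec_tail_pattern[OF refl refl refl h indec_tail_witness(2)[OF assms]]
  show "f_incompatible q" "f_incompatible (inv_perm q)"
    using f_incompatible_witness[OF ip(3,1,2)] by blast+
qed

lemma indec_tail_no_split:
  assumes "q \<in> perms n" "indec_tail q" shows "splits q = {}"
proof (rule equals0I)
  fix c assume "c \<in> splits q"
  then have "c - 1 \<in> splits (tl q)" using split_tl(1)[OF assms(1)] assms(2) by (simp add: indec_tail_def)
  then show False using assms(2) by (simp add: indec_tail_def)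
qed

text \<open>The second entry 1 forbids a cut right behind the larger first entry; later cuts merely
  move by one. This relates the cuts of the longer witness to those of q with b and b + 1
  exchanged.\<close>

lemma splits_insert_1:
  assumes "d \<in> splits (Suc h # 1 # map Suc s)" "0 < h"
  shows "d - 1 \<in> splits (h # s)"
proof -
  have d: "0 < d" "d < Suc (Suc (length s))"
    and lt: "\<And>x y. x \<in> set (take d (Suc h # 1 # map Suc s)) \<Longrightarrow> y \<in> set (drop d (Suc h # 1 # map Suc s)) \<Longrightarrow> x < y"
    using assms(1) unfolding splits_def by simp_all
  have "d \<noteq> 1"
  proof
    assume "d = 1"
    then have "Suc h < 1" using lt[of "Suc h" 1] by simp
    then show False by simp
  qed
  then obtain k where k: "d = Suc (Suc k)" using d(1) by (metis One_nat_def Suc_pred not_gr_zero)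
  have "x < y" if "x \<in> set (take (Suc k) (h # s))" "y \<in> set (drop (Suc k) (h # s))" for x y
  proof -
    have "Suc x < Suc y" by (rule lt) (use that k in \<open>auto simp: take_map drop_map\<close>)
    then show ?thesis by simp
  qed
  then show ?thesis using k d by (simp add: splits_def)
qed

text \<open>If the last entry is not 1, the absence of cuts in q gives the bound of
  \<open>early_splits_rcI\<close> through \<open>split_butlast\<close>. If it is 1,
  \<open>rc q\<close> starts with its maximum, and \<open>max_head\<close> requires two cuts of
  \<open>butlast q\<close>. Besides d, also d - 1 is one: the entry at index d - 1 exceeds those at
  indices 1, ..., d - 2, since otherwise the entry at index d would complete a 213 in
  \<open>tl q\<close>; and it exceeds b, because b + 1 occurs among the indices 1, ..., d -
  1.\<close>

lemma indec_tail_overlap_last: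
  assumes "q \<in> perms n" "indec_tail q"
    and "d \<in> splits (map (transpose (hd q) (Suc (hd q))) (butlast q))"
  shows "early_splits (rc q) \<or> max_head (rc q)"
proof -
  define b s where "b = hd q" and "s = butlast q"
  have l: "length q = n" "distinct q" "set q = {1..n}" using assms(1) length_perms perms_iff by auto
  have it: "1 < b" "b < n" "splits (tl q) = {}" "avoids (tl q) [2,1,3]"
    using assms l by (auto simp: indec_tail_def b_def)
  have n0: "0 < n" using it by simp
  obtain T where q: "q = b # T" using it(2) l b_def by (cases q) auto
  have T: "T \<noteq> []" using it l q by auto
  then have s: "s = b # butlast T" by (simp add: s_def q)
  have ls: "length s = n - 1" "distinct s" using l by (simp_all add: s_def distinct_butlast)
  have d: "d \<in> splits s" "Suc b \<notin> set (drop d s)"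
    using splits_map_transpose[of b "butlast T" d] assms(3) ls(2) unfolding s_def[symmetric] b_def[symmetric]
    by (simp_all add: s)
  have lq: "last q \<in> {1..n}" by (rule perms_hd_last(2)[OF assms(1) n0])
  have nth_s: "s ! i = q ! i" if "i < n - 1" for i using that l by (simp add: s_def nth_butlast)
  show ?thesis
  proof (cases "last q = 1")
    case False
    have "last q < c + 2" if c: "c \<in> splits (butlast q)" for c
      using split_butlast(2)[OF assms(1) c] indec_tail_no_split[OF assms(1,2)] by fastforce
    then have "early_splits (rc q)"
      using early_splits_rcI[OF assms(1) n0] False lq d(1) by (fastforce simp: s_def)
    then show ?thesis by blast
  next
    case True
    have ss: "set s = {1..n} - {1}"
    proof -
      have "q = s @ [1]" using True q by (metis append_butlast_last_id list.distinct(1) s_def)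
      then have "set q = insert 1 (set s)" "1 \<notin> set s" using l(2) by auto
      then show ?thesis using l(3) by auto
    qed
    have dl: "0 < d" "d < n - 1" using d(1) ls by (auto simp: splits_def)
    have "Suc b \<in> set s" unfolding ss using it by simp
    then have sb: "Suc b \<in> set (take d s)" using d(2) by (metis UnE append_take_drop_id set_append)
    \<comment> \<open>These b values show b \<le> d, so d - 1 is positive and can be a cut.\<close>
    have "{2..Suc b} \<subseteq> set (take d s)"
    proof
      fix y assume y: "y \<in> {2..Suc b}"
      then have "y \<in> set s" unfolding ss using it by simp
      then consider "y \<in> set (take d s)" | "y \<in> set (drop d s)" by (metis UnE append_take_drop_id set_append)
      then show "y \<in> set (take d s)"
      proof cases
        case 2
        then have "Suc b < y" using d(1) sb by (auto simp: splits_def)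
        then show ?thesis using y by simp
      qed
    qed
    then have "card {2..Suc b} \<le> card (set (take d s))" by (intro card_mono) simp_all
    also have "\<dots> \<le> d" by (metis card_length length_take min.cobounded2 order.trans)
    finally have bd: "b \<le> d" by simp
    have no213: False if "0 < i" "i < j" "j < k" "k < n" "q ! j < q ! i" "q ! i < q ! k" for i j k
    proof -
      have "tl q ! (i - 1) = q ! i" "tl q ! (j - 1) = q ! j" "tl q ! (k - 1) = q ! k"
        using that q by simp_all
      moreover have "i - 1 < j - 1" "j - 1 < k - 1" "k - 1 < length (tl q)" using that l by simp_all
      ultimately have "\<not> avoids (tl q) [2,1,3]" unfolding contains_213_iff using that(5,6) by metis
      then show False using it(4) by blast
    qed
    have sd: "\<And>i j. i < d \<Longrightarrow> d \<le> j \<Longrightarrow> j < n - 1 \<Longrightarrow> s ! i < s ! j"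
      using d(1) ls unfolding splits_iff_nth by simp
    have "s ! i < s ! j" if ij: "i < d - 1" "d - 1 \<le> j" "j < n - 1" for i j
    proof (cases "d \<le> j")
      case True
      then show ?thesis using sd[of i j] ij by simp
    next
      case False
      then have j: "j = d - 1" using ij by simp
      have before: "s ! m < s ! j" if m: "0 < m" "m < j" for m
      proof (rule ccontr)
        assume "\<not> s ! m < s ! j"
        moreover have "s ! m \<noteq> s ! j" using ls m ij by (simp add: nth_eq_iff_index_eq)
        ultimately have "s ! j < s ! m" by simp
        moreover have "s ! m < s ! d" using sd[of m d] m j dl by simp
        moreover have "d < n" "j < d" "m < n - 1" using dl j m by linarith+
        ultimately show False using no213[of m j d] m dl ij nth_s by simp
      qed
      show ?thesis
      proof (cases "i = 0")
        case False
        then show ?thesis using before ij j by simp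
      next
        case True
        obtain m where m: "m < d" "s ! m = Suc b" using sb dl ls by (auto simp: in_set_conv_nth)
        have "m \<noteq> 0" using m(2) by (cases m) (simp_all add: s)
        then have "m = j \<or> s ! m < s ! j" using before[of m] m(1) j by linarith
        then have "Suc b \<le> s ! j" using m(2) by auto
        then show ?thesis using True by (simp add: s)
      qed
    qed
    then have d1: "d - 1 \<in> splits s" unfolding splits_iff_nth using bd it(1) dl ls by simp
    have dr: "distinct (rc q)" "rc q \<noteq> []" using rc_perms[OF assms(1)] n0 by (auto simp: perms_iff)
    have st: "splits (tl (rc q)) = (\<lambda>c. n - 1 - c) ` splits s"
    proof -
      have "q \<noteq> []" using q by blast
      then show ?thesis
        using splits_removeAll_hd_rc[OF assms(1) n0]
        by (simp add: removeAll_hd[OF dr] removeAll_last[OF l(2)] s_def)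
    qed
    have "{n - 1 - d, n - 1 - (d - 1)} \<subseteq> splits (tl (rc q))" unfolding st using d(1) d1 by blast
    then have "card {n - 1 - d, n - 1 - (d - 1)} \<le> card (splits (tl (rc q)))"
      by (rule card_mono[OF finite_splits])
    moreover have "n - 1 - d \<noteq> n - 1 - (d - 1)" using dl by linarith
    ultimately have "2 \<le> card (splits (tl (rc q)))" by simp
    then have "max_head (rc q)" unfolding max_head_def hd_rc[OF assms(1) n0] using True l by simp
    then show ?thesis by blast
  qed
qed

lemma indec_tail_overlap_max:
  assumes "q \<in> perms n" "indec_tail q"
    and "d \<in> splits (map (transpose (hd q) (Suc (hd q))) (removeAll n q))"
  shows "early_splits (inv_perm (rc q))"
proof -
  define b where "b = hd q"
  have l: "length q = n" "distinct q" "set q = {1..n}" using assms(1) length_perms perms_iff by auto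
  have bn: "b < n" using assms(2) l by (auto simp: indec_tail_def b_def)
  obtain T where q: "q = b # T" using bn l b_def by (cases q) auto
  have "removeAll n q = b # removeAll n T" using bn by (simp add: q)
  moreover have "distinct (removeAll n q)" using l(2) by (rule distinct_removeAll)
  ultimately have dq: "d \<in> splits (removeAll n q)"
    using splits_map_transpose(1)[of b "removeAll n T" d] assms(3) b_def by simp
  obtain k where k: "k < n" "q ! k = n" using perms_surj[OF assms(1), of n] bn by auto
  have "k \<noteq> 0" using k bn q by (cases k) auto
  moreover have "k \<le> c" if c: "c \<in> splits (removeAll n q)" for c
    using split_removeAll_max(2)[OF assms(1) k(2,1) c] indec_tail_no_split[OF assms(1,2)] by fastforce
  ultimately show ?thesis using early_splits_inv_rcI[OF assms(1) k(2) _ k(1)] dq by blast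
qed

lemma indec_tail_f_incompatible_rc:
  assumes "q \<in> perms n" "avoids q [1,3,2,4]" "indec_tail q" "Suc (hd q) < n"
  shows "f_incompatible (rc q)" "f_incompatible (inv_perm (rc q))"
proof -
  define b where "b = hd q"
  have l: "length q = n" "distinct q" "set q = {1..n}" using assms(1) length_perms perms_iff by auto
  have h: "1 < b" using assms(3) by (simp add: indec_tail_def b_def)
  note rp = rc_perms[OF assms(1)]
  have avr: "avoids (rc q) [1,3,2,4]" using avoids_rc[OF assms(1) perm_1324] rc_1324 assms(2) by simp
  have avir: "avoids (inv_perm (rc q)) [1,3,2,4]"
    using avoids_inv_perm[OF rp perm_1324] inv_perm_1324 avr by simp
  interpret witness "[1]" "del q b" 1 "n - 1" "Suc (Suc b)"
    using indec_tail_witness(1)[OF assms(1,3)] by (simp add: b_def)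
  have qi: "q = ins b (del q b)" using indec_tail_witness(2)[OF assms(1,3)] by (simp add: b_def)
  note ip = indec_tail_pattern[OF refl refl refl h qi]
  define tr where "tr = transpose b (Suc b)"
  obtain T where q: "q = b # T" using assms(4) l b_def by (cases q) auto
  have T: "T \<noteq> []" using assms(4) l q by auto
  have trb: "tr b = Suc b" by (simp add: tr_def)
  have "ins (Suc b) (del q b) = map tr q" unfolding ins_Suc tr_def using qi by simp
  then have "tl (ins (Suc b) (del q b)) = map tr T" by (simp add: q)
  then have pi: "\<pi> = Suc (Suc b) # 1 # map Suc (map tr T)" using ip(4) by simp
  have bl: "butlast \<pi> = Suc (Suc b) # 1 # map Suc (map tr (butlast T))"
    unfolding pi using T by (simp add: map_butlast)
  have NN: "N = Suc n" using assms(4) by simp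
  \<comment> \<open>Here q_1 < n - 1 enters: the exchange of b and b + 1 fixes n, so it commutes
    with deleting the maximum.\<close>
  have trn: "tr x = n \<longleftrightarrow> x = n" for x
    using assms(4) by (auto simp: tr_def transpose_def b_def)
  have ra: "removeAll N \<pi> = Suc (Suc b) # 1 # map Suc (map tr (removeAll n T))"
  proof -
    have "removeAll (Suc n) (map Suc (map tr T)) = map Suc (map tr (removeAll n T))"
      using trn by (simp add: removeAll_filter_not_eq filter_map comp_def eq_commute[of n])
    then show ?thesis unfolding NN pi using assms(4) by (simp add: b_def)
  qed
  have early: "f_incompatible (rc q) \<and> f_incompatible (inv_perm (rc q))" if "early_splits (rc q)"
    using early_splits_f_incompatible[OF rp avr that] by blast
  consider d where "d \<in> splits (butlast \<pi>)" | d where "d \<in> splits (removeAll N \<pi>)"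
    | "splits (butlast \<pi>) = {}" "splits (removeAll N \<pi>) = {}" by blast
  then have "f_incompatible (rc q) \<and> f_incompatible (inv_perm (rc q))"
  proof cases
    case (1 d)
    then have "d - 1 \<in> splits (Suc b # map tr (butlast T))"
      unfolding bl by (rule splits_insert_1) simp
    moreover have "map tr (butlast q) = Suc b # map tr (butlast T)" using T by (simp add: q trb)
    ultimately have "early_splits (rc q) \<or> max_head (rc q)"
      using indec_tail_overlap_last[OF assms(1,3)] by (simp add: tr_def b_def)
    then show ?thesis using early max_head_f_incompatible[OF rp avr] by blast
  next
    case (2 d)
    then have "d - 1 \<in> splits (Suc b # map tr (removeAll n T))"
      unfolding ra by (rule splits_insert_1) simp
    moreover have "map tr (removeAll n q) = Suc b # map tr (removeAll n T)"
      using assms(4) by (simp add: q trb)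
    ultimately have "early_splits (inv_perm (rc q))"
      using indec_tail_overlap_max[OF assms(1,3)] by (simp add: tr_def b_def)
    from early_splits_f_incompatible[OF inv_perm_perms[OF rp] avir this]
    show ?thesis using inv_perm_inv_perm[OF rp] by simp
  next
    case 3
    then show ?thesis using f_incompatible_rc_witness[OF ip(3,1,2)] by blast
  qed
  then show "f_incompatible (rc q)" "f_incompatible (inv_perm (rc q))" by blast+
qed

subsection \<open>The four conditions\<close>

lemma two_le_card_splits:
  assumes "c \<in> splits s" "d \<in> splits s" "c \<noteq> d" shows "2 \<le> card (splits s)"
proof -
  have "card {c, d} \<le> card (splits s)" by (rule card_mono[OF finite_splits]) (use assms in simp)
  then show ?thesis using assms(3) by simp
qed

lemma comp_num_del_hd:
  assumes "q \<in> perms n" "1 < n"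
  shows "comp_num (del q (hd q)) = Suc (card (splits (tl q)))"
proof -
  have n0: "0 < n" using assms(2) by simp
  have "del q (hd q) \<in> perms (n - 1)" by (rule del_perms[OF assms(1) perms_hd_last(1)[OF assms(1) n0]])
  then show ?thesis
    using comp_num_eq splits_order_iso[OF tl_order_iso_del[OF assms(1) n0]] assms(2) by simp
qed

text \<open>A cut c of \<open>tl q\<close> with \<open>hd q \<le> c\<close> yields the cut c + 1 of
  q, then its only one. As \<open>tl q\<close> has more cuts than q, it has another one; this must
  be less than \<open>hd q\<close> - 1, or it would also yield a cut of q. By
  \<open>splits_between\<close>, \<open>hd q\<close> - 1 is then a cut of \<open>tl q\<close>, and
  \<open>hd q\<close> is a second cut of q.\<close>

lemma cond_b_early_splits:
  assumes "q \<in> perms n" "avoids q [1,3,2,4]" "\<not> 2 \<le> card (splits q)" "cond_b q"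
  shows "early_splits q"
proof -
  have l: "length q = n" "distinct q" using assms(1) length_perms perms_iff by auto
  have hn: "hd q < n" using assms(4) l by (simp add: cond_b_def)
  have h1: "1 \<le> hd q" using perms_hd_last(1)[OF assms(1)] hn by simp
  have n1: "1 < n" using hn h1 by simp
  have gt: "card (splits q) < card (splits (tl q))"
    using assms(4) comp_num_eq[OF assms(1)] comp_num_del_hd[OF assms(1) n1] n1 by (simp add: cond_b_def)
  have av: "avoids (tl q) [1,3,2,4]"
    by (rule avoids_subseq[OF assms(2)]) (cases q; auto)
  have dt: "distinct (tl q)" using l(2) by (rule distinct_tl)
  have "c < hd q" if c: "c \<in> splits (tl q)" for c
  proof (rule ccontr)
    assume "\<not> c < hd q"
    then have hc: "hd q \<le> c" by simp
    then have sc: "Suc c \<in> splits q" using split_ConsI[OF assms(1) c] by simp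
    have "1 \<le> card (splits q)" using sc finite_splits[of q] card_gt_0_iff[of "splits q"] by (simp add: Suc_le_eq) blast
    then have "\<not> card (splits (tl q)) \<le> card {c}" using gt by simp
    then have "\<not> splits (tl q) \<subseteq> {c}" using card_mono[of "{c}" "splits (tl q)"] by blast
    then obtain c2 where c2: "c2 \<in> splits (tl q)" "c2 \<noteq> c" by blast
    have "\<not> hd q \<le> Suc c2"
    proof
      assume "hd q \<le> Suc c2"
      then have "Suc c2 \<in> splits q" by (rule split_ConsI[OF assms(1) c2(1)])
      then show False using two_le_card_splits[OF sc] c2(2) assms(3) by auto
    qed
    then have "hd q - 1 \<in> splits (tl q)"
      by (intro splits_between[OF dt av c2(1) c]) (use hc in linarith)+
    then have "Suc (hd q - 1) \<in> splits q" by (rule split_ConsI[OF assms(1)]) simp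
    moreover have "Suc c \<noteq> Suc (hd q - 1)" using h1 hc by arith
    ultimately show False using two_le_card_splits[OF sc] assms(3) by blast
  qed
  moreover have "splits (tl q) \<noteq> {}" using gt by auto
  ultimately show ?thesis unfolding early_splits_def l(1) using hn by blast
qed

text \<open>The first entry equals the length c of the first component, and c is the only cut of q.
  Removing the first entry leaves the cut c - 1, while a cut of \<open>tl q\<close> at c or later
  would yield another cut of q.\<close>

lemma cond_c_early_splits:
  assumes "q \<in> perms n" "cond_c q"
  shows "early_splits q"
proof -
  note cs = components_spec[OF assms(1)]
  have cc: "1 < hd q" "length (components q) = 2" "hd (hd (components q)) = Max (set (hd (components q)))"
    using assms(2) by (auto simp: cond_c_def comp_num_def)
  obtain \<alpha> \<beta> where ab: "components q = [\<alpha>, \<beta>]" using cc(2) by (auto simp: numeral_2_eq_2 length_Suc_conv)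
  define c where "c = length \<alpha>"
  have al: "\<alpha> \<in> perms c" "0 < c" "splits \<alpha> = {}" "\<beta> \<in> perms (length \<beta>)" "0 < length \<beta>" "splits \<beta> = {}"
    using cs(1) ab by (simp_all add: nonempty_indecomposable_iff c_def)
  have q: "q = dsum \<alpha> \<beta>" using cs(2) ab by simp
  have sq: "splits q = {c}" unfolding q using splits_dsum[OF al(1,4,2,5)] al(3,6) by simp
  have "set \<alpha> = {1..c}" using al(1) by (simp add: perms_iff)
  moreover have "Max {1..c} = c" using al(2) by (intro Max_eqI) auto
  ultimately have "hd \<alpha> = c" using cc(3) ab by simp
  moreover have "\<alpha> \<noteq> []" using al(2) c_def by auto
  ultimately have hq: "hd q = c" by (simp add: q dsum_def)
  have "c < length q" using al(5) by (simp add: q c_def)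
  moreover have "c - 1 \<in> splits (tl q)" by (rule split_tl(1)[OF assms(1) _ cc(1)]) (simp add: sq)
  moreover have "j < c" if j: "j \<in> splits (tl q)" for j
  proof (rule ccontr)
    assume "\<not> j < c"
    then have "Suc j \<in> splits q" using split_ConsI[OF assms(1) j] hq by simp
    then show False using sq \<open>\<not> j < c\<close> by simp
  qed
  ultimately show ?thesis unfolding early_splits_def hq by blast
qed

text \<open>If \<open>tl q\<close> had a cut c with \<open>hd q \<le> c\<close>, its first c entries
  would be increasing, because an inversion among them would form a 213 with the entry behind the
  cut. Then \<open>hd q\<close> - 1 is a cut of \<open>tl q\<close> too, and q has the two cuts
  \<open>hd q\<close> and c + 1.\<close>

lemma cond_d_cases:
  assumes "q \<in> perms n" "\<not> 2 \<le> card (splits q)" "cond_d q"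
  shows "early_splits q \<or> indec_tail q"
proof -
  have l: "length q = n" "distinct q" using assms(1) length_perms perms_iff by auto
  have cd: "1 < hd q" "hd q < n" "avoids (del q (hd q)) [2,1,3]"
    using assms(3) l by (auto simp: cond_d_def)
  have n0: "0 < n" using cd by simp
  have av: "avoids (tl q) [2,1,3]"
    using avoids_order_iso[OF tl_order_iso_del[OF assms(1) n0]] cd(3) by blast
  have dt: "distinct (tl q)" using l(2) by (rule distinct_tl)
  have "c < hd q" if c: "c \<in> splits (tl q)" for c
  proof (rule ccontr)
    assume "\<not> c < hd q"
    then have hc: "hd q \<le> c" by simp
    then have sc: "Suc c \<in> splits q" using split_ConsI[OF assms(1) c] by simp
    have lc: "c < length (tl q)" using c by (simp add: splits_def)
    have "tl q ! i < tl q ! j" if ij: "i < hd q - 1" "hd q - 1 \<le> j" "j < length (tl q)" for i j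
    proof (rule ccontr)
      assume "\<not> ?thesis"
      moreover have "tl q ! i \<noteq> tl q ! j" using dt ij nth_eq_iff_index_eq[OF dt, of i j] by simp
      ultimately have ji: "tl q ! j < tl q ! i" by simp
      have ic: "tl q ! i < tl q ! m" if "c \<le> m" "m < length (tl q)" for m
      proof -
        have "i < c" using ij(1) hc by simp
        then show ?thesis using c that unfolding splits_iff_nth by blast
      qed
      then have "j < c" using ij(3) ji by (meson not_less not_less_iff_gr_or_eq)
      moreover have "i < j" using ij by simp
      ultimately have "\<not> avoids (tl q) [2,1,3]"
        unfolding contains_213_iff using ji ic[of c] lc by blast
      then show False using av by blast
    qed
    then have "hd q - 1 \<in> splits (tl q)" unfolding splits_iff_nth using cd(1) hc lc by simp
    then have "Suc (hd q - 1) \<in> splits q" by (rule split_ConsI[OF assms(1)]) simp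
    moreover have "Suc c \<noteq> Suc (hd q - 1)" using cd(1) hc by arith
    ultimately show False using two_le_card_splits[OF sc] assms(2) by blast
  qed
  then show ?thesis unfolding early_splits_def indec_tail_def l(1) using cd av by blast
qed

lemma cond_a_iff:
  assumes "q \<in> perms n" shows "cond_a q \<longleftrightarrow> 2 \<le> card (splits q)"
proof (cases "n = 0")
  case True
  then have "q = []" using length_perms[OF assms] by simp
  moreover have "components [] = []" using components_foldr_dsum[of "[]"] by simp
  ultimately show ?thesis by (simp add: cond_a_def comp_num_def splits_def)
next
  case False
  then show ?thesis using comp_num_eq[OF assms] by (simp add: cond_a_def)
qed

lemma cond_bcd_cases:
  assumes "q \<in> perms n" "avoids q [1,3,2,4]" "\<not> 2 \<le> card (splits q)"
    "cond_b q \<or> cond_c q \<or> cond_d q"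
  shows "early_splits q \<or> indec_tail q"
  using assms cond_b_early_splits cond_c_early_splits cond_d_cases by blast

lemma card_splits_rc:
  assumes "\<pi> \<in> perms n" shows "card (splits (rc \<pi>)) = card (splits \<pi>)"
proof -
  have "inj_on (\<lambda>c. n - c) (splits \<pi>)"
    using length_perms[OF assms] by (intro inj_onI) (auto simp: splits_def)
  then show ?thesis unfolding splits_rc[OF assms] by (rule card_image)
qed

theorem theorem6p8:
  fixes n :: nat and p :: "nat list"
  assumes "p \<in> perms n" and "avoids p [1,3,2,4]"
    and "(\<exists>q\<in>{p, inv_perm p}. cond_a q \<or> cond_b q \<or> cond_c q \<or> cond_d q) \<or>
         (\<exists>q\<in>{rc p, inv_perm (rc p)}.
            cond_a q \<or> (hd q < n - 1 \<and> (cond_b q \<or> cond_c q \<or> cond_d q)))"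
  shows "f_incompatible p"
proof (cases "2 \<le> card (splits p)")
  case True
  then show ?thesis by (rule two_splits_f_incompatible[OF assms(1,2)])
next
  case False
  \<comment> \<open>All four choices of q have the same number of cuts, so from here on condition
    (a) is excluded for each of them.\<close>
  have sym: "q \<in> perms n \<and> avoids q [1,3,2,4] \<and> \<not> 2 \<le> card (splits q) \<longrightarrow>
      inv_perm q \<in> perms n \<and> avoids (inv_perm q) [1,3,2,4] \<and> \<not> 2 \<le> card (splits (inv_perm q)) \<and>
      rc q \<in> perms n \<and> avoids (rc q) [1,3,2,4] \<and> \<not> 2 \<le> card (splits (rc q))" for q
    using inv_perm_perms rc_perms avoids_inv_perm[OF _ perm_1324, of q n] avoids_rc[OF _ perm_1324, of q n]
      inv_perm_1324 rc_1324 splits_inv_perm card_splits_rc by metis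
  have p: "p \<in> perms n \<and> avoids p [1,3,2,4] \<and> \<not> 2 \<le> card (splits p)" using assms(1,2) False by blast
  have ip: "inv_perm p \<in> perms n \<and> avoids (inv_perm p) [1,3,2,4] \<and> \<not> 2 \<le> card (splits (inv_perm p))"
    and rp: "rc p \<in> perms n \<and> avoids (rc p) [1,3,2,4] \<and> \<not> 2 \<le> card (splits (rc p))"
    using sym p by blast+
  have irp: "inv_perm (rc p) \<in> perms n \<and> avoids (inv_perm (rc p)) [1,3,2,4] \<and>
      \<not> 2 \<le> card (splits (inv_perm (rc p)))"
    using sym rp by blast
  have direct: "f_incompatible q \<and> f_incompatible (inv_perm q)"
    if "q \<in> perms n \<and> avoids q [1,3,2,4] \<and> \<not> 2 \<le> card (splits q)"
      "cond_a q \<or> cond_b q \<or> cond_c q \<or> cond_d q" for q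
    using that cond_a_iff[of q n] cond_bcd_cases[of q n] early_splits_f_incompatible[of q n]
      indec_tail_f_incompatible[of q n] by blast
  \<comment> \<open>To be applied with q = \<open>rc p\<close> or its inverse, for which p is
    \<open>rc q\<close> or the inverse of \<open>rc q\<close>.\<close>
  have reversed: "f_incompatible (rc q) \<and> f_incompatible (inv_perm (rc q))"
    if "q \<in> perms n \<and> avoids q [1,3,2,4] \<and> \<not> 2 \<le> card (splits q)"
      "cond_a q \<or> (hd q < n - 1 \<and> (cond_b q \<or> cond_c q \<or> cond_d q))" for q
  proof -
    have "\<not> cond_a q" using that(1) cond_a_iff by blast
    then have "Suc (hd q) < n" "early_splits q \<or> indec_tail q" using that cond_bcd_cases by auto
    then show ?thesis
      using that(1) early_splits_f_incompatible_rc[of q n] indec_tail_f_incompatible_rc[of q n] by blast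
  qed
  consider q where "q \<in> {p, inv_perm p}" "cond_a q \<or> cond_b q \<or> cond_c q \<or> cond_d q"
    | q where "q \<in> {rc p, inv_perm (rc p)}" "cond_a q \<or> (hd q < n - 1 \<and> (cond_b q \<or> cond_c q \<or> cond_d q))"
    using assms(3) by blast
  then show ?thesis
  proof cases
    case (1 q)
    then have "f_incompatible q \<and> f_incompatible (inv_perm q)" using direct p ip by blast
    then show ?thesis using 1(1) inv_perm_inv_perm[OF assms(1)] by auto
  next
    case (2 q)
    then have *: "f_incompatible (rc q) \<and> f_incompatible (inv_perm (rc q))" using reversed rp irp by blast
    have "rc (rc p) = p" by (rule rc_rc[OF assms(1)])
    \<comment> \<open>Inversion and reverse-complement are commuting involutions.\<close>
    moreover have "inv_perm (rc (inv_perm (rc p))) = p"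
      using rc_perms[OF assms(1)] inv_perm_rc inv_perm_inv_perm inv_perm_perms rc_rc[OF assms(1)] by metis
    ultimately show ?thesis using 2(1) * by auto
  qed
qed

end
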